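(* Let $\mathfrak o$ be a compact discrete valuation ring with residue field cardinality $q$, let $n\ge 1$, and write $T=q^{-s}$. Then, as rational functions in $T$, $$\zeta_{\mathfrak h_n(\mathfrak o)}(s)=\sum_{\mathbf w\in\mathcal W_n} C_n(\mathbf w)\,\mathrm I_n^+\bigl(q^{-2};X_0(\mathbf w),X_1(\mathbf w),\dots,X_n(\mathbf w)\bigr).$$
   Context: A compact discrete valuation ring is a complete discrete valuation ring with finite residue field. Write $[n]=\{1,\dots,n\}$, $[n]_0=\{0,1,\dots,n\}$. Heisenberg algebra: $\mathfrak h_n(\mathfrak o)$ is the $\mathfrak o$-Lie algebra that is free as an $\mathfrak o$-module on $x_1,\dots,x_{2n},y$, with bracket determined by $[x_{2i-1},x_{2i}]=y$ for $i\in[n]$; all brackets of basis elements not implied by these (via antisymmetry) vanish. Zeta function: $\zeta_{\mathfrak h_n(\mathfrak o)}(s)=\sum_{i\ge0}a_{q^i}\,q^{-is}$, where $a_{q^i}$ is the number of $\mathfrak o$-Lie subalgebras ($\mathfrak o$-submodules closed under the bracket) of $\mathfrak h_n(\mathfrak o)$ of additive index $q^i$. It is a rational function in $T=q^{-s}$ (the identity may equivalently be read as one of formal power series in $T$). Index set and weights: with $w_0:=0$, $$\mathcal W_n=\{(w_1,\dots,w_n)\in\mathbb N_0^n\mid w_i\in\{w_{i-1},\,2i-1-w_{i-1}\}\text{ for } i\in[n]\},\qquad C_n(\mathbf w)=\prod_{i=1}^n\frac1{1-q^{2i-1-2w_i}}.$$ Numerical data: for $k\in[n]$, $X_k(\mathbf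 w)=q^{\sum_{i=1}^k w_i+2k(n-k)}\,T^k$, and $X_0(\mathbf w)=q^{2n}T\,X_n(\mathbf w)$. Gaussian multinomials: $[r]_Y=\frac{1-Y^r}{1-Y}$, $[r]_Y!=\prod_{k=1}^r[k]_Y$, $\binom{a}{b}_Y=\frac{[a]_Y!}{[b]_Y![a-b]_Y!}$, and for $I=\{i_1<\dots<i_\ell\}\subseteq[n]_0$, $\binom nI_Y=\binom n{i_\ell}_Y\binom{i_\ell}{i_{\ell-1}}_Y\cdots\binom{i_2}{i_1}_Y$ (equal to $1$ for $I=\varnothing$). Augmented Igusa function of degree $n$: $$\mathrm I_n^+(Y;X_0,\dots,X_n)=\sum_{I\subseteq[n]_0}\binom nI_Y\prod_{i\in I}\frac{X_i}{1-X_i}.$$ *)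

theory Defs
  imports
    Complex_Main
    "HOL-Library.Function_Algebras"
    "HOL-Library.Product_Plus"
    "HOL-Computational_Algebra.Formal_Power_Series"
begin

section \<open>Compact discrete valuation rings\<close>

lemma module_self: "module ((*) :: 'a \<Rightarrow> 'a \<Rightarrow> 'a::comm_ring_1)"
  by standard (simp_all add: algebra_simps)

text \<open>An ideal is a submodule of the ring regarded as a module over itself.\<close>

definition ring_ideal :: "'a::comm_ring_1 set \<Rightarrow> bool" where
  "ring_ideal I \<longleftrightarrow> module.subspace (*) I"

definition principal_ideal :: "'a::comm_ring_1 set \<Rightarrow> bool" where
  "principal_ideal I \<longleftrightarrow> (\<exists>a. I = module.span (*) {a})"

definition maximal_ideal :: "'a::comm_ring_1 set \<Rightarrow> bool" where
  "maximal_ideal M \<longleftrightarrow> ring_ideal M \<and> M \<noteq> UNIV \<and>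
     (\<forall>J. ring_ideal J \<and> M \<subseteq> J \<longrightarrow> J = M \<or> J = UNIV)"

primrec ideal_power :: "'a::comm_ring_1 set \<Rightarrow> nat \<Rightarrow> 'a set" where
  "ideal_power I 0 = UNIV"
| "ideal_power I (Suc k) = module.span (*) {a * b | a b. a \<in> I \<and> b \<in> ideal_power I k}"

definition additive_quotient :: "'b::ab_group_add set \<Rightarrow> 'b set \<Rightarrow> 'b set set" where
  "additive_quotient A B = A // {(x, y). x \<in> A \<and> y \<in> A \<and> x - y \<in> B}"

text \<open>
  The index is \<open>0\<close> when the quotient is infinite, so that an equation
  \<open>additive_index A B = m\<close> with \<open>m > 0\<close> entails that the quotient is finite.
\<close>

definition additive_index :: "'b::ab_group_add set \<Rightarrow> 'b set \<Rightarrow> nat" where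
  "additive_index A B = card (additive_quotient A B)"

text \<open>
  A discrete valuation ring is a local principal ideal domain that is not a field. The rings
  below are types; the predicates take the type as their argument.
\<close>

definition discrete_valuation_ring :: "'a::idom itself \<Rightarrow> bool" where
  "discrete_valuation_ring _ \<longleftrightarrow>
     (\<forall>I :: 'a set. ring_ideal I \<longrightarrow> principal_ideal I) \<and>
     (\<exists>!M :: 'a set. maximal_ideal M) \<and>
     (\<exists>a :: 'a. a \<noteq> 0 \<and> \<not> a dvd 1)"

definition max_ideal :: "'a::comm_ring_1 set" where
  "max_ideal = (THE M. maximal_ideal M)"

text \<open>
  The two conjuncts say that the canonical map from the ring to the inverse limit of its
  quotients by the powers of \<open>I\<close> is injective and surjective, respectively.
\<close>

definition adically_complete :: "'a::comm_ring_1 set \<Rightarrow> bool" where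
  "adically_complete I \<longleftrightarrow>
     (\<Inter>k. ideal_power I k) = {0} \<and>
     (\<forall>f :: nat \<Rightarrow> 'a. (\<forall>k. f (Suc k) - f k \<in> ideal_power I k) \<longrightarrow>
        (\<exists>x. \<forall>k. x - f k \<in> ideal_power I k))"

definition compact_dvr :: "'a::idom itself \<Rightarrow> bool" where
  "compact_dvr R \<longleftrightarrow> discrete_valuation_ring R \<and>
     adically_complete (max_ideal :: 'a set) \<and>
     finite (additive_quotient UNIV (max_ideal :: 'a set))"

definition residue_card :: "'o::comm_ring_1 itself \<Rightarrow> nat" where
  "residue_card _ = additive_index (UNIV :: 'o set) max_ideal"


section \<open>The Heisenberg Lie algebra and its subalgebra zeta function\<close>

text \<open>
  The pair \<open>(a, z)\<close> stands for \<open>a 1 x\<^sub>1 + \<dots> + a (2n) x\<^sub>2\<^sub>n + z y\<close>; the function \<open>a\<close> vanishes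
  outside \<open>{1..2n}\<close>.
\<close>

type_synonym 'o heis = "(nat \<Rightarrow> 'o) \<times> 'o"

definition heis_carrier :: "nat \<Rightarrow> 'o::comm_ring_1 heis set" where
  "heis_carrier n = {(a, z). \<forall>i. i \<notin> {1..2*n} \<longrightarrow> a i = 0}"

definition heis_scale :: "'o::comm_ring_1 \<Rightarrow> 'o heis \<Rightarrow> 'o heis" where
  "heis_scale c u = (\<lambda>i. c * fst u i, c * snd u)"

definition heis_bracket :: "nat \<Rightarrow> 'o::comm_ring_1 heis \<Rightarrow> 'o heis \<Rightarrow> 'o heis" where
  "heis_bracket n u v =
     (0, \<Sum>i=1..n. fst u (2*i - 1) * fst v (2*i) - fst u (2*i) * fst v (2*i - 1))"

definition heis_x :: "nat \<Rightarrow> 'o::comm_ring_1 heis" where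
  "heis_x j = (\<lambda>i. if i = j then 1 else 0, 0)"

definition heis_y :: "'o::comm_ring_1 heis" where
  "heis_y = (0, 1)"

lemma module_heis: "module (heis_scale :: 'o::comm_ring_1 \<Rightarrow> 'o heis \<Rightarrow> 'o heis)"
  by standard (auto simp: heis_scale_def algebra_simps fun_eq_iff prod_eq_iff)

lemma heis_carrier_submodule: "module.subspace heis_scale (heis_carrier n)"
  by (auto simp: module.subspace_def[OF module_heis] heis_carrier_def heis_scale_def
      zero_prod_def)

lemma heis_bracket_add_left: "heis_bracket n (u + v) w = heis_bracket n u w + heis_bracket n v w"
  by (auto simp: heis_bracket_def algebra_simps simp flip: sum.distrib)

lemma heis_bracket_scale_left: "heis_bracket n (heis_scale c u) v = heis_scale c (heis_bracket n u v)"
  by (auto simp: heis_bracket_def heis_scale_def algebra_simps sum_distrib_left fun_eq_iff)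

lemma heis_bracket_self: "heis_bracket n u u = 0"
  by (simp add: heis_bracket_def mult.commute zero_prod_def)

lemma heis_bracket_swap: "heis_bracket n u v = - heis_bracket n v u"
  by (simp add: heis_bracket_def algebra_simps flip: sum_negf)

lemma heis_bracket_bracket: "heis_bracket n (heis_bracket n u v) w = 0"
  by (simp add: heis_bracket_def zero_prod_def)

lemma heis_bracket_x_x:
  assumes "i < j"
  shows "heis_bracket n (heis_x i) (heis_x j) =
    (if \<exists>k\<in>{1..n}. i = 2*k - 1 \<and> j = 2*k then heis_y else 0 :: 'o::comm_ring_1 heis)"
proof -
  have "(\<Sum>k=1..n. fst (heis_x i :: 'o heis) (2*k - 1) * fst (heis_x j :: 'o heis) (2*k) -
           fst (heis_x i :: 'o heis) (2*k) * fst (heis_x j :: 'o heis) (2*k - 1)) =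
        (\<Sum>k=1..n. if i = 2*k - 1 \<and> j = 2*k then 1 else 0 :: 'o)"
    using assms by (intro sum.cong) (auto simp: heis_x_def)
  also have "\<dots> = (if \<exists>k\<in>{1..n}. i = 2*k - 1 \<and> j = 2*k then 1 else 0)"
  proof (cases "\<exists>k\<in>{1..n}. i = 2*k - 1 \<and> j = 2*k")
    case True
    then obtain k where k: "k \<in> {1..n}" "i = 2*k - 1" "j = 2*k" by blast
    have "(\<Sum>l=1..n. if i = 2*l - 1 \<and> j = 2*l then 1 else 0 :: 'o) =
          (\<Sum>l=1..n. if l = k then 1 else 0)"
      using k by (intro sum.cong) auto
    then show ?thesis using k True by simp
  next
    case False
    then show ?thesis by (auto intro!: sum.neutral)
  qed
  finally show ?thesis by (simp add: heis_bracket_def heis_y_def zero_prod_def)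
qed

lemma heis_bracket_y: "heis_bracket n u heis_y = 0"
  by (simp add: heis_bracket_def heis_y_def zero_prod_def)

definition heis_subalgebra :: "nat \<Rightarrow> 'o::comm_ring_1 heis set \<Rightarrow> bool" where
  "heis_subalgebra n L \<longleftrightarrow> L \<subseteq> heis_carrier n \<and> module.subspace heis_scale L \<and>
     (\<forall>u\<in>L. \<forall>v\<in>L. heis_bracket n u v \<in> L)"

definition num_subalgebras :: "'o::comm_ring_1 itself \<Rightarrow> nat \<Rightarrow> nat \<Rightarrow> nat" where
  "num_subalgebras _ n m =
     card {L :: 'o heis set. heis_subalgebra n L \<and> additive_index (heis_carrier n) L = m}"

text \<open>The zeta function as a power series in \<open>T = q\<^sup>-\<^sup>s\<close>.\<close>

definition heis_zeta :: "'o::comm_ring_1 itself \<Rightarrow> nat \<Rightarrow> rat fps" where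
  "heis_zeta R n = Abs_fps (\<lambda>i. of_nat (num_subalgebras R n (residue_card R ^ i)))"


section \<open>Augmented Igusa functions\<close>

definition gauss_int :: "'a::field \<Rightarrow> nat \<Rightarrow> 'a" where
  "gauss_int Y r = (1 - Y ^ r) / (1 - Y)"

definition gauss_fact :: "'a::field \<Rightarrow> nat \<Rightarrow> 'a" where
  "gauss_fact Y r = (\<Prod>k=1..r. gauss_int Y k)"

definition gauss_binomial :: "'a::field \<Rightarrow> nat \<Rightarrow> nat \<Rightarrow> 'a" where
  "gauss_binomial Y a b = gauss_fact Y a / (gauss_fact Y b * gauss_fact Y (a - b))"

text \<open>For \<open>I = {i\<^sub>1 < \<dots> < i\<^sub>l}\<close> the list below is \<open>[i\<^sub>1, \<dots>, i\<^sub>l, n]\<close>.\<close>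

definition gauss_multinomial :: "'a::field \<Rightarrow> nat \<Rightarrow> nat set \<Rightarrow> 'a" where
  "gauss_multinomial Y n I =
     (let is = sorted_list_of_set I @ [n]
      in \<Prod>j<card I. gauss_binomial Y (is ! Suc j) (is ! j))"

definition augmented_igusa :: "nat \<Rightarrow> 'a::field \<Rightarrow> (nat \<Rightarrow> 'a fps) \<Rightarrow> 'a fps" where
  "augmented_igusa n Y X =
     (\<Sum>I\<in>Pow {0..n}. fps_const (gauss_multinomial Y n I) * (\<Prod>i\<in>I. X i / (1 - X i)))"


section \<open>Index set, weights and numerical data\<close>

text \<open>
  A tuple \<open>(w\<^sub>1, \<dots>, w\<^sub>n)\<close> is a function that vanishes outside \<open>{1..n}\<close>; this includes
  the convention \<open>w\<^sub>0 = 0\<close>. Writing \<open>w i = 2i - 1 - w (i - 1)\<close> as a sum avoids truncated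
  subtraction.
\<close>

definition heis_W :: "nat \<Rightarrow> (nat \<Rightarrow> nat) set" where
  "heis_W n = {w. (\<forall>i. i \<notin> {1..n} \<longrightarrow> w i = 0) \<and>
     (\<forall>i\<in>{1..n}. w i = w (i - 1) \<or> w i + w (i - 1) = 2*i - 1)}"

definition heis_C :: "nat \<Rightarrow> nat \<Rightarrow> (nat \<Rightarrow> nat) \<Rightarrow> rat" where
  "heis_C q n w = (\<Prod>i=1..n. 1 / (1 - of_nat q powi (2 * int i - 1 - 2 * int (w i))))"

definition heis_X :: "nat \<Rightarrow> nat \<Rightarrow> (nat \<Rightarrow> nat) \<Rightarrow> nat \<Rightarrow> rat fps" where
  "heis_X q n w k =
     (let X = (\<lambda>k. fps_const (of_nat q ^ ((\<Sum>i=1..k. w i) + 2*k*(n - k))) * fps_X ^ k)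
      in if k = 0 then fps_const (of_nat q ^ (2*n)) * fps_X * X n else X k)"

end

theory Submission
  imports Defs "HOL-Library.Multiset"
begin

text \<open>
  The theorem follows from a count of lattices by symplectic elementary divisors. The centre of
  the Heisenberg algebra is \<open>\<o> y\<close>, and the bracket is an alternating form \<open>\<omega>\<close> on the
  unimodular symplectic lattice \<open>L = \<o>\<^sup>2\<^sup>n\<close>. A subalgebra of finite index is given by its image \<open>M\<close> in
  \<open>L\<close>, its intersection \<open>p\<^sup>m \<o>\<close> with the centre, and a homomorphism from \<open>M\<close> to \<open>\<o> / p\<^sup>m\<close>. It is
  closed under the bracket iff \<open>\<omega>\<close> takes values in \<open>p\<^sup>m \<o>\<close> on \<open>M\<close>. If \<open>l\<^sub>1 \<ge> \<dots> \<ge> l\<^sub>n\<close> are the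
  exponents of the elementary divisors of \<open>\<omega>\<close> on \<open>M\<close>, the condition reads \<open>m \<le> l\<^sub>n\<close>, and the index of \<open>M\<close>
  is \<open>q\<close> to the power \<open>l\<^sub>1 + \<dots> + l\<^sub>n\<close>. So everything depends on the number \<open>N(l)\<close> of lattices in
  \<open>L\<close> with elementary divisors \<open>l\<close>.

  The Igusa functions on the other side have a term for each \<open>l\<close> and \<open>m\<close> as well. Expanding the
  geometric series gives monomials in \<open>X\<^sub>0, \<dots>, X\<^sub>n\<close>, whose exponents are \<open>m\<close>, the differences
  \<open>l\<^sub>i - l\<^sub>i\<^sub>+\<^sub>1\<close> and \<open>l\<^sub>n - m\<close> (\<open>bij_betw_exponents_subalgebra_types\<close>). Comparing coefficients, the
  theorem becomes the formula \<open>N(l) = R(l) A(l)\<close> of \<open>card_lattices_eq\<close>. Here \<open>A(l)\<close> is the sum over the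
  index set of the theorem with weights \<open>C\<^sub>n(w)\<close> and \<open>q\<close> to the power \<open>l\<^sub>1 w\<^sub>1 + \<dots> + l\<^sub>n w\<^sub>n\<close>
  (\<open>path_sum\<close>), and \<open>R(l)\<close> is a power of \<open>q\<close> times a Gaussian multinomial in \<open>q\<^sup>-\<^sup>2\<close>
  (\<open>orbit_weight\<close>).

  Both sides satisfy the same recursion. For the lattices (\<open>card_lattices_recursion\<close>), let \<open>r = l\<^sub>1\<close> and
  consider the vectors of \<open>M\<close> whose pairings with \<open>M\<close> all lie in \<open>p\<^sup>r \<o>\<close>, modulo \<open>p M\<close>; they form
  a vector space over the residue field whose dimension is twice the multiplicity of \<open>r\<close> in \<open>l\<close>.
  Count the pairs of a lattice \<open>M\<close> and a nonzero such vector. If the vector is primitive in \<open>L\<close>, it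
  splits off a plane from \<open>M\<close> and from \<open>L\<close> simultaneously, and what remains is a lattice of rank
  \<open>2 n - 2\<close> with elementary divisors \<open>l\<^sub>2, \<dots>, l\<^sub>n\<close> (\<open>card_lattices_through_primitive\<close>). Otherwise it is
  \<open>p x\<close> with \<open>x\<close> in \<open>L\<close>, and \<open>M + \<o> x\<close> is a lattice where one \<open>r\<close> is replaced by \<open>r - 1\<close>. The number
  of ways to come back from such a lattice is the number of functionals to the residue field with
  suitable kernel (\<open>card_neighbours\<close>). Splitting off planes relies on a form of Witt cancellation,
  \<open>has_type_perp\<close>.

  The sum over paths satisfies \<open>A(l\<^sub>1, l\<^sub>2, \<dots>) = A(l\<^sub>1 - 1, l\<^sub>2, \<dots>) + q\<^sup>s A(l\<^sub>2, \<dots>)\<close> with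
  \<open>s = l\<^sub>1 + \<dots> + l\<^sub>n\<close>, for arbitrary sequences (\<open>path_sum_head_step\<close>). If \<open>l\<^sub>1 = l\<^sub>2\<close>, the sequence on
  the right is no longer decreasing. But an ascent by one may be exchanged with a descent by one
  (\<open>path_sum_swap\<close>), which carries the lowered entry behind the leading block. Together with the
  behaviour of \<open>R\<close> under both operations this is the recursion for \<open>N\<close>.
\<close>

section \<open>Indices of additive subgroups\<close>

definition add_subgroup :: "'a::ab_group_add set \<Rightarrow> bool" where
  "add_subgroup A \<longleftrightarrow> 0 \<in> A \<and> (\<forall>x\<in>A. \<forall>y\<in>A. x - y \<in> A)"

lemma add_subgroup_0: "add_subgroup A \<Longrightarrow> 0 \<in> A"
  and add_subgroup_diff: "add_subgroup A \<Longrightarrow> x \<in> A \<Longrightarrow> y \<in> A \<Longrightarrow> x - y \<in> A"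
  by (auto simp: add_subgroup_def)

lemma add_subgroup_neg: "add_subgroup A \<Longrightarrow> x \<in> A \<Longrightarrow> - x \<in> A"
  using add_subgroup_diff[of A 0 x] add_subgroup_0[of A] by simp

lemma add_subgroup_add: "add_subgroup A \<Longrightarrow> x \<in> A \<Longrightarrow> y \<in> A \<Longrightarrow> x + y \<in> A"
  using add_subgroup_diff[of A x "- y"] add_subgroup_neg[of A y] by simp

definition coset :: "'a::ab_group_add set \<Rightarrow> 'a \<Rightarrow> 'a set" where
  "coset B x = (\<lambda>z. x + z) ` B"

lemma mem_coset_iff: "y \<in> coset B x \<longleftrightarrow> y - x \<in> B"
  unfolding coset_def by (force simp: image_iff algebra_simps)

lemma coset_eq_iff:
  assumes "add_subgroup B"
  shows "coset B x = coset B y \<longleftrightarrow> x - y \<in> B"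
proof
  assume "coset B x = coset B y"
  moreover have "x \<in> coset B x"
    using assms by (simp add: mem_coset_iff add_subgroup_0)
  ultimately show "x - y \<in> B" by (simp add: mem_coset_iff)
next
  assume xy: "x - y \<in> B"
  have "z - x \<in> B \<longleftrightarrow> z - y \<in> B" for z
    using add_subgroup_add[OF assms _ xy, of "z - x"] add_subgroup_diff[OF assms _ xy, of "z - y"]
    by auto
  then show "coset B x = coset B y" by (auto simp: mem_coset_iff)
qed

lemma coset_zero: "coset B 0 = B"
  by (auto simp: coset_def)

text \<open>
  For a subgroup \<open>B\<close> of \<open>A\<close> this is the additive index. In general it is the index of \<open>A \<inter> B\<close> in
  \<open>A\<close>, which serves to count the cosets of a lattice that are represented in a given module.
\<close>

definition idx :: "'a::ab_group_add set \<Rightarrow> 'a set \<Rightarrow> nat" where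
  "idx A B = card (coset B ` A)"

lemma bij_betw_images_same_kernel:
  assumes "\<And>x y. x \<in> A \<Longrightarrow> y \<in> A \<Longrightarrow> g x = g y \<longleftrightarrow> h x = h y"
  shows "\<exists>k. bij_betw k (g ` A) (h ` A)"
proof -
  define k where "k = (\<lambda>c. h (inv_into A g c))"
  have *: "k (g x) = h x" if "x \<in> A" for x
  proof -
    have "inv_into A g (g x) \<in> A" "g (inv_into A g (g x)) = g x"
      using that by (auto intro: inv_into_into f_inv_into_f)
    then show ?thesis unfolding k_def using assms that by blast
  qed
  have "inj_on k (g ` A)"
    by (rule inj_onI) (auto simp: * assms)
  moreover have "k ` (g ` A) = h ` A" by (force simp: *)
  ultimately show ?thesis unfolding bij_betw_def by blast
qed

lemma card_images_same_kernel:
  assumes "\<And>x y. x \<in> A \<Longrightarrow> y \<in> A \<Longrightarrow> g x = g y \<longleftrightarrow> h x = h y"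
  shows "card (g ` A) = card (h ` A)" "finite (g ` A) \<longleftrightarrow> finite (h ` A)"
  using bij_betw_images_same_kernel[of A g h, OF assms] bij_betw_same_card bij_betw_finite
  by blast+

lemma additive_index_eq_idx:
  assumes "add_subgroup A" "add_subgroup B" "B \<subseteq> A"
  shows "additive_index A B = idx A B"
proof -
  define R where "R = {(x, y). x \<in> A \<and> y \<in> A \<and> x - y \<in> B}"
  have quot: "A // R = (\<lambda>x. R `` {x}) ` A" by (auto simp: quotient_def)
  have "R `` {x} = coset B x" if "x \<in> A" for x
  proof -
    have "x - y \<in> B \<longleftrightarrow> y - x \<in> B" for y
      using add_subgroup_neg[OF assms(2), of "x - y"] add_subgroup_neg[OF assms(2), of "y - x"]
      by auto
    moreover have "y \<in> A" if "y - x \<in> B" for y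
      using add_subgroup_add[OF assms(1), of "y - x" x] that \<open>x \<in> A\<close> assms(3) by auto
    ultimately show ?thesis using that by (auto simp: R_def mem_coset_iff)
  qed
  then have "A // R = coset B ` A" unfolding quot by simp
  then show ?thesis
    by (simp add: additive_index_def additive_quotient_def idx_def R_def)
qed

lemma idx_self: "add_subgroup A \<Longrightarrow> idx A A = 1"
proof -
  assume A: "add_subgroup A"
  have "coset A ` A = {A}"
  proof -
    have "coset A x = A" if "x \<in> A" for x
      using coset_eq_iff[OF A, of x 0] that by (simp add: coset_zero)
    then show ?thesis using A add_subgroup_0 by force
  qed
  then show ?thesis by (simp add: idx_def)
qed

lemma idx_eq_1_imp_eq:
  assumes "add_subgroup A" "add_subgroup B" "B \<subseteq> A" "idx A B = 1"
  shows "A = B"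
proof -
  obtain c where c: "coset B ` A = {c}"
    using assms(4) unfolding idx_def by (auto simp: card_1_singleton_iff)
  have "x \<in> B" if "x \<in> A" for x
  proof -
    have "coset B x = coset B 0" using c that add_subgroup_0[OF assms(1)] by blast
    then show ?thesis using coset_eq_iff[OF assms(2)] by auto
  qed
  then show ?thesis using assms(3) by auto
qed

text \<open>
  Nearly all indices below are computed with this form of the isomorphism theorem: the
  homomorphism \<open>f\<close> induces an isomorphism \<open>A/B \<rightarrow> A'/B'\<close>, but need not map \<open>A\<close> onto \<open>A'\<close>.
\<close>

lemma idx_cong_hom:
  assumes "add_subgroup B" "add_subgroup B'"
    and diff: "\<And>x y. x \<in> A \<Longrightarrow> y \<in> A \<Longrightarrow> f (x - y) = f x - f y"
    and closed: "\<And>x y. x \<in> A \<Longrightarrow> y \<in> A \<Longrightarrow> x - y \<in> A"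
    and into: "\<And>x. x \<in> A \<Longrightarrow> f x \<in> A'"
    and ker: "\<And>x. x \<in> A \<Longrightarrow> f x \<in> B' \<longleftrightarrow> x \<in> B"
    and onto: "\<And>y. y \<in> A' \<Longrightarrow> \<exists>x\<in>A. y - f x \<in> B'"
  shows "idx A B = idx A' B'"
proof -
  have "card (coset B ` A) = card ((\<lambda>x. coset B' (f x)) ` A)"
  proof (rule card_images_same_kernel(1))
    fix x y assume xy: "x \<in> A" "y \<in> A"
    then show "coset B x = coset B y \<longleftrightarrow> coset B' (f x) = coset B' (f y)"
      using ker[OF closed[OF xy]]
      by (simp add: coset_eq_iff[OF assms(1)] coset_eq_iff[OF assms(2)] diff)
  qed
  moreover have "(\<lambda>x. coset B' (f x)) ` A = coset B' ` A'"
  proof -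
    have "\<exists>x\<in>A. coset B' y = coset B' (f x)" if "y \<in> A'" for y
      using onto[OF that] coset_eq_iff[OF assms(2)] by blast
    then show ?thesis using into by (auto simp: image_iff)
  qed
  ultimately show ?thesis by (simp add: idx_def)
qed

text \<open>
  The fibres of \<open>A/C \<rightarrow> A/B\<close> are translates of \<open>B/C\<close>. Infinite quotients have index \<open>0\<close>, and the
  formula survives because \<open>A/C\<close> is infinite as soon as one of the other two quotients is.
\<close>

lemma idx_tower:
  assumes A: "add_subgroup A" and B: "add_subgroup B" and C: "add_subgroup C"
    and "C \<subseteq> B" "B \<subseteq> A"
  shows "idx A C = idx A B * idx B C"
proof -
  define F where "F = (\<lambda>c. coset C ` c)"
  have cosets_sub: "c \<subseteq> A" if "c \<in> coset B ` A" for c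
    using that assms add_subgroup_add[OF A] by (auto simp: coset_def)
  have F_card: "card (F c) = idx B C" "finite (F c) \<longleftrightarrow> finite (coset C ` B)"
    if c: "c \<in> coset B ` A" for c
  proof -
    obtain x where x: "x \<in> A" "c = coset B x" using c by auto
    have eq: "F c = (\<lambda>z. coset C (x + z)) ` B" by (auto simp: F_def x coset_def)
    have ker: "coset C (x + z) = coset C (x + z') \<longleftrightarrow> coset C z = coset C z'" for z z'
      by (simp add: coset_eq_iff[OF C])
    show "card (F c) = idx B C" unfolding eq idx_def
      by (rule card_images_same_kernel(1)) (rule ker)
    show "finite (F c) \<longleftrightarrow> finite (coset C ` B)" unfolding eq
      by (rule card_images_same_kernel(2)) (rule ker)
  qed
  have union: "coset C ` A = \<Union> (F ` (coset B ` A))"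
  proof -
    have "x \<in> coset B x" for x using B by (simp add: mem_coset_iff add_subgroup_0)
    then show ?thesis using cosets_sub by (fastforce simp: F_def)
  qed
  have disj: "F c \<inter> F c' = {}" if cc: "c \<in> coset B ` A" "c' \<in> coset B ` A" "c \<noteq> c'" for c c'
  proof (rule ccontr)
    assume "F c \<inter> F c' \<noteq> {}"
    then obtain y y' where y: "y \<in> c" "y' \<in> c'" "coset C y = coset C y'"
      by (auto simp: F_def)
    obtain x x' where x: "c = coset B x" "c' = coset B x'" using cc by auto
    have "y - x \<in> B" "y' - x' \<in> B" "y - y' \<in> B"
      using y x assms(4) by (auto simp: mem_coset_iff coset_eq_iff[OF C])
    then have "(y - y') - (y - x) + (y' - x') \<in> B"
      using add_subgroup_add[OF B] add_subgroup_diff[OF B] by blast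
    then have "x - x' \<in> B" by simp
    then show False using cc x coset_eq_iff[OF B] by blast
  qed
  show ?thesis
  proof (cases "finite (coset B ` A)")
    case fin: True
    show ?thesis
    proof (cases "finite (coset C ` B)")
      case True
      have "card (coset C ` A) = (\<Sum>c\<in>coset B ` A. card (F c))"
        unfolding union using fin True F_card(2) disj
        by (intro card_UN_disjoint) auto
      also have "\<dots> = (\<Sum>c\<in>coset B ` A. idx B C)" using F_card(1) by (intro sum.cong) auto
      finally show ?thesis by (simp add: idx_def)
    next
      case False
      have "coset C ` B \<subseteq> coset C ` A" using assms by auto
      then have "infinite (coset C ` A)" using False finite_subset by blast
      then show ?thesis using False by (simp add: idx_def)
    qed
  next
    case False
    have "infinite (coset C ` A)"
    proof
      assume fin: "finite (coset C ` A)"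
      have nonempty: "F c \<noteq> {}" if c: "c \<in> coset B ` A" for c
        using c B add_subgroup_0 by (auto simp: F_def coset_def)
      have "inj_on F (coset B ` A)"
      proof (rule inj_onI)
        fix c c' assume "c \<in> coset B ` A" "c' \<in> coset B ` A" "F c = F c'"
        then show "c = c'" using disj[of c c'] nonempty[of c] by auto
      qed
      moreover have "F ` (coset B ` A) \<subseteq> Pow (coset C ` A)" using union by auto
      ultimately show False using False fin
        by (meson finite_Pow_iff finite_imageD finite_subset)
    qed
    then show ?thesis using False by (simp add: idx_def)
  qed
qed

lemma card_cosets_diff:
  assumes "add_subgroup A" "add_subgroup B" "add_subgroup C" "C \<subseteq> B" "B \<subseteq> A"
    and fin: "idx A C > 0"
  shows "card (coset C ` (A - B)) = idx A C - idx B C"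
proof -
  have "coset C ` (A - B) = coset C ` A - coset C ` B"
  proof -
    have "x \<in> B" if "coset C x = coset C y" "y \<in> B" for x y
    proof -
      have "x - y \<in> B" using that coset_eq_iff[OF assms(3)] assms(4) by auto
      then show ?thesis using add_subgroup_add[OF assms(2), of "x - y" y] that by simp
    qed
    then show ?thesis by fastforce
  qed
  moreover have "coset C ` B \<subseteq> coset C ` A" using assms by auto
  moreover have "finite (coset C ` A)" using fin unfolding idx_def by (meson card_gt_0_iff)
  ultimately show ?thesis unfolding idx_def by (simp add: card_Diff_subset finite_subset)
qed

text \<open>Applied to \<open>f k = p\<^sup>k z\<close>, this puts a power multiple of \<open>z\<close> into every lattice.\<close>

lemma idx_pos_pigeonhole:
  fixes f :: "nat \<Rightarrow> 'a::ab_group_add"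
  assumes "add_subgroup B" "idx A B > 0" "range f \<subseteq> A"
  shows "\<exists>a b. a < b \<and> f a - f b \<in> B"
proof -
  have "finite (coset B ` A)" using assms(2) unfolding idx_def by (rule card_ge_0_finite)
  moreover have "(\<lambda>k. coset B (f k)) ` UNIV \<subseteq> coset B ` A" using assms(3) by auto
  ultimately have "finite ((\<lambda>k. coset B (f k)) ` UNIV)" by (rule finite_subset[rotated])
  then have "\<not> inj (\<lambda>k. coset B (f k))" using finite_imageD infinite_UNIV_nat by blast
  then obtain a b where "a < b" "coset B (f a) = coset B (f b)"
    unfolding inj_def by (metis linorder_neqE_nat)
  then show ?thesis using coset_eq_iff[OF assms(1)] by blast
qed

section \<open>Discrete valuation rings with finite residue field\<close>

text \<open>
  Fixing a uniformizer \<open>p\<close> turns statements about ideals and valuations into divisibility by powers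
  of \<open>p\<close>.
\<close>

locale finite_residue_dvr =
  fixes p :: "'o::idom" and q :: nat
  assumes p_nonzero: "p \<noteq> 0" and p_nonunit: "\<not> p dvd 1"
    and valuation: "\<And>x. x \<noteq> 0 \<Longrightarrow> \<exists>u k. u dvd 1 \<and> x = u * p ^ k"
    and residue: "idx UNIV {x. p dvd x} = q" and q_pos: "q > 0"
begin

lemma unit_if_not_dvd: "\<not> p dvd x \<Longrightarrow> x dvd 1"
proof -
  assume "\<not> p dvd x"
  then have "x \<noteq> 0" by auto
  then obtain u k where uk: "u dvd 1" "x = u * p ^ k" using valuation by blast
  then have "k = 0" using \<open>\<not> p dvd x\<close> by (cases k) auto
  then show ?thesis using uk by simp
qed

lemma p_power_dvd_cancel [simp]: "p ^ i * a dvd p ^ i * b \<longleftrightarrow> a dvd b"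
  using p_nonzero by simp

lemma p_power_dvd_iff: "p ^ i dvd p ^ j \<longleftrightarrow> i \<le> j"
proof
  assume d: "p ^ i dvd p ^ j"
  show "i \<le> j"
  proof (rule ccontr)
    assume "\<not> i \<le> j"
    then have "p ^ j * p dvd p ^ j * 1"
      using d power_le_dvd[of p i "p ^ j" "Suc j"] by (simp add: mult.commute)
    then show False using p_nonunit unfolding p_power_dvd_cancel by simp
  qed
qed (rule le_imp_power_dvd)

lemma unit_times_power:
  assumes "p ^ s dvd x" "\<not> p ^ Suc s dvd x"
  shows "\<exists>c d. c * d = 1 \<and> x = c * p ^ s"
proof -
  obtain c where c: "x = p ^ s * c" using assms(1) by auto
  then have "\<not> p ^ s * p dvd p ^ s * c" using assms(2) by (simp add: mult.commute)
  then have "\<not> p dvd c" by (simp only: p_power_dvd_cancel) simp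
  then obtain d where "1 = c * d" using unit_if_not_dvd by (metis dvdE)
  then show ?thesis using c by (metis mult.commute)
qed

lemma unit_one_minus_power: "k > 0 \<Longrightarrow> (1 - p ^ k) dvd 1"
proof (rule unit_if_not_dvd)
  assume "k > 0"
  show "\<not> p dvd 1 - p ^ k"
  proof
    assume "p dvd 1 - p ^ k"
    moreover have "p dvd p ^ k" using \<open>k > 0\<close> by simp
    ultimately have "p dvd (1 - p ^ k) + p ^ k" by (rule dvd_add)
    then show False using p_nonunit by simp
  qed
qed

lemma add_subgroup_multiples: "add_subgroup {x. c dvd (x::'o)}"
  by (auto simp: add_subgroup_def)

lemma idx_multiples: "idx UNIV {x. p ^ d dvd x} = q ^ d"
proof (induction d)
  case 0
  have "{x::'o. p ^ 0 dvd x} = UNIV" by auto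
  then show ?case using idx_self[of "UNIV :: 'o set"] by (simp add: add_subgroup_def)
next
  case (Suc d)
  have "idx UNIV {x. p dvd x} = idx {x. p ^ d dvd x} {x. p ^ Suc d dvd x}"
  proof (rule idx_cong_hom[where f = "\<lambda>x. p ^ d * x"])
    show "p ^ d * x \<in> {x. p ^ Suc d dvd x} \<longleftrightarrow> x \<in> {x. p dvd x}" for x
      using p_power_dvd_cancel[of d p x] by (simp add: mult.commute)
    show "\<exists>x\<in>UNIV. y - p ^ d * x \<in> {x. p ^ Suc d dvd x}" if y: "y \<in> {x. p ^ d dvd x}" for y
    proof -
      obtain x where "y = p ^ d * x" using y by auto
      then show ?thesis by (intro bexI[of _ x]) auto
    qed
  qed (use add_subgroup_multiples in \<open>auto simp: algebra_simps\<close>)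
  moreover have "idx UNIV {x. p ^ Suc d dvd x} =
      idx UNIV {x. p ^ d dvd x} * idx {x. p ^ d dvd x} {x. p ^ Suc d dvd x}"
    by (rule idx_tower) (use add_subgroup_multiples power_le_dvd[of p "Suc d" _ d]
      in \<open>auto simp: add_subgroup_def\<close>)
  ultimately show ?case using Suc residue by simp
qed

lemma q_ge_2: "q \<ge> 2"
proof -
  have "q \<noteq> 1"
  proof
    assume "q = 1"
    then have "UNIV = {x. p dvd x}"
      using idx_eq_1_imp_eq[of UNIV "{x. p dvd x}"] residue add_subgroup_multiples[of p]
      by (auto simp: add_subgroup_def)
    then show False using p_nonunit by blast
  qed
  then show ?thesis using q_pos by linarith
qed

end

section \<open>Lattices with an alternating form\<close>

locale alternating_module = finite_residue_dvr p q + module scale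
  for p :: "'o::idom" and q :: nat and scale :: "'o \<Rightarrow> 'v::ab_group_add \<Rightarrow> 'v" +
  fixes \<omega> :: "'v \<Rightarrow> 'v \<Rightarrow> 'o"
  assumes torsion_free: "scale c x = 0 \<Longrightarrow> c = 0 \<or> x = 0"
    and form_add_left: "\<omega> (x + y) z = \<omega> x z + \<omega> y z"
    and form_scale_left: "\<omega> (scale c x) z = c * \<omega> x z"
    and form_self [simp]: "\<omega> x x = 0"
    and form_swap: "\<omega> x y = - \<omega> y x"
begin

lemma form_add_right: "\<omega> z (x + y) = \<omega> z x + \<omega> z y"
  using form_add_left[of x y z] form_swap[of z] by simp

lemma form_scale_right: "\<omega> z (scale c x) = c * \<omega> z x"
  using form_scale_left[of c x z] form_swap[of z] by simp

lemma form_zero_left [simp]: "\<omega> 0 z = 0"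
  using form_scale_left[of 0 0 z] by simp

lemma form_zero_right [simp]: "\<omega> z 0 = 0"
  using form_scale_right[of z 0 0] by simp

lemma form_minus_left: "\<omega> (- x) z = - \<omega> x z"
  using form_scale_left[of "- 1" x z] by simp

lemma form_minus_right: "\<omega> z (- x) = - \<omega> z x"
  using form_scale_right[of z "- 1" x] by simp

lemma form_diff_left: "\<omega> (x - y) z = \<omega> x z - \<omega> y z"
  using form_add_left[of x "- y" z] by (simp add: form_minus_left)

lemma form_diff_right: "\<omega> z (x - y) = \<omega> z x - \<omega> z y"
  using form_add_right[of z x "- y"] by (simp add: form_minus_right)

lemmas form_bilinear =
  form_add_left form_scale_left form_add_right form_scale_right
  form_minus_left form_minus_right form_diff_left form_diff_right

lemma add_subgroup_subspace: "subspace A \<Longrightarrow> add_subgroup A"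
  by (simp add: add_subgroup_def subspace_0 subspace_diff)

lemma scale_cancel: "c \<noteq> 0 \<Longrightarrow> scale c x = scale c y \<Longrightarrow> x = y"
  using torsion_free[of c "x - y"] by (auto simp: scale_right_diff_distrib)

lemma dvd_p_power_cancel: "p ^ s dvd a * p ^ l \<longleftrightarrow> p ^ (s - l) dvd a"
proof (cases "s \<le> l")
  case True
  then show ?thesis by (simp add: le_imp_power_dvd dvd_mult)
next
  case False
  then have "p ^ s = p ^ l * p ^ (s - l)" by (simp flip: power_add)
  then show ?thesis using p_power_dvd_cancel[of l "p ^ (s - l)" a] by (simp add: mult.commute)
qed

definition line :: "nat \<Rightarrow> 'v \<Rightarrow> 'v set \<Rightarrow> 'v set" where
  "line i u A = {scale a u + z | a z. p ^ i dvd a \<and> z \<in> A}"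

lemma subspace_line:
  assumes "subspace A" shows "subspace (line i u A)"
proof (rule subspaceI)
  show "0 \<in> line i u A"
    using subspace_0[OF assms] by (force simp: line_def intro: exI[of _ 0])
next
  fix x y assume "x \<in> line i u A" "y \<in> line i u A"
  then obtain a z b w where "x = scale a u + z" "p ^ i dvd a" "z \<in> A"
    "y = scale b u + w" "p ^ i dvd b" "w \<in> A" by (auto simp: line_def)
  moreover have "x + y = scale (a + b) u + (z + w)"
    using calculation by (simp add: scale_left_distrib)
  ultimately show "x + y \<in> line i u A"
    using subspace_add[OF assms] unfolding line_def by (blast intro: dvd_add)
next
  fix c x assume "x \<in> line i u A"
  then obtain a z where "x = scale a u + z" "p ^ i dvd a" "z \<in> A" by (auto simp: line_def)
  moreover have "scale c x = scale (c * a) u + scale c z"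
    using calculation by (simp add: scale_right_distrib)
  ultimately show "scale c x \<in> line i u A"
    using subspace_scale[OF assms] unfolding line_def by (blast intro: dvd_mult)
qed

lemma line_mono: "j \<le> i \<Longrightarrow> B \<subseteq> A \<Longrightarrow> line i u B \<subseteq> line j u A"
  unfolding line_def by (blast intro: dvd_trans[OF le_imp_power_dvd])

lemma subset_line: "A \<subseteq> line i u A"
  unfolding line_def by (force intro: exI[of _ 0])

text \<open>
  The coefficient of \<open>u\<close> contributes the factor \<open>q\<^sup>d\<close>. Both steps of the chain
  \<open>line i u A \<supseteq> line (i + d) u A \<supseteq> line (i + d) u B\<close> are isomorphism theorems.
\<close>

lemma idx_line:
  assumes A: "subspace A" and B: "subspace B" and BA: "B \<subseteq> A"
    and free: "\<And>a. scale a u \<in> A \<Longrightarrow> a = 0"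
  shows "idx (line i u A) (line (i + d) u B) = q ^ d * idx A B"
proof -
  note sub = subspace_line[OF A] subspace_line[OF B]
  have mem: "scale a u + z \<in> line j u C \<longleftrightarrow> p ^ j dvd a"
    if "z \<in> C" "subspace C" "C \<subseteq> A" for a z j C
  proof
    assume "scale a u + z \<in> line j u C"
    then obtain b w where b: "scale a u + z = scale b u + w" "p ^ j dvd b" "w \<in> C"
      by (auto simp: line_def)
    then have "scale (a - b) u = w - z" by (simp add: scale_left_diff_distrib algebra_simps)
    moreover have "w - z \<in> A" using that b subspace_diff[OF that(2)] by blast
    ultimately have "a - b = 0" using free by metis
    then show "p ^ j dvd a" using b by simp
  qed (use that in \<open>auto simp: line_def\<close>)
  have "idx (line i u A) (line (i + d) u A) = idx UNIV {x. p ^ d dvd x}"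
  proof (rule idx_cong_hom[symmetric, where f = "\<lambda>a. scale (p ^ i * a) u"])
    fix a
    show "scale (p ^ i * a) u \<in> line i u A"
      using subspace_0[OF A] unfolding line_def
      by (intro CollectI exI[of _ "p ^ i * a"] exI[of _ 0]) simp
    have "scale (p ^ i * a) u \<in> line (i + d) u A \<longleftrightarrow> p ^ (i + d) dvd p ^ i * a"
      using mem[of 0 A "p ^ i * a" "i + d"] A subspace_0[OF A] by simp
    also have "\<dots> \<longleftrightarrow> p ^ d dvd a" by (simp only: power_add p_power_dvd_cancel)
    finally show "scale (p ^ i * a) u \<in> line (i + d) u A \<longleftrightarrow> a \<in> {x. p ^ d dvd x}" by simp
  next
    fix y assume "y \<in> line i u A"
    then obtain a z where "y = scale (p ^ i * a) u + z" "z \<in> A" by (auto simp: line_def)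
    then show "\<exists>x\<in>UNIV. y - scale (p ^ i * x) u \<in> line (i + d) u A"
      using subset_line by (intro bexI[of _ a]) auto
  qed (use sub add_subgroup_subspace add_subgroup_multiples
        in \<open>auto simp: scale_left_diff_distrib algebra_simps\<close>)
  moreover have "idx (line (i + d) u A) (line (i + d) u B) = idx A B"
  proof (rule idx_cong_hom[symmetric, where f = "\<lambda>x. x"])
    fix x assume x: "x \<in> A"
    show "x \<in> line (i + d) u A" using x subset_line by auto
    show "x \<in> line (i + d) u B \<longleftrightarrow> x \<in> B"
    proof
      assume "x \<in> line (i + d) u B"
      then obtain a z where a: "x = scale a u + z" "z \<in> B" by (auto simp: line_def)
      then have "scale a u = x - z" by simp
      moreover have "x - z \<in> A" using x a BA subspace_diff[OF A] by blast
      ultimately have "scale a u \<in> A" by simp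
      then show "x \<in> B" using a free[of a] by simp
    qed (use subset_line in auto)
  next
    fix y assume "y \<in> line (i + d) u A"
    then obtain a z where a: "p ^ (i + d) dvd a" "y = scale a u + z" "z \<in> A"
      by (auto simp: line_def)
    then have "y - z \<in> line (i + d) u B"
      using subspace_0[OF B] by (force simp: line_def)
    then show "\<exists>x\<in>A. y - x \<in> line (i + d) u B" using a by blast
  qed (use sub A B add_subgroup_subspace subspace_diff in auto)
  moreover have "idx (line i u A) (line (i + d) u B) =
      idx (line i u A) (line (i + d) u A) * idx (line (i + d) u A) (line (i + d) u B)"
    by (rule idx_tower) (use sub add_subgroup_subspace line_mono BA in auto)
  ultimately show ?thesis using idx_multiples by simp
qed

definition hsum :: "nat \<Rightarrow> 'v \<Rightarrow> 'v \<Rightarrow> 'v set \<Rightarrow> 'v set" where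
  "hsum i u v A = line i u (line i v A)"

lemma mem_hsum:
  "x \<in> hsum i u v A \<longleftrightarrow>
    (\<exists>a b z. x = scale a u + scale b v + z \<and> p ^ i dvd a \<and> p ^ i dvd b \<and> z \<in> A)"
  unfolding hsum_def line_def by (auto simp: add.assoc)

text \<open>
  A block of a symplectic basis: \<open>u\<close> and \<open>v\<close> span a plane with elementary divisor \<open>p\<^sup>l\<close> that is
  orthogonal to the remaining blocks.
\<close>

definition plane :: "nat \<Rightarrow> 'v \<Rightarrow> 'v \<Rightarrow> 'v set \<Rightarrow> bool" where
  "plane l u v M \<longleftrightarrow> \<omega> u v = p ^ l \<and> (\<forall>z\<in>M. \<omega> u z = 0 \<and> \<omega> v z = 0)"

lemma plane_form:
  assumes "plane l u v M" "z \<in> M" "z' \<in> M"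
  shows "\<omega> (scale a u + scale b v + z) (scale a' u + scale b' v + z') =
    (a * b' - b * a') * p ^ l + \<omega> z z'"
proof -
  have "\<omega> v u = - (p ^ l)" "\<omega> z u = 0" "\<omega> z v = 0"
    using assms form_swap[of v u] form_swap[of z u] form_swap[of z v] by (auto simp: plane_def)
  then show ?thesis using assms by (simp add: plane_def form_bilinear algebra_simps)
qed

lemma plane_subset: "plane l u v M \<Longrightarrow> A \<subseteq> M \<Longrightarrow> plane l u v A"
  by (auto simp: plane_def)

lemma plane_coordinates:
  assumes "plane l u v M" "x = scale a u + scale b v + z" "z \<in> M"
  shows "\<omega> x v = a * p ^ l" "\<omega> x u = - (b * p ^ l)"
proof -
  have "\<omega> v u = - (p ^ l)" "\<omega> z u = 0" "\<omega> z v = 0"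
    using assms form_swap[of v u] form_swap[of z u] form_swap[of z v] by (auto simp: plane_def)
  then show "\<omega> x v = a * p ^ l" "\<omega> x u = - (b * p ^ l)"
    using assms by (simp_all add: plane_def form_bilinear)
qed

lemma subspace_hsum: "subspace A \<Longrightarrow> subspace (hsum i u v A)"
  by (simp add: hsum_def subspace_line)

lemma subset_hsum: "A \<subseteq> hsum i u v A"
  unfolding hsum_def using subset_line by blast

lemma plane_mem_hsum: "subspace A \<Longrightarrow> u \<in> hsum 0 u v A" "subspace A \<Longrightarrow> v \<in> hsum 0 u v A"
proof -
  assume A: "subspace A"
  have "u = scale 1 u + scale 0 v + 0" "v = scale 0 u + scale 1 v + 0" by simp_all
  then show "u \<in> hsum 0 u v A" "v \<in> hsum 0 u v A"
    using subspace_0[OF A] unfolding mem_hsum by (metis one_dvd power_0)+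
qed

lemma plane_free:
  assumes "plane l u v A"
  shows "scale a u \<in> line i v A \<Longrightarrow> a = 0" "scale a v \<in> A \<Longrightarrow> a = 0"
proof -
  show "scale a v \<in> A \<Longrightarrow> a = 0"
    using assms p_nonzero by (auto simp: plane_def form_scale_right)
  assume "scale a u \<in> line i v A"
  then obtain b z where b: "scale a u = scale b v + z" "z \<in> A" by (auto simp: line_def)
  then have "\<omega> (scale b v + z) v = 0"
    using assms form_swap[of z v] by (auto simp: plane_def form_bilinear)
  then have "\<omega> (scale a u) v = 0" using b by simp
  then show "a = 0" using assms p_nonzero by (simp add: plane_def form_bilinear)
qed

lemma idx_hsum:
  assumes "plane l u v A" "subspace A" "subspace B" "B \<subseteq> A"
  shows "idx (hsum i u v A) (hsum (i + d) u v B) = q ^ (2 * d) * idx A B"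
proof -
  have "idx (hsum i u v A) (hsum (i + d) u v B) =
      q ^ d * idx (line i v A) (line (i + d) v B)"
    unfolding hsum_def using assms plane_free(1)[OF assms(1)]
    by (intro idx_line) (auto simp: subspace_line line_mono)
  also have "idx (line i v A) (line (i + d) v B) = q ^ d * idx A B"
    using assms plane_free(2)[OF assms(1)] by (intro idx_line) auto
  finally show ?thesis by (simp add: mult_2 power_add)
qed

section \<open>Symplectic elementary divisors\<close>

text \<open>
  A module has type \<open>\<tau>\<close> if it has a symplectic basis with elementary divisors \<open>p\<^sup>l\<close>, one plane for
  each \<open>l\<close> in the multiset \<open>\<tau>\<close>. Splitting off one plane at a time avoids indexed bases, and
  every statement about coordinates becomes an induction on the planes.
\<close>

inductive has_type :: "'v set \<Rightarrow> nat multiset \<Rightarrow> bool" where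
  has_type_zero: "has_type {0} {#}"
| has_type_plane: "has_type M \<tau> \<Longrightarrow> plane l u v M \<Longrightarrow> has_type (hsum 0 u v M) (add_mset l \<tau>)"

lemma has_type_subspace: "has_type M \<tau> \<Longrightarrow> subspace M"
  by (induction rule: has_type.induct) (simp_all add: subspace_hsum subspace_single_0)

lemma has_type_nondegenerate:
  "has_type M \<tau> \<Longrightarrow> x \<in> M \<Longrightarrow> (\<And>z. z \<in> M \<Longrightarrow> \<omega> x z = 0) \<Longrightarrow> x = 0"
proof (induction arbitrary: x rule: has_type.induct)
  case (has_type_plane M \<tau> l u v)
  note M = has_type_subspace[OF has_type_plane.hyps(1)]
  obtain a b z where x: "x = scale a u + scale b v + z" "z \<in> M"
    using has_type_plane.prems(1) by (auto simp: mem_hsum)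
  have "\<omega> x v = 0" "\<omega> x u = 0"
    using has_type_plane.prems(2) plane_mem_hsum[OF M] by auto
  then have ab: "a = 0" "b = 0"
    using plane_coordinates[OF has_type_plane.hyps(2) x] p_nonzero by auto
  then have "x = z" using x by simp
  moreover have "z = 0"
    by (rule has_type_plane.IH[OF x(2)])
      (use has_type_plane.prems(2)[OF subsetD[OF subset_hsum]] \<open>x = z\<close> in simp)
  ultimately show ?case by simp
qed simp

lemma has_type_form_dvd:
  "has_type M \<tau> \<Longrightarrow> (\<forall>x\<in>M. \<forall>y\<in>M. p ^ m dvd \<omega> x y) \<longleftrightarrow> (\<forall>l\<in>#\<tau>. m \<le> l)"
proof (induction rule: has_type.induct)
  case (has_type_plane M \<tau> l u v)
  note M = has_type_subspace[OF has_type_plane.hyps(1)]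
  show ?case
  proof
    assume L: "\<forall>x\<in>hsum 0 u v M. \<forall>y\<in>hsum 0 u v M. p ^ m dvd \<omega> x y"
    then have "p ^ m dvd \<omega> u v" using plane_mem_hsum[OF M] by blast
    then have "m \<le> l" using has_type_plane.hyps(2) by (simp add: plane_def p_power_dvd_iff)
    moreover have "\<forall>x\<in>M. \<forall>y\<in>M. p ^ m dvd \<omega> x y" using L subset_hsum by blast
    ultimately show "\<forall>l'\<in>#add_mset l \<tau>. m \<le> l'" using has_type_plane.IH by auto
  next
    assume R: "\<forall>l'\<in>#add_mset l \<tau>. m \<le> l'"
    then have "p ^ m dvd p ^ l" "\<forall>x\<in>M. \<forall>y\<in>M. p ^ m dvd \<omega> x y"
      using has_type_plane.IH by (auto simp: le_imp_power_dvd)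
    then show "\<forall>x\<in>hsum 0 u v M. \<forall>y\<in>hsum 0 u v M. p ^ m dvd \<omega> x y"
      by (auto simp: mem_hsum plane_form[OF has_type_plane.hyps(2)])
  qed
qed simp

lemma has_type_isometry:
  assumes "has_type M \<tau>"
    and "\<And>x y. x \<in> M \<Longrightarrow> y \<in> M \<Longrightarrow> f (x + y) = f x + f y"
    and "\<And>c x. x \<in> M \<Longrightarrow> f (scale c x) = scale c (f x)"
    and "\<And>x y. x \<in> M \<Longrightarrow> y \<in> M \<Longrightarrow> \<omega> (f x) (f y) = \<omega> x y"
  shows "has_type (f ` M) \<tau>"
  using assms
proof (induction rule: has_type.induct)
  case has_type_zero
  have "f 0 = 0" using has_type_zero(2)[of 0 0] by simp
  then show ?case by (simp add: has_type.has_type_zero)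
next
  case (has_type_plane M \<tau> l u v)
  note M = has_type_subspace[OF has_type_plane.hyps(1)]
  note H = plane_mem_hsum[OF M, where u = u and v = v] and sub = subset_hsum[of M 0 u v]
  note S = subspace_hsum[OF M, where i = 0 and u = u and v = v]
  have "has_type (f ` M) \<tau>" using has_type_plane.IH has_type_plane.prems sub by blast
  moreover have "plane l (f u) (f v) (f ` M)"
    using has_type_plane.hyps(2) has_type_plane.prems(3)[OF H]
      has_type_plane.prems(3)[OF H(1) subsetD[OF sub]]
      has_type_plane.prems(3)[OF H(2) subsetD[OF sub]] by (simp add: plane_def)
  moreover have img: "f (scale a u + scale b v + z) = scale a (f u) + scale b (f v) + f z"
    if "z \<in> M" for a b z
  proof -
    have "scale a u \<in> hsum 0 u v M" "scale b v \<in> hsum 0 u v M" "z \<in> hsum 0 u v M"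
      "scale a u + scale b v \<in> hsum 0 u v M"
      using subspace_scale[OF S H(1), of a] subspace_scale[OF S H(2), of b] subsetD[OF sub that]
        subspace_add[OF S subspace_scale[OF S H(1), of a] subspace_scale[OF S H(2), of b]]
      by simp_all
    then show ?thesis using has_type_plane.prems(1,2) H by simp
  qed
  have "f ` hsum 0 u v M = hsum 0 (f u) (f v) (f ` M)"
  proof (intro equalityI subsetI)
    fix y assume "y \<in> f ` hsum 0 u v M"
    then obtain a b z where "y = f (scale a u + scale b v + z)" "z \<in> M" by (auto simp: mem_hsum)
    then show "y \<in> hsum 0 (f u) (f v) (f ` M)" using img by (auto simp: mem_hsum)
  next
    fix y assume "y \<in> hsum 0 (f u) (f v) (f ` M)"
    then obtain a b z where "y = scale a (f u) + scale b (f v) + f z" "z \<in> M"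
      by (auto simp: mem_hsum)
    moreover have "scale a u + scale b v + z \<in> hsum 0 u v M"
      using calculation(2) by (auto simp: mem_hsum)
    ultimately show "y \<in> f ` hsum 0 u v M" using img[of z a b] by force
  qed
  then show ?case using has_type.has_type_plane calculation by simp
qed

text \<open>
  In terms of the dual lattice, \<open>lev M s\<close> is \<open>M \<inter> p\<^sup>s M\<^sup>#\<close>. On it the form is divisible by
  \<open>p\<^sup>s\<close>, and \<open>rad M s\<close> is the radical of the form \<open>p\<^sup>-\<^sup>s \<omega>\<close> modulo \<open>p\<close>. Hence
  \<open>lev M s / rad M s\<close> is a symplectic space over the residue field, and its dimension is twice the
  multiplicity of \<open>s\<close> in the type. This makes the type an invariant of \<open>M\<close>.
\<close>

definition lev :: "'v set \<Rightarrow> nat \<Rightarrow> 'v set" where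
  "lev M s = {x \<in> M. \<forall>z\<in>M. p ^ s dvd \<omega> x z}"

definition rad :: "'v set \<Rightarrow> nat \<Rightarrow> 'v set" where
  "rad M s = {x \<in> lev M s. \<forall>z\<in>lev M s. p ^ Suc s dvd \<omega> x z}"

lemma subspace_lev: "subspace M \<Longrightarrow> subspace (lev M s)"
  by (rule subspaceI) (auto simp: lev_def form_bilinear subspace_0 subspace_add subspace_scale)

lemma subspace_rad: "subspace M \<Longrightarrow> subspace (rad M s)"
  using subspace_lev[of M s]
  by (intro subspaceI) (auto simp: rad_def form_bilinear subspace_0 subspace_add subspace_scale)

lemma lev_subset: "lev M s \<subseteq> M" and rad_subset_lev: "rad M s \<subseteq> lev M s"
  by (auto simp: lev_def rad_def)

lemma lev_0: "lev M 0 = M"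
  by (auto simp: lev_def)

lemma lev_Suc_subset_rad: "lev M (Suc s) \<subseteq> rad M s"
proof -
  have "p ^ s dvd a" if "p ^ Suc s dvd a" for a using power_le_dvd[OF that, of s] by simp
  then show ?thesis unfolding lev_def rad_def by blast
qed

lemma lev_hsum:
  assumes "plane l u v M" "subspace M"
  shows "lev (hsum 0 u v M) s = hsum (s - l) u v (lev M s)"
proof (intro equalityI subsetI)
  fix x assume x: "x \<in> lev (hsum 0 u v M) s"
  then obtain a b z where x': "x = scale a u + scale b v + z" "z \<in> M"
    by (auto simp: lev_def mem_hsum)
  have dvd: "p ^ s dvd \<omega> x w" if "w \<in> hsum 0 u v M" for w using x that by (auto simp: lev_def)
  have "p ^ s dvd a * p ^ l" "p ^ s dvd b * p ^ l"
    using dvd[of v] dvd[of u] plane_mem_hsum[OF assms(2)] plane_coordinates[OF assms(1) x']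
    by auto
  moreover have "z \<in> lev M s"
  proof -
    have "p ^ s dvd \<omega> z w" if "w \<in> M" for w
    proof -
      have "\<omega> x w = \<omega> z w" using assms(1) that x' by (simp add: plane_def form_bilinear)
      then show ?thesis using dvd that subset_hsum by fastforce
    qed
    then show ?thesis using x' by (simp add: lev_def)
  qed
  ultimately show "x \<in> hsum (s - l) u v (lev M s)"
    using x' by (auto simp: mem_hsum dvd_p_power_cancel)
next
  fix x assume "x \<in> hsum (s - l) u v (lev M s)"
  then obtain a b z where x: "x = scale a u + scale b v + z" "p ^ (s - l) dvd a"
    "p ^ (s - l) dvd b" "z \<in> lev M s" by (auto simp: mem_hsum)
  have z: "z \<in> M" using x lev_subset by blast
  have "p ^ s dvd a * p ^ l" "p ^ s dvd b * p ^ l" using x by (simp_all add: dvd_p_power_cancel)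
  then have ab: "p ^ s dvd (a * b' - b * a') * p ^ l" for a' b'
  proof -
    have "(a * b' - b * a') * p ^ l = a * p ^ l * b' - b * p ^ l * a'"
      by (simp add: algebra_simps)
    moreover have "p ^ s dvd a * p ^ l * b' - b * p ^ l * a'"
      by (rule dvd_diff; rule dvd_mult2; fact)
    ultimately show ?thesis by simp
  qed
  have "p ^ s dvd \<omega> x w" if "w \<in> hsum 0 u v M" for w
    using that ab x(4) by (auto simp: mem_hsum x(1) plane_form[OF assms(1) z] lev_def)
  then show "x \<in> lev (hsum 0 u v M) s" using x z by (auto simp: lev_def mem_hsum)
qed

text \<open>
  The block of level \<open>l\<close> meets \<open>lev M s\<close> in the multiples of \<open>p\<close> to the truncated difference
  \<open>s - l\<close>; only for \<open>l = s\<close> does the radical require one more factor \<open>p\<close>.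
\<close>

lemma rad_hsum:
  assumes "plane l u v M" "subspace M"
  shows "rad (hsum 0 u v M) s = hsum (s - l + of_bool (l = s)) u v (rad M s)"
proof -
  have key: "p ^ (s - l) dvd a \<and> p ^ Suc s dvd a * p ^ (s - l + l) \<longleftrightarrow>
    p ^ (s - l + of_bool (l = s)) dvd a" for a
    unfolding dvd_p_power_cancel using power_le_dvd[of p "s - l" a 1] power_le_dvd[of p 1 a 0]
    by (cases l s rule: linorder_cases) auto
  note P = plane_subset[OF assms(1) lev_subset] and S = subspace_lev[OF assms(2)]
  show ?thesis
  proof (intro equalityI subsetI)
    fix x assume x: "x \<in> rad (hsum 0 u v M) s"
    then obtain a b z where x': "x = scale a u + scale b v + z" "p ^ (s - l) dvd a"
      "p ^ (s - l) dvd b" "z \<in> lev M s"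
      unfolding rad_def lev_hsum[OF assms] by (auto simp: mem_hsum)
    have dvd: "p ^ Suc s dvd \<omega> x w" if "w \<in> hsum (s - l) u v (lev M s)" for w
      using x that by (simp add: rad_def lev_hsum[OF assms])
    have mem: "scale (p ^ (s - l)) u \<in> hsum (s - l) u v (lev M s)"
      "scale (p ^ (s - l)) v \<in> hsum (s - l) u v (lev M s)"
      unfolding mem_hsum using subspace_0[OF S[of s]]
      by (rule_tac x = "p ^ (s - l)" in exI, rule_tac x = 0 in exI, rule_tac x = 0 in exI, simp)
        (rule_tac x = 0 in exI, rule_tac x = "p ^ (s - l)" in exI, rule_tac x = 0 in exI,
          use subspace_0[OF S[of s]] in simp)
    have "p ^ Suc s dvd a * p ^ (s - l + l)" "p ^ Suc s dvd b * p ^ (s - l + l)"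
      using dvd[OF mem(2)] dvd[OF mem(1)] plane_coordinates[OF P x'(1,4)]
      by (simp_all add: form_scale_right power_add mult.left_commute)
    moreover have "z \<in> rad M s"
    proof -
      have "p ^ Suc s dvd \<omega> z w" if "w \<in> lev M s" for w
      proof -
        have "\<omega> x w = \<omega> z w" using P that x' by (simp add: plane_def form_bilinear)
        then show ?thesis using dvd that subset_hsum by fastforce
      qed
      then show ?thesis using x' by (simp add: rad_def)
    qed
    moreover have "p ^ (s - l + of_bool (l = s)) dvd a" "p ^ (s - l + of_bool (l = s)) dvd b"
      using x'(2,3) calculation key by blast+
    ultimately show "x \<in> hsum (s - l + of_bool (l = s)) u v (rad M s)"
      using x'(1) unfolding mem_hsum by blast
  next
    fix x assume "x \<in> hsum (s - l + of_bool (l = s)) u v (rad M s)"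
    then obtain a b z where x: "x = scale a u + scale b v + z"
      "p ^ (s - l + of_bool (l = s)) dvd a" "p ^ (s - l + of_bool (l = s)) dvd b" "z \<in> rad M s"
      by (auto simp: mem_hsum)
    have z: "z \<in> lev M s" using x rad_subset_lev by blast
    have k: "p ^ (s - l) dvd a" "p ^ (s - l) dvd b"
      "p ^ Suc s dvd a * p ^ (s - l + l)" "p ^ Suc s dvd b * p ^ (s - l + l)"
      using x key by auto
    have ab: "p ^ Suc s dvd (a * b' - b * a') * p ^ l"
      if "p ^ (s - l) dvd a'" "p ^ (s - l) dvd b'" for a' b'
    proof -
      obtain a1 b1 where "a' = p ^ (s - l) * a1" "b' = p ^ (s - l) * b1"
        using \<open>p ^ (s - l) dvd a'\<close> \<open>p ^ (s - l) dvd b'\<close> unfolding dvd_def by blast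
      then have "(a * b' - b * a') * p ^ l =
          a * p ^ (s - l + l) * b1 - b * p ^ (s - l + l) * a1"
        by (simp add: power_add algebra_simps)
      moreover have "p ^ Suc s dvd a * p ^ (s - l + l) * b1 - b * p ^ (s - l + l) * a1"
        by (rule dvd_diff; rule dvd_mult2; fact k)
      ultimately show ?thesis by simp
    qed
    have "p ^ Suc s dvd \<omega> x w" if w0: "w \<in> hsum (s - l) u v (lev M s)" for w
    proof -
      obtain a' b' w' where w: "w = scale a' u + scale b' v + w'" "p ^ (s - l) dvd a'"
        "p ^ (s - l) dvd b'" "w' \<in> lev M s" using w0 unfolding mem_hsum by blast
      have "p ^ Suc s dvd \<omega> z w'" using x w by (auto simp: rad_def)
      then show ?thesis using ab[OF w(2,3)] unfolding x(1) w(1) plane_form[OF P z w(4)]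
        by (rule dvd_add[rotated])
    qed
    then show "x \<in> rad (hsum 0 u v M) s"
      using x k z unfolding rad_def lev_hsum[OF assms] by (auto simp: mem_hsum)
  qed
qed

lemma idx_lev: "has_type M \<tau> \<Longrightarrow> idx M (lev M s) = q ^ (2 * (\<Sum>l\<in>#\<tau>. s - l))"
proof (induction rule: has_type.induct)
  case has_type_zero
  have "lev {0} s = {0}" by (auto simp: lev_def)
  then show ?case using idx_self[of "{0::'v}"] by (simp add: add_subgroup_def)
next
  case (has_type_plane M \<tau> l u v)
  note M = has_type_subspace[OF has_type_plane.hyps(1)]
  show ?case
    using idx_hsum[OF has_type_plane.hyps(2) M subspace_lev[OF M] lev_subset,
        where i = 0 and d = "s - l"] has_type_plane.IH
    by (simp add: lev_hsum[OF has_type_plane.hyps(2) M] power_add algebra_simps)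
qed

lemma idx_rad: "has_type M \<tau> \<Longrightarrow> idx (lev M s) (rad M s) = q ^ (2 * count \<tau> s)"
proof (induction rule: has_type.induct)
  case has_type_zero
  have "lev {0} s = {0}" "rad {0} s = {0}" by (auto simp: lev_def rad_def)
  then show ?case using idx_self[of "{0::'v}"] by (simp add: add_subgroup_def)
next
  case (has_type_plane M \<tau> l u v)
  note M = has_type_subspace[OF has_type_plane.hyps(1)]
  show ?case
    using idx_hsum[OF plane_subset[OF has_type_plane.hyps(2) lev_subset] subspace_lev[OF M]
        subspace_rad[OF M] rad_subset_lev, where i = "s - l" and d = "of_bool (l = s)" for s]
      has_type_plane.IH
    by (simp add: lev_hsum[OF has_type_plane.hyps(2) M] rad_hsum[OF has_type_plane.hyps(2) M]
        power_add algebra_simps)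
qed

lemma has_type_unique:
  assumes "has_type M \<tau>" "has_type M \<tau>'"
  shows "\<tau> = \<tau>'"
proof (rule multiset_eqI)
  fix s
  have "q ^ (2 * count \<tau> s) = q ^ (2 * count \<tau>' s)"
    using idx_rad[OF assms(1), of s] idx_rad[OF assms(2), of s] by simp
  then show "count \<tau> s = count \<tau>' s" using q_ge_2 by (simp add: power_inject_exp)
qed

lemma not_in_type_iff:
  assumes "has_type M \<tau>" "s \<notin># \<tau>"
  shows "lev M s = rad M s"
  using idx_rad[OF assms(1), of s] assms(2) rad_subset_lev
    add_subgroup_subspace[OF subspace_lev[OF has_type_subspace[OF assms(1)]]]
    add_subgroup_subspace[OF subspace_rad[OF has_type_subspace[OF assms(1)]]]
  by (intro idx_eq_1_imp_eq) (auto simp: not_in_iff)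

text \<open>
  At the top level \<open>r\<close> all coordinates of a vector in the radical are divisible by \<open>p\<close>: on the
  planes of level \<open>r\<close> because of the radical, on the others because they already are in \<open>lev M r\<close>.
\<close>

lemma rad_top:
  assumes "has_type M \<tau>" "\<forall>l\<in>#\<tau>. l \<le> r"
  shows "rad M r = {x \<in> lev M r. \<exists>y\<in>M. x = scale p y}"
proof (intro equalityI subsetI)
  fix x assume "x \<in> rad M r"
  moreover have "\<exists>y\<in>M. x = scale p y" if "x \<in> rad M r" for x
    using assms that
  proof (induction arbitrary: x rule: has_type.induct)
    case has_type_zero
    then show ?case by (auto simp: rad_def lev_def)
  next
    case (has_type_plane M \<tau> l u v)
    note M = has_type_subspace[OF has_type_plane.hyps(1)]
    obtain a b z where x: "x = scale a u + scale b v + z" "z \<in> rad M r"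
      "p ^ (r - l + of_bool (l = r)) dvd a" "p ^ (r - l + of_bool (l = r)) dvd b"
      using has_type_plane.prems by (auto simp: rad_hsum[OF has_type_plane.hyps(2) M] mem_hsum)
    have "1 \<le> r - l + of_bool (l = r)" using has_type_plane.prems(1) by (auto simp: le_less)
    then have "p dvd a" "p dvd b"
      using power_le_dvd[OF x(3), of 1] power_le_dvd[OF x(4), of 1] by simp_all
    then obtain a' b' where "a = p * a'" "b = p * b'" unfolding dvd_def by blast
    moreover obtain y where "y \<in> M" "z = scale p y"
      using has_type_plane.IH[OF _ x(2)] has_type_plane.prems(1) by auto
    ultimately show ?case using x(1)
      by (intro bexI[of _ "scale a' u + scale b' v + y"])
        (auto simp: scale_right_distrib mem_hsum)
  qed
  ultimately show "x \<in> {x \<in> lev M r. \<exists>y\<in>M. x = scale p y}" using rad_subset_lev by auto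
next
  fix x assume "x \<in> {x \<in> lev M r. \<exists>y\<in>M. x = scale p y}"
  then obtain y where y: "x \<in> lev M r" "y \<in> M" "x = scale p y" by auto
  have "p ^ Suc r dvd \<omega> x z" if "z \<in> lev M r" for z
  proof -
    have "p ^ r dvd \<omega> z y" using that y by (auto simp: lev_def)
    then show ?thesis using y form_swap[of y z] by (simp add: form_bilinear)
  qed
  then show "x \<in> rad M r" using y by (simp add: rad_def)
qed

text \<open>
  The bound \<open>r\<close> on the elementary divisors gives \<open>p\<^sup>r M\<^sup># \<subseteq> M\<close>. Stating this inclusion for
  functionals avoids the vector space that contains the dual lattice \<open>M\<^sup>#\<close>.
\<close>

lemma functional_represented:
  assumes "has_type M \<tau>" "\<forall>l\<in>#\<tau>. l \<le> r" "\<And>z. z \<in> M \<Longrightarrow> p ^ r dvd \<omega> w z"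
  shows "\<exists>w'\<in>M. \<forall>z\<in>M. \<omega> w z = \<omega> w' z"
  using assms
proof (induction rule: has_type.induct)
  case (has_type_plane M \<tau> l u v)
  note M = has_type_subspace[OF has_type_plane.hyps(1)]
  have "p ^ l dvd \<omega> w v" "p ^ l dvd \<omega> w u"
    using has_type_plane.prems(1)
      power_le_dvd[OF has_type_plane.prems(2)[OF plane_mem_hsum(1)[OF M]], of l]
      power_le_dvd[OF has_type_plane.prems(2)[OF plane_mem_hsum(2)[OF M]], of l]
    by auto
  then obtain a b where ab: "\<omega> w v = p ^ l * a" "\<omega> w u = p ^ l * b"
    unfolding dvd_def by blast
  obtain w1 where w1: "w1 \<in> M" "\<And>z. z \<in> M \<Longrightarrow> \<omega> w z = \<omega> w1 z"
  proof -
    have "\<exists>w'\<in>M. \<forall>z\<in>M. \<omega> w z = \<omega> w' z"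
      using has_type_plane.prems(1) has_type_plane.prems(2)[OF subsetD[OF subset_hsum]]
      by (intro has_type_plane.IH) simp_all
    then show ?thesis using that by blast
  qed
  define w' where "w' = scale a u + scale (- b) v + w1"
  have "w' \<in> hsum 0 u v M"
    unfolding mem_hsum w'_def using w1(1)
    by (intro exI[of _ a] exI[of _ "- b"] exI[of _ w1]) simp
  moreover have "\<omega> w z = \<omega> w' z" if z0: "z \<in> hsum 0 u v M" for z
  proof -
    obtain a' b' z' where z: "z = scale a' u + scale b' v + z'" "z' \<in> M"
      using z0 unfolding mem_hsum by blast
    show ?thesis
      unfolding w'_def z(1) plane_form[OF has_type_plane.hyps(2) w1(1) z(2)]
      using ab w1(2)[OF z(2)] by (simp add: form_bilinear algebra_simps)
  qed
  ultimately show ?case by blast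
qed simp

text \<open>
  A functional to the residue field is an element of \<open>M\<^sup># / p M\<^sup>#\<close>. If it vanishes on
  \<open>lev M (s + 1)\<close>, it ignores the planes of level above \<open>s\<close>, and on the other planes it can be
  multiplied by \<open>p\<^sup>s\<close> and read off from the form. The function \<open>f\<close> is a lift to \<open>\<o>\<close>, additive
  only modulo \<open>p\<close>.
\<close>

lemma residue_functional_represented:
  assumes "has_type M \<tau>"
    and "\<And>x y. x \<in> M \<Longrightarrow> y \<in> M \<Longrightarrow> p dvd f (x + y) - (f x + f y)"
    and "\<And>c x. x \<in> M \<Longrightarrow> p dvd f (scale c x) - c * f x"
    and "\<And>z. z \<in> lev M (Suc s) \<Longrightarrow> p dvd f z"
  shows "\<exists>y\<in>lev M s. \<forall>z\<in>M. p ^ Suc s dvd \<omega> z y - f z * p ^ s"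
  using assms
proof (induction rule: has_type.induct)
  case has_type_zero
  have "p dvd f 0" using has_type_zero(3) by (simp add: lev_def)
  then have "p ^ Suc s dvd - (f 0 * p ^ s)" by (simp add: mult_dvd_mono)
  then show ?case by (simp add: lev_def)
next
  case (has_type_plane M \<tau> l u v)
  note M = has_type_subspace[OF has_type_plane.hyps(1)]
  note P = has_type_plane.hyps(2)
  note H = plane_mem_hsum[OF M, where u = u and v = v] and sub = subset_hsum[of M 0 u v]
  note S = subspace_hsum[OF M, where i = 0 and u = u and v = v]
  have lev_sub: "lev M (Suc s) \<subseteq> lev (hsum 0 u v M) (Suc s)"
    unfolding lev_hsum[OF P M] by (rule subset_hsum)
  have "\<exists>y\<in>lev M s. \<forall>z\<in>M. p ^ Suc s dvd \<omega> z y - f z * p ^ s"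
    using sub lev_sub by (intro has_type_plane.IH) (auto intro: has_type_plane.prems)
  then obtain y where y: "y \<in> lev M s" "\<And>z. z \<in> M \<Longrightarrow> p ^ Suc s dvd \<omega> z y - f z * p ^ s"
    by blast
  have big: "p dvd f u" "p dvd f v" if "\<not> l \<le> s"
  proof -
    have "u \<in> lev (hsum 0 u v M) (Suc s)" "v \<in> lev (hsum 0 u v M) (Suc s)"
      unfolding lev_hsum[OF P M] using that plane_mem_hsum[OF subspace_lev[OF M], where u = u and v = v]
      by (simp_all add: Suc_diff_le)
    then show "p dvd f u" "p dvd f v" using has_type_plane.prems(3) by auto
  qed
  define c where "c = (if l \<le> s then p ^ (s - l) else 0)"
  have c: "p ^ (s - l) dvd c" "p ^ Suc s dvd c * x * p ^ l - x * p ^ s"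
    if "l \<le> s \<or> p dvd x" for x
  proof -
    show "p ^ (s - l) dvd c" by (simp add: c_def)
    show "p ^ Suc s dvd c * x * p ^ l - x * p ^ s"
    proof (cases "l \<le> s")
      case True
      then have "c * p ^ l = p ^ s" by (simp add: c_def flip: power_add)
      moreover have "c * x * p ^ l = x * (c * p ^ l)" by (simp only: ac_simps)
      ultimately have "c * x * p ^ l = x * p ^ s" by metis
      then show ?thesis by (metis dvd_0_right right_minus_eq)
    next
      case False
      then have "p ^ Suc s dvd x * p ^ s" using that by (simp add: mult_dvd_mono)
      then show ?thesis using False by (simp add: c_def)
    qed
  qed
  \<comment> \<open>The two coordinates are chosen so that \<open>u\<close> and \<open>v\<close> pair with \<open>y'\<close> to \<open>p\<^sup>s f u\<close> and \<open>p\<^sup>s f v\<close>.\<close>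
  define y' where "y' = scale (- (c * f v)) u + scale (c * f u) v + y"
  have "y \<in> M" using y(1) lev_subset by blast
  have c0: "p ^ (s - l) dvd c" using c(1)[of 0] by simp
  have "y' \<in> lev (hsum 0 u v M) s"
    unfolding lev_hsum[OF P M] mem_hsum y'_def using y(1) c0
    by (intro exI[of _ "- (c * f v)"] exI[of _ "c * f u"] exI[of _ y]) simp
  moreover have "p ^ Suc s dvd \<omega> z y' - f z * p ^ s" if z0: "z \<in> hsum 0 u v M" for z
  proof -
    obtain a b z' where z: "z = scale a u + scale b v + z'" "z' \<in> M"
      using z0 unfolding mem_hsum by blast
    have mem: "scale a u \<in> hsum 0 u v M" "scale b v \<in> hsum 0 u v M" "z' \<in> hsum 0 u v M"
      "scale a u + scale b v \<in> hsum 0 u v M"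
      using subspace_scale[OF S H(1), of a] subspace_scale[OF S H(2), of b] subsetD[OF sub z(2)]
        subspace_add[OF S subspace_scale[OF S H(1), of a] subspace_scale[OF S H(2), of b]]
      by simp_all
    have "p dvd (f z - (f (scale a u + scale b v) + f z'))
        + (f (scale a u + scale b v) - (f (scale a u) + f (scale b v)))
        + (f (scale a u) - a * f u) + (f (scale b v) - b * f v)"
      unfolding z(1)
      by (rule dvd_add[OF dvd_add[OF dvd_add[OF has_type_plane.prems(1)[OF mem(4,3)]
              has_type_plane.prems(1)[OF mem(1,2)]] has_type_plane.prems(2)[OF H(1)]]
            has_type_plane.prems(2)[OF H(2)]])
    also have "(f z - (f (scale a u + scale b v) + f z'))
        + (f (scale a u + scale b v) - (f (scale a u) + f (scale b v)))
        + (f (scale a u) - a * f u) + (f (scale b v) - b * f v)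
      = f z - (a * f u + b * f v + f z')" by simp
    finally have "p dvd f z - (a * f u + b * f v + f z')" .
    then have 1: "p ^ Suc s dvd (f z - (a * f u + b * f v + f z')) * p ^ s"
      by (simp add: mult_dvd_mono)
    have 2: "p ^ Suc s dvd a * (c * f u * p ^ l - f u * p ^ s)"
      "p ^ Suc s dvd b * (c * f v * p ^ l - f v * p ^ s)"
      using c(2)[of "f u"] c(2)[of "f v"] big by (cases "l \<le> s"; simp)+
    have "\<omega> z y' - f z * p ^ s =
        a * (c * f u * p ^ l - f u * p ^ s) + b * (c * f v * p ^ l - f v * p ^ s)
        + (\<omega> z' y - f z' * p ^ s) - (f z - (a * f u + b * f v + f z')) * p ^ s"
      unfolding y'_def z(1) plane_form[OF P z(2) \<open>y \<in> M\<close>] by (simp add: algebra_simps)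
    also have "p ^ Suc s dvd \<dots>"
      by (rule dvd_diff[OF dvd_add[OF dvd_add[OF 2(1) 2(2)] y(2)[OF z(2)]] 1])
    finally show ?thesis .
  qed
  ultimately show ?case by blast
qed

section \<open>Splitting off planes\<close>

definition perp :: "'v set \<Rightarrow> 'v \<Rightarrow> 'v \<Rightarrow> 'v set" where
  "perp M u v = {z \<in> M. \<omega> u z = 0 \<and> \<omega> v z = 0}"

lemma subspace_perp: "subspace M \<Longrightarrow> subspace (perp M u v)"
  by (rule subspaceI) (auto simp: perp_def form_bilinear subspace_0 subspace_add subspace_scale)

lemma perp_subset: "perp M u v \<subseteq> M"
  by (auto simp: perp_def)

lemma perp_commute: "perp M u v = perp M v u"
  by (auto simp: perp_def)

lemma perp_scale: "c \<noteq> 0 \<Longrightarrow> perp M u (scale c v) = perp M u v"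
  by (auto simp: perp_def form_scale_left)

lemma perp_hsum:
  assumes "plane l u v M" "subspace M"
  shows "perp (hsum 0 u v M) u v = M"
proof (intro equalityI subsetI)
  fix x assume "x \<in> perp (hsum 0 u v M) u v"
  then have x: "x \<in> hsum 0 u v M" "\<omega> u x = 0" "\<omega> v x = 0" by (auto simp: perp_def)
  obtain a b z where x': "x = scale a u + scale b v + z" "z \<in> M"
    using x(1) unfolding mem_hsum by blast
  have "a * p ^ l = 0" "b * p ^ l = 0"
    using plane_coordinates[OF assms(1) x'] x form_swap[of x u] form_swap[of x v] by auto
  then show "x \<in> M" using x' p_nonzero by simp
next
  fix x assume "x \<in> M"
  then show "x \<in> perp (hsum 0 u v M) u v"
    using subsetD[OF subset_hsum] assms(1) by (simp add: perp_def plane_def)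
qed

lemma lev_dvd: "x \<in> lev M s \<Longrightarrow> z \<in> M \<Longrightarrow> p ^ s dvd \<omega> x z"
  and lev_dvd': "x \<in> lev M s \<Longrightarrow> z \<in> M \<Longrightarrow> p ^ s dvd \<omega> z x"
  and lev_mem: "x \<in> lev M s \<Longrightarrow> x \<in> M"
  using form_swap[of z x] by (simp_all add: lev_def)

lemma split_plane:
  assumes M: "subspace M" and uv: "u \<in> lev M s" "v \<in> lev M s" "\<omega> u v = p ^ s"
  shows "hsum 0 u v (perp M u v) = M" "plane s u v (perp M u v)"
proof -
  show "plane s u v (perp M u v)" using uv by (simp add: plane_def perp_def)
  have vu: "\<omega> v u = - (p ^ s)" using uv(3) form_swap[of v u] by simp
  show "hsum 0 u v (perp M u v) = M"
  proof (intro equalityI subsetI)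
    fix x assume "x \<in> hsum 0 u v (perp M u v)"
    then obtain a b z where "x = scale a u + scale b v + z" "z \<in> perp M u v"
      unfolding mem_hsum by blast
    then show "x \<in> M"
      using uv lev_mem perp_subset M by (metis subspace_add subspace_scale subsetD)
  next
    fix x assume x: "x \<in> M"
    obtain a where a: "\<omega> x v = p ^ s * a" using lev_dvd'[OF uv(2) x] unfolding dvd_def by blast
    obtain b where b: "\<omega> u x = p ^ s * b" using lev_dvd[OF uv(1) x] unfolding dvd_def by blast
    define z where "z = x - scale a u - scale b v"
    have "z \<in> M"
      unfolding z_def using x lev_mem[OF uv(1)] lev_mem[OF uv(2)] M
      by (intro subspace_diff subspace_scale)
    moreover have "\<omega> u z = 0" "\<omega> v z = 0"
      using a b uv(3) vu form_swap[of v x] by (simp_all add: z_def form_bilinear)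
    ultimately have "z \<in> perp M u v" by (simp add: perp_def)
    moreover have "x = scale a u + scale b v + z" by (simp add: z_def)
    ultimately show "x \<in> hsum 0 u v (perp M u v)" unfolding mem_hsum by (metis one_dvd power_0)
  qed
qed

text \<open>
  Complements of two planes sharing the vector \<open>m\<close> are isometric: adding a multiple of \<open>m\<close>
  to the elements of one complement moves it onto the other.
\<close>

lemma has_type_perp_exchange_normalized:
  assumes M: "subspace M" and lev: "m \<in> lev M s" "v \<in> lev M s" "w \<in> lev M s"
    and mv: "\<omega> m v = p ^ s" and mw: "\<omega> m w = p ^ s"
    and type: "has_type (perp M m w) \<tau>"
  shows "has_type (perp M m v) \<tau>"
proof -
  define c where "c = (\<lambda>z. SOME c. \<omega> v z = c * p ^ s)"
  have c: "\<omega> v z = c z * p ^ s" if "z \<in> M" for z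
  proof -
    have "\<exists>c. \<omega> v z = c * p ^ s"
      using lev_dvd[OF lev(2) that] unfolding dvd_def by (metis mult.commute)
    then show ?thesis unfolding c_def by (rule someI_ex)
  qed
  have vm: "\<omega> v m = - (p ^ s)" and wm: "\<omega> w m = - (p ^ s)"
    using mv mw form_swap[of v m] form_swap[of w m] by auto
  have cancel: "a = b" if "a * p ^ s = b * p ^ s" for a b using that p_nonzero by simp
  define f where "f = (\<lambda>z. z + scale (c z) m)"
  have f_perp: "f z \<in> perp M m v" if "z \<in> perp M m w" for z
  proof -
    have "z \<in> M" "\<omega> m z = 0" using that by (auto simp: perp_def)
    then show ?thesis
      using c[OF \<open>z \<in> M\<close>] vm lev_mem[OF lev(1)] M
      by (simp add: perp_def f_def form_bilinear subspace_add subspace_scale)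
  qed
  have "has_type (f ` perp M m w) \<tau>"
  proof (rule has_type_isometry[OF type])
    fix x y assume xy: "x \<in> perp M m w" "y \<in> perp M m w"
    then have xyM: "x \<in> M" "y \<in> M" "\<omega> m x = 0" "\<omega> m y = 0" by (auto simp: perp_def)
    have "c (x + y) = c x + c y"
      using c[OF xyM(1)] c[OF xyM(2)] c[OF subspace_add[OF M xyM(1,2)]]
      by - (rule cancel, simp add: form_bilinear algebra_simps)
    then show "f (x + y) = f x + f y" by (simp add: f_def scale_left_distrib)
    have "\<omega> x m = 0" using xyM form_swap[of x m] by simp
    then show "\<omega> (f x) (f y) = \<omega> x y" using xyM by (simp add: f_def form_bilinear)
  next
    fix a x assume "x \<in> perp M m w"
    then have x: "x \<in> M" by (auto simp: perp_def)
    have "c (scale a x) * p ^ s = a * (c x * p ^ s)"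
      using c[OF x] c[OF subspace_scale[OF M x, of a]] by (metis form_scale_right)
    then have "c (scale a x) = a * c x" by (intro cancel[of "c (scale a x)"]) (simp add: mult.assoc)
    then show "f (scale a x) = scale a (f x)" by (simp add: f_def scale_right_distrib)
  qed
  moreover have "f ` perp M m w = perp M m v"
  proof (intro equalityI subsetI)
    fix y assume y: "y \<in> perp M m v"
    then have yM: "y \<in> M" "\<omega> m y = 0" "\<omega> v y = 0" by (auto simp: perp_def)
    obtain d where d: "\<omega> w y = d * p ^ s"
      using lev_dvd[OF lev(3) yM(1)] unfolding dvd_def by (metis mult.commute)
    define z where "z = y + scale d m"
    have z: "z \<in> perp M m w"
      using yM d wm lev_mem[OF lev(1)] M
      by (simp add: z_def perp_def form_bilinear subspace_add subspace_scale)
    have "c z = - d"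
    proof (rule cancel)
      have "z \<in> M" using z by (simp add: perp_def)
      then have "c z * p ^ s = \<omega> v z" using c by simp
      also have "\<dots> = - d * p ^ s" using yM vm by (simp add: z_def form_bilinear)
      finally show "c z * p ^ s = - d * p ^ s" .
    qed
    then have "f z = y" by (simp add: f_def z_def)
    then show "y \<in> f ` perp M m w" using z by blast
  qed (use f_perp in blast)
  ultimately show ?thesis by simp
qed

lemma normalize_pair:
  assumes "u \<in> lev M s" "v \<in> lev M s" "\<not> p ^ Suc s dvd \<omega> u v" "subspace M"
  shows "\<exists>d. d \<noteq> 0 \<and> scale d v \<in> lev M s \<and> \<omega> u (scale d v) = p ^ s"
proof -
  obtain c d where cd: "c * d = 1" "\<omega> u v = c * p ^ s"
    using unit_times_power[OF lev_dvd[OF assms(1) lev_mem[OF assms(2)]] assms(3)] by blast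
  have "\<omega> u (scale d v) = (c * d) * p ^ s" using cd(2) by (simp add: form_bilinear ac_simps)
  moreover have "d \<noteq> 0" using cd(1) by auto
  ultimately show ?thesis
    using cd(1) subspace_scale[OF subspace_lev[OF assms(4)] assms(2)] by auto
qed

lemma has_type_perp_exchange:
  assumes M: "subspace M" and lev: "m \<in> lev M s" "v \<in> lev M s" "w \<in> lev M s"
    and mv: "\<not> p ^ Suc s dvd \<omega> m v" and mw: "\<not> p ^ Suc s dvd \<omega> m w"
    and type: "has_type (perp M m w) \<tau>"
  shows "has_type (perp M m v) \<tau>"
proof -
  obtain c where c: "c \<noteq> 0" "scale c v \<in> lev M s" "\<omega> m (scale c v) = p ^ s"
    using normalize_pair[OF lev(1,2) mv M] by blast
  obtain d where d: "d \<noteq> 0" "scale d w \<in> lev M s" "\<omega> m (scale d w) = p ^ s"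
    using normalize_pair[OF lev(1,3) mw M] by blast
  show ?thesis
    using has_type_perp_exchange_normalized[OF M lev(1) c(2) d(2) c(3) d(3)] type
    by (simp add: perp_scale c(1) d(1))
qed

lemma exists_plane:
  "has_type M \<tau> \<Longrightarrow> s \<in># \<tau> \<Longrightarrow>
    \<exists>u\<in>lev M s. \<exists>w\<in>lev M s. \<omega> u w = p ^ s \<and> has_type (perp M u w) (\<tau> - {#s#})"
proof (induction rule: has_type.induct)
  case (has_type_plane M \<tau> l u v)
  note M = has_type_subspace[OF has_type_plane.hyps(1)]
  note P = has_type_plane.hyps(2)
  show ?case
  proof (cases "l = s")
    case True
    have "u \<in> lev (hsum 0 u v M) s" "v \<in> lev (hsum 0 u v M) s"
      unfolding lev_hsum[OF P M] using True plane_mem_hsum[OF subspace_lev[OF M]] by auto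
    moreover have "\<omega> u v = p ^ s" using P True by (simp add: plane_def)
    moreover have "has_type (perp (hsum 0 u v M) u v) (add_mset l \<tau> - {#s#})"
      using perp_hsum[OF P M] has_type_plane.hyps(1) True by simp
    ultimately show ?thesis by blast
  next
    case False
    then have "s \<in># \<tau>" using has_type_plane.prems by simp
    then obtain a b where ab: "a \<in> lev M s" "b \<in> lev M s" "\<omega> a b = p ^ s"
      "has_type (perp M a b) (\<tau> - {#s#})"
      using has_type_plane.IH by blast
    have abM: "a \<in> M" "b \<in> M" using ab lev_mem by auto
    have "a \<in> lev (hsum 0 u v M) s" "b \<in> lev (hsum 0 u v M) s"
      unfolding lev_hsum[OF P M] using ab subsetD[OF subset_hsum] by blast+
    moreover have "perp (hsum 0 u v M) a b = hsum 0 u v (perp M a b)"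
    proof -
      have "\<omega> c (scale x u + scale y v + z) = \<omega> c z" if "c \<in> M" for c x y z
        using that P form_swap[of c u] form_swap[of c v] by (simp add: plane_def form_bilinear)
      then have "\<omega> a x = \<omega> a z \<and> \<omega> b x = \<omega> b z"
        if "x = scale c u + scale d v + z" for x c d z
        using that abM by simp
      then show ?thesis unfolding perp_def mem_hsum set_eq_iff mem_Collect_eq by metis
    qed
    moreover have "has_type (hsum 0 u v (perp M a b)) (add_mset l (\<tau> - {#s#}))"
      using has_type.has_type_plane[OF ab(4) plane_subset[OF P perp_subset]] .
    moreover have "add_mset l \<tau> - {#s#} = add_mset l (\<tau> - {#s#})" using False by simp
    ultimately show ?thesis using ab(3) by metis
  qed
qed simp

text \<open>
  Witt cancellation for a plane of level \<open>s\<close>. Any two such planes are joined by a chain in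
  which neighbours share a vector.
\<close>

lemma has_type_perp:
  assumes type: "has_type M \<tau>" "s \<in># \<tau>" and lev: "m \<in> lev M s" "v \<in> lev M s"
    and mv: "\<not> p ^ Suc s dvd \<omega> m v"
  shows "has_type (perp M m v) (\<tau> - {#s#})"
proof -
  note M = has_type_subspace[OF type(1)]
  obtain u w where uw: "u \<in> lev M s" "w \<in> lev M s" "\<omega> u w = p ^ s"
    "has_type (perp M u w) (\<tau> - {#s#})"
    using exists_plane[OF type] by blast
  have uw': "\<not> p ^ Suc s dvd \<omega> u w"
    using uw(3) p_power_dvd_iff[of "Suc s" s] by simp
  \<comment> \<open>A vector \<open>t\<close> off two hyperplanes: one of \<open>w\<close>, \<open>v\<close> and their sum will do, even when \<open>q = 2\<close>.\<close>
  define good where "good = (\<lambda>t. t \<in> lev M s \<and> \<not> p ^ Suc s dvd \<omega> u t \<and> \<not> p ^ Suc s dvd \<omega> m t)"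
  have "\<exists>t. good t"
  proof (cases "good w \<or> good v")
    case False
    then have "p ^ Suc s dvd \<omega> m w" "p ^ Suc s dvd \<omega> u v"
      using uw uw' lev mv by (auto simp: good_def)
    then have "good (v + w)"
      using uw uw' lev mv M
      by (auto simp: good_def form_bilinear subspace_add subspace_lev dvd_add_right_iff
          dvd_add_left_iff)
    then show ?thesis by blast
  qed blast
  then obtain t where t: "t \<in> lev M s" "\<not> p ^ Suc s dvd \<omega> u t" "\<not> p ^ Suc s dvd \<omega> m t"
    by (auto simp: good_def)
  have "has_type (perp M t u) (\<tau> - {#s#})"
    using has_type_perp_exchange[OF M uw(1) t(1) uw(2) t(2) uw' uw(4)] perp_commute by metis
  moreover have "\<not> p ^ Suc s dvd \<omega> t u" "\<not> p ^ Suc s dvd \<omega> t m"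
    using t form_swap[of t u] form_swap[of t m] by auto
  ultimately have "has_type (perp M t m) (\<tau> - {#s#})"
    using has_type_perp_exchange[OF M t(1) lev(1) uw(1)] by blast
  then show ?thesis
    using has_type_perp_exchange[OF M lev t(1) mv t(3)] perp_commute by metis
qed

section \<open>Neighbouring lattices\<close>

text \<open>
  For \<open>y\<close> in \<open>lev M s\<close> this is the kernel of the functional \<open>p\<^sup>-\<^sup>s \<omega> z y\<close> to the residue field.
\<close>

definition kern :: "'v set \<Rightarrow> nat \<Rightarrow> 'v \<Rightarrow> 'v set" where
  "kern M s y = {z \<in> M. p ^ Suc s dvd \<omega> z y}"

lemma subspace_kern: "subspace M \<Longrightarrow> subspace (kern M s y)"
  by (rule subspaceI)
    (auto simp: kern_def form_bilinear subspace_0 subspace_add subspace_scale)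

text \<open>
  The vectors \<open>x\<close> and \<open>y\<close> span a plane of level \<open>s\<close>, and passing to the kernel only replaces
  \<open>x\<close> by \<open>p x\<close>: one elementary divisor goes up by one step.
\<close>

lemma has_type_kern:
  assumes type: "has_type M \<tau>" "s \<in># \<tau>" and lev: "x \<in> lev M s" "y \<in> lev M s"
    and xy: "\<not> p ^ Suc s dvd \<omega> x y"
  shows "has_type (kern M s y) (add_mset (Suc s) (\<tau> - {#s#}))"
proof -
  note M = has_type_subspace[OF type(1)]
  have "\<not> p ^ Suc s dvd \<omega> y x" using xy form_swap[of y x] by simp
  then obtain d where d: "d \<noteq> 0" "scale d x \<in> lev M s" "\<omega> y (scale d x) = p ^ s"
    using normalize_pair[OF lev(2,1)] M by blast
  define w where "w = scale (- d) x"
  have w: "w \<in> lev M s" "\<omega> w y = p ^ s"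
    using d subspace_neg[OF subspace_lev[OF M]] form_swap[of y "scale d x"]
    by (auto simp: w_def form_bilinear)
  define P where "P = perp M w y"
  have MP: "hsum 0 w y P = M" and P: "plane s w y P"
    unfolding P_def using split_plane[OF M w(1) lev(2) w(2)] by auto
  have typeP: "has_type P (\<tau> - {#s#})"
    unfolding P_def using w p_power_dvd_iff[of "Suc s" s] by (intro has_type_perp[OF type w(1) lev(2)]) simp
  have "plane (Suc s) (scale p w) y P" using P by (simp add: plane_def form_bilinear)
  moreover have "kern M s y = hsum 0 (scale p w) y P"
  proof (intro equalityI subsetI)
    fix z assume "z \<in> kern M s y"
    then have z: "z \<in> hsum 0 w y P" "p ^ Suc s dvd \<omega> z y" using MP by (auto simp: kern_def)
    obtain a b z' where z': "z = scale a w + scale b y + z'" "z' \<in> P"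
      using z(1) unfolding mem_hsum by blast
    have "p ^ s * p dvd p ^ s * a"
      using z(2) plane_coordinates(1)[OF P z'] by (simp add: mult.commute)
    then have "p dvd a" unfolding p_power_dvd_cancel .
    then obtain a' where "a = p * a'" by (rule dvdE)
    then have "z = scale a' (scale p w) + scale b y + z'" using z'(1) by (simp add: mult.commute)
    then show "z \<in> hsum 0 (scale p w) y P" using z'(2) unfolding mem_hsum by (metis one_dvd power_0)
  next
    fix z assume "z \<in> hsum 0 (scale p w) y P"
    then obtain a b z' where z: "z = scale a (scale p w) + scale b y + z'" "z' \<in> P"
      unfolding mem_hsum by blast
    then have z': "z = scale (a * p) w + scale b y + z'" by simp
    then have "z \<in> M" unfolding MP[symmetric] mem_hsum using z(2) by (metis one_dvd power_0)
    moreover have "p ^ Suc s dvd \<omega> z y" using plane_coordinates(1)[OF P z' z(2)] by simp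
    ultimately show "z \<in> kern M s y" by (simp add: kern_def)
  qed
  ultimately show ?thesis using has_type_plane[OF typeP] by simp
qed

text \<open>The reverse passage, which divides a basis vector of a plane by \<open>p\<close>.\<close>

lemma has_type_add_generator:
  assumes type: "has_type M \<tau>" "Suc s \<in># \<tau>" and x: "scale p x \<in> lev M (Suc s)"
    and v: "v \<in> lev M (Suc s)" "\<omega> x v = p ^ s"
  shows "has_type (line 0 x M) (add_mset s (\<tau> - {#Suc s#}))"
proof -
  note M = has_type_subspace[OF type(1)]
  define P where "P = perp M (scale p x) v"
  have xv: "\<omega> (scale p x) v = p ^ Suc s" using v by (simp add: form_bilinear)
  have MP: "hsum 0 (scale p x) v P = M" and P: "plane (Suc s) (scale p x) v P"
    unfolding P_def using split_plane[OF M x v(1) xv] by auto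
  have typeP: "has_type P (\<tau> - {#Suc s#})"
    unfolding P_def using xv p_power_dvd_iff[of "Suc (Suc s)" "Suc s"]
    by (intro has_type_perp[OF type x v(1)]) simp
  have "plane s x v P" using P v p_nonzero by (auto simp: plane_def form_bilinear)
  moreover have "line 0 x M = hsum 0 x v P"
  proof (intro equalityI subsetI)
    fix z assume "z \<in> line 0 x M"
    then obtain a z1 where z1: "z = scale a x + z1" "z1 \<in> M" by (auto simp: line_def)
    obtain b c z2 where z2: "z1 = scale b (scale p x) + scale c v + z2" "z2 \<in> P"
      using z1(2) unfolding MP[symmetric] mem_hsum by blast
    have "z = scale (a + b * p) x + scale c v + z2"
      using z1 z2 by (simp add: scale_left_distrib)
    then show "z \<in> hsum 0 x v P" using z2(2) unfolding mem_hsum by (metis one_dvd power_0)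
  next
    fix z assume "z \<in> hsum 0 x v P"
    then obtain a b z' where z: "z = scale a x + scale b v + z'" "z' \<in> P"
      unfolding mem_hsum by blast
    have "scale b v + z' \<in> M"
      using z(2) lev_mem[OF v(1)] perp_subset M unfolding P_def
      by (meson subsetD subspace_add subspace_scale)
    then show "z \<in> line 0 x M" using z(1) unfolding line_def by (auto simp: add.assoc)
  qed
  ultimately show ?thesis using has_type_plane[OF typeP] by simp
qed

lemma scale_mem_iff:
  assumes M: "subspace M" and x: "x \<notin> M" "scale p x \<in> M"
  shows "scale a x \<in> M \<longleftrightarrow> p dvd a"
proof
  assume ax: "scale a x \<in> M"
  show "p dvd a"
  proof (rule ccontr)
    assume "\<not> p dvd a"
    then obtain b where "b * a = 1" using unit_if_not_dvd by (metis dvdE mult.commute)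
    then have "x = scale b (scale a x)" by simp
    then show False using subspace_scale[OF M ax, of b] x by simp
  qed
next
  assume "p dvd a"
  then obtain b where "a = b * p" unfolding dvd_def by (auto simp: mult.commute)
  then show "scale a x \<in> M" using subspace_scale[OF M x(2), of b] by simp
qed

lemma idx_add_generator:
  assumes M: "subspace M" and x: "x \<notin> M" "scale p x \<in> M"
  shows "idx (line 0 x M) M = q"
proof -
  have "idx UNIV {a. p dvd a} = idx (line 0 x M) M"
  proof (rule idx_cong_hom[where f = "\<lambda>a. scale a x"])
    fix a
    show "scale a x \<in> line 0 x M" using subspace_0[OF M] unfolding line_def by force
    show "scale a x \<in> M \<longleftrightarrow> a \<in> {a. p dvd a}" using scale_mem_iff[OF M x] by simp
  next
    fix y assume "y \<in> line 0 x M"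
    then obtain a z where "y = scale a x + z" "z \<in> M" by (auto simp: line_def)
    then show "\<exists>a\<in>UNIV. y - scale a x \<in> M" by (intro bexI[of _ a]) auto
  qed (use M in \<open>auto simp: add_subgroup_subspace add_subgroup_multiples scale_left_diff_distrib\<close>)
  then show ?thesis using residue by simp
qed

lemma power_multiple_mem:
  assumes L: "subspace L" and M: "subspace M" "M \<subseteq> L" "idx L M > 0" and z: "z \<in> L"
  shows "\<exists>k. scale (p ^ k) z \<in> M"
proof -
  obtain a b :: nat where ab: "a < b" "scale (p ^ a) z - scale (p ^ b) z \<in> M"
    using idx_pos_pigeonhole[OF add_subgroup_subspace[OF M(1)] M(3), of "\<lambda>k. scale (p ^ k) z"]
      subspace_scale[OF L z] by auto
  note ab(2)
  moreover have "p ^ b = (p ^ (b - a)) * p ^ a" using ab(1) by (simp flip: power_add)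
  ultimately have "scale (1 - p ^ (b - a)) (scale (p ^ a) z) \<in> M"
    by (simp add: scale_left_diff_distrib left_diff_distrib)
  moreover obtain c where "c * (1 - p ^ (b - a)) = 1"
    using unit_one_minus_power[of "b - a"] ab(1) by (metis dvdE mult.commute zero_less_diff)
  ultimately have "scale (p ^ a) z \<in> M"
    using subspace_scale[OF M(1), of "scale (1 - p ^ (b - a)) (scale (p ^ a) z)" c]
    by (metis mult.assoc mult_1 scale_scale)
  then show ?thesis by blast
qed

text \<open>The last multiple \<open>p\<^sup>j z\<close> outside \<open>M\<close> of a vector \<open>z\<close> outside \<open>M\<close>.\<close>

lemma exists_index_q_extension:
  assumes L: "subspace L" and M: "subspace M" "M \<subseteq> L" "idx L M > 0" "M \<noteq> L"
  shows "\<exists>x\<in>L. x \<notin> M \<and> scale p x \<in> M"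
proof -
  obtain z where z: "z \<in> L" "z \<notin> M" using M by blast
  define k where "k = (LEAST k. scale (p ^ k) z \<in> M)"
  have k: "scale (p ^ k) z \<in> M"
    unfolding k_def using power_multiple_mem[OF L M(1-3) z(1)] by (rule LeastI_ex)
  then have "k \<noteq> 0" using z by (intro notI) simp
  then obtain j where j: "k = Suc j" using not0_implies_Suc by blast
  have "scale (p ^ j) z \<notin> M" using not_less_Least[of j "\<lambda>k. scale (p ^ k) z \<in> M"] j by (simp add: k_def)
  moreover have "scale p (scale (p ^ j) z) \<in> M" using k j by simp
  ultimately show ?thesis using subspace_scale[OF L z(1)] by blast
qed

lemma subspace_line_subset: "subspace L \<Longrightarrow> x \<in> L \<Longrightarrow> M \<subseteq> L \<Longrightarrow> line i x M \<subseteq> L"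
  unfolding line_def by (auto intro: subspace_add subspace_scale)

text \<open>
  A sublattice of index \<open>q\<close> is the kernel of a functional \<open>f\<close> to the residue field. If \<open>s\<close> is the
  largest level at which \<open>f\<close> does not vanish, then \<open>f\<close> is the pairing with a vector of level \<open>s\<close>
  and the sublattice is one of the kernels considered above.
\<close>

lemma has_type_index_q:
  assumes type: "has_type (line 0 x M) \<sigma>" and M: "subspace M" and x: "x \<notin> M" "scale p x \<in> M"
  shows "\<exists>s\<in>#\<sigma>. has_type M (add_mset (Suc s) (\<sigma> - {#s#}))"
proof -
  define N where "N = line 0 x M"
  have N: "has_type N \<sigma>" "subspace N" and MN: "M \<subseteq> N"
    using type subspace_line[OF M] subset_line by (auto simp: N_def)
  have pN: "scale p y \<in> M" if yN: "y \<in> N" for y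
  proof -
    obtain a z where "y = scale a x + z" "z \<in> M" using yN by (auto simp: N_def line_def)
    then have "scale p y = scale a (scale p x) + scale p z"
      by (simp add: scale_right_distrib mult.commute)
    moreover have "scale a (scale p x) + scale p z \<in> M"
      by (intro subspace_add[OF M] subspace_scale[OF M] x(2) \<open>z \<in> M\<close>)
    ultimately show ?thesis by simp
  qed
  have xN: "x \<in> N" using subspace_0[OF M] unfolding N_def line_def
    by (intro CollectI exI[of _ 1] exI[of _ 0]) simp
  obtain r where r: "\<forall>l\<in>#\<sigma>. l \<le> r"
    by (metis Max_ge finite_set_mset)
  have "lev N (Suc r) \<subseteq> M"
    using lev_Suc_subset_rad[of N r] pN unfolding rad_top[OF N(1) r] by auto
  define s where "s = (LEAST s. lev N (Suc s) \<subseteq> M)"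
  have s1: "lev N (Suc s) \<subseteq> M" unfolding s_def using \<open>lev N (Suc r) \<subseteq> M\<close> by (rule LeastI)
  have "\<not> lev N s \<subseteq> M"
  proof (cases s)
    case 0
    then show ?thesis using xN x(1) by (auto simp: lev_0)
  next
    case (Suc j)
    then show ?thesis using not_less_Least[of j "\<lambda>s. lev N (Suc s) \<subseteq> M"] by (simp add: s_def)
  qed
  then obtain w where w: "w \<in> lev N s" "w \<notin> M" by blast
  define f where "f = (\<lambda>z. SOME a. z - scale a x \<in> M)"
  have f: "z - scale (f z) x \<in> M" if zN: "z \<in> N" for z
  proof -
    obtain a w where "z = scale a x + w" "w \<in> M" using zN by (auto simp: N_def line_def)
    then have "\<exists>a. z - scale a x \<in> M" by (intro exI[of _ a]) simp
    then show ?thesis unfolding f_def by (rule someI_ex)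
  qed
  note mult_x = scale_mem_iff[OF M x, THEN iffD1]
  have fM: "p dvd f z \<longleftrightarrow> z \<in> M" if "z \<in> N" for z
  proof
    assume "p dvd f z"
    then have "scale (f z) x \<in> M" using scale_mem_iff[OF M x] by simp
    then show "z \<in> M" using subspace_add[OF M f[OF that], of "scale (f z) x"] by simp
  next
    assume "z \<in> M"
    then have "scale (f z) x \<in> M" using subspace_diff[OF M _ f[OF that], of z] by simp
    then show "p dvd f z" by (rule mult_x)
  qed
  have "\<exists>y\<in>lev N s. \<forall>z\<in>N. p ^ Suc s dvd \<omega> z y - f z * p ^ s"
  proof (rule residue_functional_represented[OF N(1)])
    fix a b assume ab: "a \<in> N" "b \<in> N"
    have "(a + b - scale (f (a + b)) x) - (a - scale (f a) x) - (b - scale (f b) x) \<in> M"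
      by (intro subspace_diff[OF M] f ab subspace_add[OF N(2)])
    then have "scale (f a + f b - f (a + b)) x \<in> M"
      by (simp add: scale_left_diff_distrib scale_left_distrib algebra_simps)
    then have "p dvd f a + f b - f (a + b)" by (rule mult_x)
    then show "p dvd f (a + b) - (f a + f b)" by (metis dvd_minus_iff minus_diff_eq)
  next
    fix c a assume a: "a \<in> N"
    have "(scale c a - scale (f (scale c a)) x) - scale c (a - scale (f a) x) \<in> M"
      by (intro subspace_diff[OF M] subspace_scale[OF M] f a subspace_scale[OF N(2)])
    then have "scale (c * f a - f (scale c a)) x \<in> M"
      by (simp add: scale_left_diff_distrib scale_right_diff_distrib)
    then have "p dvd c * f a - f (scale c a)" by (rule mult_x)
    then show "p dvd f (scale c a) - c * f a" by (metis dvd_minus_iff minus_diff_eq)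
  next
    fix z assume z: "z \<in> lev N (Suc s)"
    then show "p dvd f z" using fM[OF lev_mem[OF z]] s1 by blast
  qed
  then obtain y where y: "y \<in> lev N s" "\<And>z. z \<in> N \<Longrightarrow> p ^ Suc s dvd \<omega> z y - f z * p ^ s"
    by blast
  have y_iff: "p ^ Suc s dvd \<omega> z y \<longleftrightarrow> z \<in> M" if z: "z \<in> N" for z
  proof -
    have "p ^ Suc s dvd \<omega> z y \<longleftrightarrow> p ^ Suc s dvd f z * p ^ s"
      using y(2)[OF z] by (metis dvd_diff_commute dvd_add_right_iff diff_add_cancel)
    also have "\<dots> \<longleftrightarrow> p dvd f z" using p_power_dvd_cancel[of s p "f z"] by (simp add: mult.commute)
    finally show ?thesis using fM[OF z] by simp
  qed
  have wy: "\<not> p ^ Suc s dvd \<omega> w y" using y_iff[OF lev_mem[OF w(1)]] w(2) by simp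
  have "s \<in># \<sigma>"
  proof (rule ccontr)
    assume "s \<notin># \<sigma>"
    then have "w \<in> rad N s" using not_in_type_iff[OF N(1)] w(1) by simp
    then show False using wy y(1) by (simp add: rad_def)
  qed
  moreover have "kern N s y = M" using y_iff MN unfolding kern_def by blast
  ultimately show ?thesis using has_type_kern[OF N(1) _ w(1) y(1) wy] by auto
qed

text \<open>
  Symplectic bases exist for all sublattices of finite index. A chain of steps of index \<open>q\<close>
  connects \<open>M\<close> with \<open>L\<close>, and each step raises a single elementary divisor by one.
\<close>

theorem sublattice_has_type:
  assumes L: "has_type L \<tau>0" and "subspace M" "M \<subseteq> L" "idx L M > 0"
  shows "\<exists>\<tau>. has_type M \<tau> \<and> size \<tau> = size \<tau>0 \<and> idx L M * q ^ (\<Sum>\<^sub># \<tau>0) = q ^ (\<Sum>\<^sub># \<tau>)"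
  using assms(2-)
proof (induction "idx L M" arbitrary: M rule: less_induct)
  case less
  note Ls = has_type_subspace[OF L]
  show ?case
  proof (cases "M = L")
    case True
    then show ?thesis using L idx_self[OF add_subgroup_subspace[OF Ls]] by auto
  next
    case False
    then obtain x where x: "x \<in> L" "x \<notin> M" "scale p x \<in> M"
      using exists_index_q_extension[OF Ls less.prems] by blast
    define N where "N = line 0 x M"
    have N: "subspace N" "N \<subseteq> L" "M \<subseteq> N"
      unfolding N_def using subspace_line less.prems subset_line
        subspace_line_subset[OF Ls x(1) less.prems(2)] by auto
    have idx: "idx L M = idx L N * q"
      using idx_tower[of L N M] idx_add_generator[OF less.prems(1) x(2,3)] N Ls less.prems(1)
      by (simp add: N_def add_subgroup_subspace)
    then have "idx L N < idx L M" "idx L N > 0" using less.prems(3) q_ge_2 by (auto intro: gr0I)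
    then obtain \<sigma> where \<sigma>: "has_type N \<sigma>" "size \<sigma> = size \<tau>0"
      "idx L N * q ^ (\<Sum>\<^sub># \<tau>0) = q ^ (\<Sum>\<^sub># \<sigma>)"
      using less.hyps N by blast
    obtain s where s: "s \<in># \<sigma>" "has_type M (add_mset (Suc s) (\<sigma> - {#s#}))"
      using has_type_index_q[OF _ less.prems(1) x(2,3)] \<sigma>(1) unfolding N_def by blast
    obtain \<rho> where \<rho>: "\<sigma> = add_mset s \<rho>" using s(1) by (metis multi_member_split)
    have "idx L M * q ^ (\<Sum>\<^sub># \<tau>0) = q ^ (\<Sum>\<^sub># (add_mset (Suc s) \<rho>))"
      using \<sigma>(3) unfolding idx \<rho> by (simp add: ac_simps)
    then show ?thesis using s(2) \<sigma>(2) \<rho>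
      by (intro exI[of _ "add_mset (Suc s) \<rho>"]) simp
  qed
qed

section \<open>Pairs of neighbouring lattices\<close>

definition lattices :: "'v set \<Rightarrow> nat multiset \<Rightarrow> 'v set set" where
  "lattices L \<tau> = {M. M \<subseteq> L \<and> has_type M \<tau> \<and> idx L M > 0}"

lemma line_coset:
  assumes M: "subspace M"
  shows "{scale a x' + z | a x' z. x' \<in> coset M x \<and> z \<in> M} = line 0 x M"
proof (intro equalityI subsetI)
  fix y assume "y \<in> {scale a x' + z | a x' z. x' \<in> coset M x \<and> z \<in> M}"
  then obtain a x' z where y: "y = scale a x' + z" "x' - x \<in> M" "z \<in> M"
    by (auto simp: mem_coset_iff)
  have "y = scale a x + (scale a (x' - x) + z)" using y by (simp add: scale_right_diff_distrib)
  moreover have "scale a (x' - x) + z \<in> M" using y M by (intro subspace_add subspace_scale)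
  ultimately show "y \<in> line 0 x M" unfolding line_def by auto
next
  fix y assume "y \<in> line 0 x M"
  then obtain a z where "y = scale a x + z" "z \<in> M" by (auto simp: line_def)
  moreover have "x \<in> coset M x" using subspace_0[OF M] by (simp add: mem_coset_iff)
  ultimately show "y \<in> {scale a x' + z | a x' z. x' \<in> coset M x \<and> z \<in> M}" by blast
qed

text \<open>
  Let \<open>N\<close> contain \<open>M\<close> with index \<open>q\<close>. A generator of \<open>N/M\<close> is the same as a functional on \<open>N\<close>
  to the residue field with kernel \<open>M\<close>, namely the one that takes the value \<open>1\<close> there. The
  generator is recorded as the coset \<open>X = x + M\<close>, the functional as the class \<open>Y\<close> of a vector \<open>y\<close>
  that represents it, modulo \<open>lev N (s + 1)\<close>. The following maps turn the pair \<open>(M, X)\<close> into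
  \<open>(N, Y)\<close> and back.
\<close>

definition extend_pair :: "nat \<Rightarrow> 'v set \<times> 'v set \<Rightarrow> 'v set \<times> 'v set" where
  "extend_pair s = (\<lambda>(M, X).
    let N = {scale a x + z | a x z. x \<in> X \<and> z \<in> M}
    in (N, {y \<in> lev N s. \<forall>z\<in>X. p ^ Suc s dvd \<omega> z y - p ^ s}))"

definition restrict_pair :: "nat \<Rightarrow> 'v set \<times> 'v set \<Rightarrow> 'v set \<times> 'v set" where
  "restrict_pair s = (\<lambda>(N, Y).
    ({z \<in> N. \<forall>y\<in>Y. p ^ Suc s dvd \<omega> z y}, {z \<in> N. \<forall>y\<in>Y. p ^ Suc s dvd \<omega> z y - p ^ s}))"

lemma pair_correspondence:
  assumes N: "subspace N" and xy: "x \<in> lev N s" "y \<in> lev N s" "\<omega> x y = p ^ s"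
  shows "restrict_pair s (N, coset (lev N (Suc s)) y) = (kern N s y, coset (kern N s y) x)"
    and "extend_pair s (kern N s y, coset (kern N s y) x) = (N, coset (lev N (Suc s)) y)"
proof -
  define M where "M = kern N s y"
  have M: "subspace M" unfolding M_def by (rule subspace_kern[OF N])
  have MN: "M \<subseteq> N" by (auto simp: M_def kern_def)
  have memM: "z \<in> M \<longleftrightarrow> z \<in> N \<and> p ^ Suc s dvd \<omega> z y" for z by (simp add: M_def kern_def)
  have xN: "x \<in> N" and yN: "y \<in> N" using xy lev_mem by auto
  have shift: "p ^ Suc s dvd \<omega> z y' - c \<longleftrightarrow> p ^ Suc s dvd \<omega> z y - c"
    if "y' \<in> coset (lev N (Suc s)) y" "z \<in> N" for y' z c
  proof -
    have "y' - y \<in> lev N (Suc s)" using that(1) by (simp add: mem_coset_iff)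
    then have "p ^ Suc s dvd \<omega> z (y' - y)" using that(2) by (rule lev_dvd')
    moreover have "\<omega> z y' - c = \<omega> z (y' - y) + (\<omega> z y - c)" by (simp add: form_bilinear)
    ultimately show ?thesis using dvd_add_right_iff by metis
  qed
  have y_mem: "y \<in> coset (lev N (Suc s)) y"
    using subspace_0[OF subspace_lev[OF N]] by (simp add: mem_coset_iff)
  have cosetM: "z \<in> coset M x \<longleftrightarrow> z \<in> N \<and> p ^ Suc s dvd \<omega> z y - p ^ s" for z
  proof -
    have "z - x \<in> N \<longleftrightarrow> z \<in> N"
      using subspace_add[OF N _ xN, of "z - x"] subspace_diff[OF N _ xN, of z] by auto
    moreover have "\<omega> (z - x) y = \<omega> z y - p ^ s" using xy by (simp add: form_bilinear)
    ultimately show ?thesis by (simp add: mem_coset_iff memM)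
  qed
  show "restrict_pair s (N, coset (lev N (Suc s)) y) = (kern N s y, coset (kern N s y) x)"
  proof -
    have "{z \<in> N. \<forall>y'\<in>coset (lev N (Suc s)) y. p ^ Suc s dvd \<omega> z y'} = M"
      using shift[where c = 0] y_mem memM by auto
    moreover have "{z \<in> N. \<forall>y'\<in>coset (lev N (Suc s)) y. p ^ Suc s dvd \<omega> z y' - p ^ s} = coset M x"
      using shift[where c = "p ^ s"] y_mem cosetM by blast
    ultimately show ?thesis unfolding restrict_pair_def M_def by simp
  qed
  have N_line: "line 0 x M = N"
  proof (intro equalityI subsetI)
    fix z assume z: "z \<in> N"
    obtain a where a: "\<omega> z y = p ^ s * a" using lev_dvd'[OF xy(2) z] by (rule dvdE)
    have "z - scale a x \<in> N" using z xN N by (intro subspace_diff subspace_scale)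
    moreover have "\<omega> (z - scale a x) y = 0" using a xy(3) by (simp add: form_bilinear)
    ultimately have "z - scale a x \<in> M" by (simp add: memM)
    moreover have "z = scale a x + (z - scale a x)" by simp
    ultimately show "z \<in> line 0 x M" unfolding line_def by force
  qed (use subspace_line_subset[OF N xN MN] in blast)
  have Y: "{y' \<in> lev N s. \<forall>z\<in>coset M x. p ^ Suc s dvd \<omega> z y' - p ^ s} = coset (lev N (Suc s)) y"
  proof (intro equalityI subsetI)
    fix y' assume "y' \<in> {y' \<in> lev N s. \<forall>z\<in>coset M x. p ^ Suc s dvd \<omega> z y' - p ^ s}"
    then have y': "y' \<in> lev N s" "\<And>z. z \<in> coset M x \<Longrightarrow> p ^ Suc s dvd \<omega> z y' - p ^ s" by auto
    have d: "p ^ Suc s dvd \<omega> z (y' - y)" if "z \<in> coset M x" for z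
      using dvd_diff[OF y'(2)[OF that], of "\<omega> z y - p ^ s"] that cosetM
      by (simp add: form_bilinear)
    have "p ^ Suc s dvd \<omega> (y' - y) z" if z: "z \<in> N" for z
    proof -
      obtain a m where am: "z = scale a x + m" "m \<in> M"
        using z unfolding N_line[symmetric] line_def by blast
      have x: "x \<in> coset M x" "x + m \<in> coset M x"
        using am(2) subspace_0[OF M] by (simp_all add: mem_coset_iff)
      have "\<omega> z (y' - y) = a * \<omega> x (y' - y) + (\<omega> (x + m) (y' - y) - \<omega> x (y' - y))"
        by (simp add: am(1) form_bilinear right_diff_distrib)
      also have "p ^ Suc s dvd \<dots>"
        using d[OF x(1)] d[OF x(2)] by (rule_tac dvd_add[OF dvd_mult dvd_diff])
      finally show ?thesis using form_swap[of "y' - y" z] by simp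
    qed
    moreover have "y' - y \<in> N" using y' yN N lev_mem by (intro subspace_diff) auto
    ultimately show "y' \<in> coset (lev N (Suc s)) y" by (simp add: mem_coset_iff lev_def)
  next
    fix y' assume y': "y' \<in> coset (lev N (Suc s)) y"
    then have "y' - y \<in> lev N s"
      using subsetD[OF lev_Suc_subset_rad] subsetD[OF rad_subset_lev] by (simp add: mem_coset_iff)
    then have "y' \<in> lev N s"
      using subspace_add[OF subspace_lev[OF N] _ xy(2), of "y' - y"] by simp
    then show "y' \<in> {y' \<in> lev N s. \<forall>z\<in>coset M x. p ^ Suc s dvd \<omega> z y' - p ^ s}"
      using shift[OF y', where c = "p ^ s"] cosetM by blast
  qed
  show "extend_pair s (kern N s y, coset (kern N s y) x) = (N, coset (lev N (Suc s)) y)"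
    unfolding extend_pair_def M_def[symmetric] prod.case line_coset[OF M] N_line Let_def Y ..
qed

text \<open>
  The value \<open>1\<close> of the functional is taken at a vector \<open>x\<close> of level \<open>s\<close> because \<open>y\<close> is not in the
  radical.
\<close>

lemma mem_kern_neighbour:
  assumes N: "has_type N (add_mset s \<rho>)" and y: "y \<in> lev N s" "y \<notin> rad N s"
  shows "\<exists>x\<in>lev N s. \<omega> x y = p ^ s \<and> x \<notin> kern N s y \<and> scale p x \<in> lev (kern N s y) (Suc s) \<and>
    has_type (kern N s y) (add_mset (Suc s) \<rho>) \<and> idx N (kern N s y) = q"
proof -
  note Ns = has_type_subspace[OF N]
  obtain x0 where x0: "x0 \<in> lev N s" "\<not> p ^ Suc s dvd \<omega> y x0"
    using y by (auto simp: rad_def)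
  obtain d where d: "scale d x0 \<in> lev N s" "\<omega> y (scale d x0) = p ^ s"
    using normalize_pair[OF y(1) x0(1,2) Ns] by blast
  define x where "x = scale (- d) x0"
  have x: "x \<in> lev N s" "\<omega> x y = p ^ s"
    using d subspace_neg[OF subspace_lev[OF Ns]] form_swap[of y "scale d x0"]
    by (auto simp: x_def form_bilinear)
  have nd: "\<not> p ^ Suc s dvd \<omega> x y" using x(2) p_power_dvd_iff[of "Suc s" s] by simp
  have xM: "x \<notin> kern N s y" using nd by (simp add: kern_def)
  have pxM: "scale p x \<in> kern N s y"
    using x lev_mem[OF x(1)] subspace_scale[OF Ns] by (simp add: kern_def form_bilinear)
  have "scale p x \<in> lev (kern N s y) (Suc s)"
  proof -
    have "p ^ Suc s dvd \<omega> (scale p x) z" if "z \<in> kern N s y" for z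
      using that lev_dvd[OF x(1), of z] by (simp add: kern_def form_bilinear)
    then show ?thesis using pxM by (simp add: lev_def)
  qed
  moreover have "has_type (kern N s y) (add_mset (Suc s) \<rho>)"
    using has_type_kern[OF N _ x(1) y(1) nd] by simp
  moreover have "idx N (kern N s y) = q"
  proof -
    have "line 0 x (kern N s y) = N"
      using pair_correspondence(2)[OF Ns x(1) y(1) x(2)] line_coset[OF subspace_kern[OF Ns]]
      by (simp add: extend_pair_def Let_def)
    then show ?thesis using idx_add_generator[OF subspace_kern[OF Ns] xM pxM] by simp
  qed
  ultimately show ?thesis using x xM by blast
qed

text \<open>
  At the top level \<open>s + 1\<close> a vector \<open>p x\<close> outside \<open>p M\<close> is not in the radical, so it is part of
  a plane of that level. The other basis vector of the plane represents the functional.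
\<close>

lemma add_generator_neighbour:
  assumes M: "has_type M (add_mset (Suc s) \<rho>)" and top: "\<forall>l\<in>#\<rho>. l \<le> Suc s"
    and x: "x \<notin> M" "scale p x \<in> lev M (Suc s)"
  defines "N \<equiv> line 0 x M"
  shows "\<exists>y. y \<in> lev N s \<and> y \<notin> rad N s \<and> x \<in> lev N s \<and> \<omega> x y = p ^ s \<and> kern N s y = M \<and>
    has_type N (add_mset s \<rho>) \<and> idx N M = q"
proof -
  note Ms = has_type_subspace[OF M]
  note Ns = subspace_line[OF Ms, of 0 x]
  have "scale p x \<notin> rad M (Suc s)"
  proof
    assume "scale p x \<in> rad M (Suc s)"
    then obtain y where "y \<in> M" "scale p x = scale p y"
      using rad_top[OF M, of "Suc s"] top by auto
    then show False using x(1) scale_cancel[OF p_nonzero] by metis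
  qed
  then obtain v where v: "v \<in> lev M (Suc s)" "\<not> p ^ Suc (Suc s) dvd \<omega> (scale p x) v"
    using x(2) by (auto simp: rad_def)
  obtain d where d: "scale d v \<in> lev M (Suc s)" "\<omega> (scale p x) (scale d v) = p ^ Suc s"
    using normalize_pair[OF x(2) v Ms] by blast
  define y where "y = scale d v"
  have "p * \<omega> x y = p * p ^ s" using d(2) by (simp add: y_def form_bilinear)
  then have xy: "\<omega> x y = p ^ s" using p_nonzero by (simp only: mult_cancel_left) simp
  have yM: "y \<in> lev M (Suc s)" "y \<in> M" using d(1) lev_mem by (auto simp: y_def)
  have dvd_x: "p ^ s dvd \<omega> x z" if "z \<in> M" for z
  proof -
    have "p ^ 1 * p ^ s dvd p ^ 1 * \<omega> x z" using lev_dvd[OF x(2) that] by (simp add: form_bilinear)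
    then show ?thesis unfolding p_power_dvd_cancel .
  qed
  have dvd_y: "p ^ Suc s dvd \<omega> y z" if "z \<in> M" for z using lev_dvd[OF yM(1) that] .
  have MN: "M \<subseteq> N" unfolding N_def by (rule subset_line)
  have xN: "x \<in> N" using subspace_0[OF Ms] unfolding N_def line_def
    by (intro CollectI exI[of _ 1] exI[of _ 0]) simp
  have levN: "w \<in> lev N s" if w: "w \<in> N" "p ^ s dvd \<omega> w x" "\<And>z. z \<in> M \<Longrightarrow> p ^ s dvd \<omega> w z" for w
  proof -
    have "p ^ s dvd \<omega> w z" if zN: "z \<in> N" for z
    proof -
      obtain a z' where "z = scale a x + z'" "z' \<in> M" using zN by (auto simp: N_def line_def)
      then show ?thesis using w by (simp add: form_bilinear)
    qed
    then show ?thesis using w(1) by (simp add: lev_def)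
  qed
  have xlev: "x \<in> lev N s" using dvd_x by (intro levN xN) simp_all
  have "p ^ s dvd \<omega> y z" if "z \<in> M" for z using power_le_dvd[OF dvd_y[OF that], of s] by simp
  then have ylev: "y \<in> lev N s"
    using form_swap[of y x] xy yM MN by (intro levN) auto
  have "y \<notin> rad N s"
  proof
    assume "y \<in> rad N s"
    then have "p ^ Suc s dvd \<omega> y x" using xlev by (simp add: rad_def)
    then show False using xy form_swap[of y x] p_power_dvd_iff[of "Suc s" s] by simp
  qed
  moreover have "kern N s y = M"
  proof (intro equalityI subsetI)
    fix z assume "z \<in> kern N s y"
    then have z: "z \<in> N" "p ^ Suc s dvd \<omega> z y" by (auto simp: kern_def)
    obtain a m where am: "z = scale a x + m" "m \<in> M" using z(1) by (auto simp: N_def line_def)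
    have "p ^ Suc s dvd \<omega> m y" using dvd_y[OF am(2)] form_swap[of m y] by simp
    moreover have "\<omega> z y = p ^ s * a + \<omega> m y" using xy by (simp add: am(1) form_bilinear)
    ultimately have "p ^ Suc s dvd p ^ s * a" using z(2) by (metis dvd_add_left_iff)
    then have "p ^ s * p dvd p ^ s * a" by (simp add: mult.commute)
    then have "p dvd a" unfolding p_power_dvd_cancel .
    then obtain b where "a = p * b" by (rule dvdE)
    then have "z = scale b (scale p x) + m" using am(1) by (simp add: mult.commute)
    then show "z \<in> M"
      using subspace_add[OF Ms subspace_scale[OF Ms lev_mem[OF x(2)], of b] am(2)] by simp
  next
    fix z assume "z \<in> M"
    then show "z \<in> kern N s y" using dvd_y[of z] form_swap[of z y] MN by (auto simp: kern_def)
  qed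
  moreover have "has_type N (add_mset s \<rho>)"
    unfolding N_def using has_type_add_generator[OF M _ x(2) yM(1) xy] by simp
  moreover have "idx N M = q"
    unfolding N_def by (rule idx_add_generator[OF Ms x(1) lev_mem[OF x(2)]])
  ultimately show ?thesis using xlev ylev xy by blast
qed

text \<open>
  Double counting of the pairs \<open>M \<subset> N\<close> where the type of \<open>N\<close> arises from that of \<open>M\<close> by lowering
  one of the largest elementary divisors, each pair counted with the \<open>q - 1\<close> generators of \<open>N/M\<close>.
\<close>

theorem card_neighbours:
  assumes L: "subspace L" and top: "\<forall>l\<in>#\<rho>. l \<le> Suc s"
  shows "card (SIGMA M:lattices L (add_mset (Suc s) \<rho>).
        coset M ` {x \<in> L. x \<notin> M \<and> scale p x \<in> lev M (Suc s)}) =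
      card (SIGMA N:lattices L (add_mset s \<rho>). coset (lev N (Suc s)) ` (lev N s - rad N s))"
    (is "card ?A = card ?B")
proof -
  have B: "restrict_pair s b \<in> ?A \<and> extend_pair s (restrict_pair s b) = b" if b: "b \<in> ?B" for b
  proof -
    obtain N y where N: "N \<in> lattices L (add_mset s \<rho>)"
      and y: "y \<in> lev N s" "y \<notin> rad N s" "b = (N, coset (lev N (Suc s)) y)" using b by auto
    have NT: "has_type N (add_mset s \<rho>)" "N \<subseteq> L" "idx L N > 0" using N by (auto simp: lattices_def)
    obtain x where x: "x \<in> lev N s" "\<omega> x y = p ^ s" "x \<notin> kern N s y"
      "scale p x \<in> lev (kern N s y) (Suc s)" "has_type (kern N s y) (add_mset (Suc s) \<rho>)"
      "idx N (kern N s y) = q"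
      using mem_kern_neighbour[OF NT(1) y(1,2)] by blast
    note Ns = has_type_subspace[OF NT(1)]
    have "kern N s y \<subseteq> N" by (auto simp: kern_def)
    then have "idx L (kern N s y) = idx L N * q"
      using idx_tower[of L N "kern N s y"] NT L Ns subspace_kern[OF Ns] x(6)
      by (simp add: add_subgroup_subspace)
    then have "kern N s y \<in> lattices L (add_mset (Suc s) \<rho>)"
      using x(5) NT \<open>kern N s y \<subseteq> N\<close> q_pos by (auto simp: lattices_def)
    moreover have "x \<in> L" using lev_mem[OF x(1)] NT(2) by blast
    ultimately show ?thesis
      using pair_correspondence[OF Ns x(1) y(1) x(2)] x(3,4) y(3) by auto
  qed
  have A: "extend_pair s a \<in> ?B \<and> restrict_pair s (extend_pair s a) = a" if a: "a \<in> ?A" for a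
  proof -
    obtain M x where M: "M \<in> lattices L (add_mset (Suc s) \<rho>)"
      and x: "x \<in> L" "x \<notin> M" "scale p x \<in> lev M (Suc s)" "a = (M, coset M x)" using a by auto
    have MT: "has_type M (add_mset (Suc s) \<rho>)" "M \<subseteq> L" "idx L M > 0"
      using M by (auto simp: lattices_def)
    note Ms = has_type_subspace[OF MT(1)]
    define N where "N = line 0 x M"
    obtain y where y: "y \<in> lev N s" "y \<notin> rad N s" "x \<in> lev N s" "\<omega> x y = p ^ s" "kern N s y = M"
      "has_type N (add_mset s \<rho>)" "idx N M = q"
      using add_generator_neighbour[OF MT(1) top x(2,3)] unfolding N_def by blast
    note Ns = has_type_subspace[OF y(6)]
    have N: "N \<subseteq> L" "M \<subseteq> N"
      unfolding N_def using subspace_line_subset[OF L x(1) MT(2)] subset_line by auto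
    then have "idx L M = idx L N * q"
      using idx_tower[of L N M] L Ns Ms y(7) by (simp add: add_subgroup_subspace)
    then have "N \<in> lattices L (add_mset s \<rho>)"
      using y(6) MT N by (auto simp: lattices_def intro: gr0I)
    then show ?thesis
      using pair_correspondence[OF Ns y(3,1,4)] y(1,2,5) x(4) by auto
  qed
  have "bij_betw (extend_pair s) ?A ?B"
    by (rule bij_betw_byWitness[where f' = "restrict_pair s"]) (use A B in blast)+
  then show ?thesis by (rule bij_betw_same_card)
qed

text \<open>
  The functionals that vanish on \<open>lev N (s + 1)\<close> form a space of dimension \<open>2 K\<close>; those to be
  excluded vanish on \<open>lev N s\<close> as well.
\<close>

lemma card_top_functionals:
  fixes s :: nat
  assumes N: "has_type N \<tau>"
  defines "K \<equiv> size (filter_mset (\<lambda>l. l \<le> s) \<tau>)"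
  shows "card (coset (lev N (Suc s)) ` (lev N s - rad N s)) = q ^ (2 * K) - q ^ (2 * (K - count \<tau> s))"
proof -
  note Ns = has_type_subspace[OF N]
  note G = add_subgroup_subspace[OF Ns] add_subgroup_subspace[OF subspace_lev[OF Ns]]
    add_subgroup_subspace[OF subspace_rad[OF Ns]]
  have sub: "lev N (Suc s) \<subseteq> lev N s" using lev_Suc_subset_rad rad_subset_lev by blast
  have sum: "(\<Sum>l\<in>#\<tau>. Suc s - l) = (\<Sum>l\<in>#\<tau>. s - l) + K"
    unfolding K_def by (induction \<tau>) auto
  have "idx N (lev N (Suc s)) = idx N (lev N s) * idx (lev N s) (lev N (Suc s))"
    by (rule idx_tower) (use G sub lev_subset in auto)
  then have K: "idx (lev N s) (lev N (Suc s)) = q ^ (2 * K)"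
    unfolding idx_lev[OF N] sum using q_pos by (simp add: power_add distrib_left)
  have c: "count \<tau> s \<le> K"
    unfolding K_def by (induction \<tau>) auto
  have "idx (lev N s) (lev N (Suc s)) = idx (lev N s) (rad N s) * idx (rad N s) (lev N (Suc s))"
    by (rule idx_tower) (use G lev_Suc_subset_rad rad_subset_lev in auto)
  moreover have "2 * K = 2 * count \<tau> s + 2 * (K - count \<tau> s)" using c by simp
  ultimately have "idx (rad N s) (lev N (Suc s)) = q ^ (2 * (K - count \<tau> s))"
    unfolding idx_rad[OF N] K using q_pos by (metis mult_left_cancel power_add power_not_zero less_numeral_extra(3))
  then show ?thesis
    using card_cosets_diff[of "lev N s" "rad N s" "lev N (Suc s)"] G lev_Suc_subset_rad rad_subset_lev K q_pos
    by simp
qed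

section \<open>Unimodular lattices\<close>

definition unimodular :: "nat \<Rightarrow> 'v set \<Rightarrow> bool" where
  "unimodular n L \<longleftrightarrow> has_type L (replicate_mset n 0)"

lemma unimodular_subspace: "unimodular n L \<Longrightarrow> subspace L"
  by (simp add: unimodular_def has_type_subspace)

lemma lev_unimodular:
  assumes "unimodular n L"
  shows "lev L j = scale (p ^ j) ` L"
proof (intro equalityI subsetI)
  have divide: "\<exists>w\<in>L. z = scale (p ^ j) w" if "has_type L \<tau>" "\<forall>l\<in>#\<tau>. l = 0" "z \<in> lev L j" for \<tau> z L
    using that
  proof (induction arbitrary: z rule: has_type.induct)
    case has_type_zero
    then show ?case by (auto simp: lev_def)
  next
    case (has_type_plane M \<tau> l u v)
    note M = has_type_subspace[OF has_type_plane.hyps(1)]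
    obtain a b z' where z: "z = scale a u + scale b v + z'" "p ^ j dvd a" "p ^ j dvd b" "z' \<in> lev M j"
      using has_type_plane.prems unfolding lev_hsum[OF has_type_plane.hyps(2) M] mem_hsum by auto
    obtain a' b' where ab: "a = p ^ j * a'" "b = p ^ j * b'" using z(2,3) unfolding dvd_def by blast
    obtain w where w: "w \<in> M" "z' = scale (p ^ j) w"
      using has_type_plane.IH[OF _ z(4)] has_type_plane.prems(1) by auto
    have "z = scale (p ^ j) (scale a' u + scale b' v + w)"
      using z(1) ab w(2) by (simp add: scale_right_distrib)
    moreover have "scale a' u + scale b' v + w \<in> hsum 0 u v M"
      using w(1) unfolding mem_hsum by auto
    ultimately show ?case by blast
  qed
  show "z \<in> scale (p ^ j) ` L" if "z \<in> lev L j" for z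
  proof -
    have "\<forall>l\<in>#replicate_mset n 0. l = (0::nat)" by simp
    then show ?thesis using divide[OF assms[unfolded unimodular_def] _ that] by blast
  qed
next
  fix z assume "z \<in> scale (p ^ j) ` L"
  then show "z \<in> lev L j"
    using subspace_scale[OF unimodular_subspace[OF assms]] by (auto simp: lev_def form_bilinear)
qed

lemma idx_lev_unimodular: "unimodular n L \<Longrightarrow> idx L (lev L j) = q ^ (2 * n * j)"
  unfolding unimodular_def by (simp add: idx_lev mult.assoc)

lemma unimodular_nondegenerate: "unimodular n L \<Longrightarrow> x \<in> L \<Longrightarrow> (\<And>z. z \<in> L \<Longrightarrow> \<omega> x z = 0) \<Longrightarrow> x = 0"
  unfolding unimodular_def by (rule has_type_nondegenerate)

lemma idx_lattice:
  assumes L: "unimodular n L" and M: "M \<in> lattices L \<tau>"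
  shows "idx L M = q ^ (\<Sum>\<^sub># \<tau>)" "size \<tau> = n"
proof -
  have M': "has_type M \<tau>" "M \<subseteq> L" "idx L M > 0" using M by (auto simp: lattices_def)
  obtain \<tau>' where \<tau>': "has_type M \<tau>'" "size \<tau>' = n" "idx L M * q ^ (\<Sum>\<^sub># (replicate_mset n 0)) = q ^ (\<Sum>\<^sub># \<tau>')"
    using sublattice_has_type[OF L[unfolded unimodular_def] has_type_subspace[OF M'(1)] M'(2,3)] by auto
  have "\<tau>' = \<tau>" using has_type_unique M'(1) \<tau>'(1) by blast
  then show "idx L M = q ^ (\<Sum>\<^sub># \<tau>)" "size \<tau> = n" using \<tau>' by auto
qed

text \<open>
  An element of \<open>M\<close> induces the same functional on \<open>M\<close> as \<open>w\<close>. The difference is orthogonal to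
  \<open>M\<close>, hence to \<open>L\<close>, and vanishes.
\<close>

lemma mem_lattice_if_form_dvd:
  assumes L: "unimodular n L" and M: "M \<in> lattices L \<tau>" and top: "\<forall>l\<in>#\<tau>. l \<le> r"
    and w: "w \<in> L" "\<And>z. z \<in> M \<Longrightarrow> p ^ r dvd \<omega> w z"
  shows "w \<in> lev M r"
proof -
  have M': "has_type M \<tau>" "M \<subseteq> L" "idx L M > 0" using M by (auto simp: lattices_def)
  note Ls = unimodular_subspace[OF L] and Ms = has_type_subspace[OF M'(1)]
  obtain w' where w': "w' \<in> M" "\<And>z. z \<in> M \<Longrightarrow> \<omega> w z = \<omega> w' z"
    using functional_represented[OF M'(1) top w(2)] by blast
  have "w - w' = 0"
  proof (rule unimodular_nondegenerate[OF L])
    show "w - w' \<in> L" using w(1) w'(1) M'(2) subspace_diff[OF Ls] by blast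
    fix z assume "z \<in> L"
    then obtain k where "scale (p ^ k) z \<in> M" using power_multiple_mem[OF Ls Ms M'(2,3)] by blast
    then have "\<omega> (w - w') (scale (p ^ k) z) = 0" using w'(2) by (simp add: form_diff_left)
    then show "\<omega> (w - w') z = 0" using p_nonzero by (simp add: form_scale_right)
  qed
  then show ?thesis using w'(1) w(2) by (simp add: lev_def)
qed

lemma lev_unimodular_subset_lattice:
  assumes L: "unimodular n L" and M: "M \<in> lattices L \<tau>" and top: "\<forall>l\<in>#\<tau>. l \<le> r"
  shows "lev L r \<subseteq> lev M r"
proof
  fix w assume "w \<in> lev L r"
  moreover have "M \<subseteq> L" using M by (simp add: lattices_def)
  ultimately show "w \<in> lev M r"
    using lev_dvd[of w L r] lev_mem[of w L r] by (intro mem_lattice_if_form_dvd[OF L M top]) auto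
qed

lemma finite_intermediate_subgroups:
  assumes "add_subgroup B" "idx A B > 0"
  shows "finite {M. add_subgroup M \<and> B \<subseteq> M \<and> M \<subseteq> A}"
proof (rule finite_imageD)
  have "finite (coset B ` A)" using assms(2) unfolding idx_def by (meson card_gt_0_iff)
  then show "finite ((\<lambda>M. coset B ` M) ` {M. add_subgroup M \<and> B \<subseteq> M \<and> M \<subseteq> A})"
    by (rule finite_subset[rotated, OF finite_Pow_iff[THEN iffD2]]) auto
  have "M = \<Union> (coset B ` M)" if M: "add_subgroup M" "B \<subseteq> M" for M
  proof (intro equalityI subsetI)
    fix x assume "x \<in> M"
    then show "x \<in> \<Union> (coset B ` M)" using assms(1) add_subgroup_0 by (force simp: mem_coset_iff)
  next
    fix x assume "x \<in> \<Union> (coset B ` M)"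
    then obtain y where "y \<in> M" "x - y \<in> M" using M(2) by (auto simp: mem_coset_iff)
    then show "x \<in> M" using add_subgroup_add[OF M(1), of "x - y" y] by simp
  qed
  then show "inj_on (\<lambda>M. coset B ` M) {M. add_subgroup M \<and> B \<subseteq> M \<and> M \<subseteq> A}"
    by (intro inj_onI) (metis (mono_tags, lifting) mem_Collect_eq)
qed

lemma finite_lattices:
  assumes L: "unimodular n L"
  shows "finite (lattices L \<tau>)"
proof -
  obtain r where r: "\<forall>l\<in>#\<tau>. l \<le> r" by (metis Max_ge finite_set_mset)
  have "lattices L \<tau> \<subseteq> {M. add_subgroup M \<and> lev L r \<subseteq> M \<and> M \<subseteq> L}"
    using lev_unimodular_subset_lattice[OF L _ r] lev_subset
    by (auto simp: lattices_def add_subgroup_subspace has_type_subspace) blast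
  moreover have "finite {M. add_subgroup M \<and> lev L r \<subseteq> M \<and> M \<subseteq> L}"
    using idx_lev_unimodular[OF L] q_pos
    by (intro finite_intermediate_subgroups add_subgroup_subspace subspace_lev unimodular_subspace[OF L])
      simp
  ultimately show ?thesis by (rule finite_subset)
qed

section \<open>Recursion for the number of lattices\<close>

text \<open>
  The lattices for which a fixed primitive vector \<open>m\<close> lies at the top level all contain \<open>m\<close> and
  \<open>p\<^sup>r f\<close>, where \<open>f\<close> is a vector of \<open>L\<close> with \<open>\<omega> m f = 1\<close>. They split off the plane spanned by
  these two vectors, and what remains is an arbitrary lattice in the complement of \<open>m\<close> and \<open>f\<close>.
\<close>

lemma card_lattices_through_primitive:
  assumes L: "unimodular n L" and m: "m \<in> L" "m \<notin> lev L 1" and top: "\<forall>l\<in>#\<rho>. l \<le> r"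
  shows "\<exists>L'. unimodular (n - 1) L' \<and>
    card {M \<in> lattices L (add_mset r \<rho>). m \<in> lev M r} = card (lattices L' \<rho>)"
proof -
  note Ls = unimodular_subspace[OF L]
  have LT: "has_type L (replicate_mset n 0)" using L by (simp add: unimodular_def)
  have "m \<notin> rad L 0"
    using m(2) rad_top[OF LT, of 0] lev_unimodular[OF L, of 1] by auto
  then obtain f0 where f0: "f0 \<in> lev L 0" "\<not> p ^ Suc 0 dvd \<omega> m f0"
    using m(1) by (auto simp: rad_def lev_0)
  have m0: "m \<in> lev L 0" using m(1) by (simp add: lev_0)
  obtain d where d: "scale d f0 \<in> lev L 0" "\<omega> m (scale d f0) = p ^ 0"
    using normalize_pair[OF m0 f0 Ls] by blast
  define f where "f = scale d f0"
  have f: "f \<in> lev L 0" "f \<in> L" "\<omega> m f = p ^ 0" using d lev_0 by (auto simp: f_def)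
  define L' where "L' = perp L m f"
  have LL': "hsum 0 m f L' = L" and P: "plane 0 m f L'"
    unfolding L'_def using split_plane[OF Ls m0 f(1,3)] by auto
  have "0 \<in># replicate_mset n (0::nat)"
  proof (rule ccontr)
    assume "0 \<notin># replicate_mset n (0::nat)"
    then show False using not_in_type_iff[OF LT] \<open>m \<notin> rad L 0\<close> m0 by blast
  qed
  then have n: "n > 0" by (cases n) auto
  have L'T: "has_type L' (replicate_mset n 0 - {#0#})"
    unfolding L'_def using f(3) p_nonunit \<open>0 \<in># _\<close> by (intro has_type_perp[OF LT _ m0 f(1)]) auto
  have L'u: "unimodular (n - 1) L'"
    using L'T n unfolding unimodular_def by (cases n) auto
  note L's = unimodular_subspace[OF L'u]
  have L'L: "L' \<subseteq> L" by (simp add: L'_def perp_subset)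
  have idx: "idx L (hsum 0 m (scale (p ^ r) f) M) = q ^ r * idx L' M"
    if M: "subspace M" "M \<subseteq> L'" for M
  proof -
    have "line 0 (scale (p ^ r) f) M = line r f M"
    proof -
      have "x \<in> line 0 (scale (p ^ r) f) M \<longleftrightarrow> x \<in> line r f M" for x
        unfolding line_def dvd_def by (auto simp: mult.commute)
      then show ?thesis by blast
    qed
    then have eq: "hsum 0 m (scale (p ^ r) f) M = line (0 + 0) m (line (0 + r) f M)"
      by (simp add: hsum_def)
    have "idx L (hsum 0 m (scale (p ^ r) f) M) =
        q ^ 0 * idx (line 0 f L') (line (0 + r) f M)"
      unfolding eq unfolding LL'[symmetric] hsum_def
      using plane_free(1)[OF P] M L's by (intro idx_line) (auto simp: subspace_line line_mono)
    also have "idx (line 0 f L') (line (0 + r) f M) = q ^ r * idx L' M"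
      using plane_free(2)[OF P] M L's by (intro idx_line) auto
    finally show ?thesis by simp
  qed
  have plane_r: "plane r m (scale (p ^ r) f) L'" using P by (simp add: plane_def form_bilinear)
  have "bij_betw (hsum 0 m (scale (p ^ r) f)) (lattices L' \<rho>)
      {M \<in> lattices L (add_mset r \<rho>). m \<in> lev M r}"
  proof (rule bij_betw_byWitness[where f' = "\<lambda>M. perp M m f"])
    have perp_r: "perp M m (scale (p ^ r) f) = perp M m f" for M
      using p_nonzero by (intro perp_scale) simp
    have forward: "hsum 0 m (scale (p ^ r) f) M \<in> {M \<in> lattices L (add_mset r \<rho>). m \<in> lev M r} \<and>
        perp (hsum 0 m (scale (p ^ r) f) M) m f = M" if "M \<in> lattices L' \<rho>" for M
    proof -
      have M: "M \<subseteq> L'" "has_type M \<rho>" "idx L' M > 0" using that by (auto simp: lattices_def)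
      note Ms = has_type_subspace[OF M(2)]
      note PM = plane_subset[OF plane_r M(1)]
      have "hsum 0 m (scale (p ^ r) f) M \<subseteq> L"
      proof
        fix z assume "z \<in> hsum 0 m (scale (p ^ r) f) M"
        then obtain a b w where "z = scale a m + scale b (scale (p ^ r) f) + w" "w \<in> M"
          unfolding mem_hsum by blast
        then show "z \<in> L"
          using m(1) f(2) M(1) L'L Ls by (meson subsetD subspace_add subspace_scale)
      qed
      moreover have "m \<in> lev (hsum 0 m (scale (p ^ r) f) M) r"
        unfolding lev_hsum[OF PM Ms] using plane_mem_hsum(1)[OF subspace_lev[OF Ms]] by simp
      ultimately show ?thesis
        using has_type_plane[OF M(2) PM] idx[OF Ms M(1)] M(3) q_pos perp_r perp_hsum[OF PM Ms]
        by (simp add: lattices_def)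
    qed
    have backward: "perp M m f \<in> lattices L' \<rho> \<and> hsum 0 m (scale (p ^ r) f) (perp M m f) = M"
      if "M \<in> {M \<in> lattices L (add_mset r \<rho>). m \<in> lev M r}" for M
    proof -
      have M: "M \<in> lattices L (add_mset r \<rho>)" "M \<subseteq> L" "has_type M (add_mset r \<rho>)" "idx L M > 0"
        "m \<in> lev M r" using that by (auto simp: lattices_def)
      note Ms = has_type_subspace[OF M(3)]
      have fr: "scale (p ^ r) f \<in> lev M r"
      proof (rule mem_lattice_if_form_dvd[OF L M(1)])
        show "\<forall>l\<in>#add_mset r \<rho>. l \<le> r" using top by simp
      qed (use subspace_scale[OF Ls f(2)] in \<open>simp_all add: form_scale_left\<close>)
      have mfr: "\<omega> m (scale (p ^ r) f) = p ^ r" using f(3) by (simp add: form_bilinear)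
      have nd: "\<not> p ^ Suc r dvd \<omega> m (scale (p ^ r) f)"
        using mfr p_power_dvd_iff[of "Suc r" r] by simp
      have sum: "hsum 0 m (scale (p ^ r) f) (perp M m f) = M"
        using split_plane(1)[OF Ms M(5) fr mfr] by (simp only: perp_r)
      have "has_type (perp M m f) \<rho>"
        using has_type_perp[OF M(3) _ M(5) fr nd] by (simp add: perp_r)
      moreover have sub: "perp M m f \<subseteq> L'" using M(2) by (auto simp: perp_def L'_def)
      moreover have "idx L' (perp M m f) > 0"
        using idx[OF subspace_perp[OF Ms] sub] M(4) unfolding sum by (auto intro: gr0I)
      ultimately show ?thesis using sum by (simp add: lattices_def)
    qed
    show "\<forall>M\<in>lattices L' \<rho>. perp (hsum 0 m (scale (p ^ r) f) M) m f = M"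
      using forward by blast
    show "hsum 0 m (scale (p ^ r) f) ` lattices L' \<rho> \<subseteq> {M \<in> lattices L (add_mset r \<rho>). m \<in> lev M r}"
      using forward by blast
    show "\<forall>M\<in>{M \<in> lattices L (add_mset r \<rho>). m \<in> lev M r}.
        hsum 0 m (scale (p ^ r) f) (perp M m f) = M"
      using backward by blast
    show "(\<lambda>M. perp M m f) ` {M \<in> lattices L (add_mset r \<rho>). m \<in> lev M r} \<subseteq> lattices L' \<rho>"
      using backward by blast
  qed
  then have "card (lattices L' \<rho>) = card {M \<in> lattices L (add_mset r \<rho>). m \<in> lev M r}"
    by (rule bij_betw_same_card)
  then show ?thesis using L'u by (intro exI[of _ L']) simp
qed

text \<open>
  There are \<open>q\<close> to the power \<open>2 count \<tau> r\<close> classes of top-level vectors modulo the radical. Being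
  primitive in \<open>L\<close> depends only on the class. Classes of nonprimitive vectors \<open>p x\<close> correspond to
  cosets \<open>x + M\<close>, and the class \<open>0\<close> accounts for the \<open>Suc\<close>. The primitive vectors are counted modulo
  \<open>p\<close> to the power \<open>r + 1\<close> on \<open>L\<close>, a modulus that does not depend on \<open>M\<close>.
\<close>

lemma card_top_vectors:
  assumes L: "unimodular n L" and M: "M \<in> lattices L \<tau>" and top: "\<forall>l\<in>#\<tau>. l \<le> r"
  defines "B \<equiv> lev L (Suc r)"
  shows "card (coset B ` (lev M r - lev L 1)) +
      idx (rad M r) B * Suc (card (coset M ` {x \<in> L. x \<notin> M \<and> scale p x \<in> lev M r})) =
      idx (rad M r) B * q ^ (2 * count \<tau> r)"
    and "idx (rad M r) B * q ^ (\<Sum>\<^sub># \<tau> + 2 * (\<Sum>l\<in>#\<tau>. r - l) + 2 * count \<tau> r) =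
      q ^ (2 * n * Suc r)"
proof -
  have M': "has_type M \<tau>" "M \<subseteq> L" "idx L M > 0" using M by (auto simp: lattices_def)
  note Ls = unimodular_subspace[OF L] and Ms = has_type_subspace[OF M'(1)]
  note G = add_subgroup_subspace
  have radM: "rad M r = {x \<in> lev M r. \<exists>y\<in>M. x = scale p y}" by (rule rad_top[OF M'(1) top])
  have L1: "lev L 1 = scale p ` L" using lev_unimodular[OF L, of 1] by simp
  have Brad: "B \<subseteq> rad M r"
  proof
    fix z assume "z \<in> B"
    then obtain w where w: "w \<in> L" "z = scale (p ^ Suc r) w"
      unfolding B_def lev_unimodular[OF L] by blast
    have "scale (p ^ r) w \<in> lev M r"
      using w(1) lev_unimodular_subset_lattice[OF L M top] lev_unimodular[OF L, of r] by blast
    moreover have "z = scale p (scale (p ^ r) w)" using w by simp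
    ultimately show "z \<in> rad M r"
      using subspace_scale[OF subspace_lev[OF Ms], of _ r p] lev_mem unfolding radM by blast
  qed
  have subB: "subspace B" unfolding B_def by (rule subspace_lev[OF Ls])
  define J where "J = lev M r \<inter> lev L 1"
  have subJ: "subspace J" unfolding J_def by (intro subspace_inter subspace_lev Ls Ms)
  have radJ: "rad M r \<subseteq> J" using radM L1 M'(2) by (auto simp: J_def)
  have JM: "J \<subseteq> lev M r" by (simp add: J_def)
  define A where "A = {x \<in> L. scale p x \<in> lev M r}"
  have subA: "subspace A"
    unfolding A_def
    by (rule subspaceI)
      (use Ls subspace_lev[OF Ms, of r] in \<open>auto simp: scale_right_distrib subspace_0 subspace_add
        subspace_scale scale_left_commute simp del: scale_scale\<close>)
  have idxA: "idx A M = idx J (rad M r)"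
  proof (rule idx_cong_hom[where f = "scale p"])
    fix x assume x: "x \<in> A"
    show "scale p x \<in> J" using x L1 by (auto simp: A_def J_def)
    show "scale p x \<in> rad M r \<longleftrightarrow> x \<in> M"
      using x scale_cancel[OF p_nonzero] unfolding radM A_def by blast
  next
    fix y assume "y \<in> J"
    then obtain x where "x \<in> L" "y = scale p x" "y \<in> lev M r" using L1 by (auto simp: J_def)
    then show "\<exists>x\<in>A. y - scale p x \<in> rad M r"
      using subspace_0[OF subspace_rad[OF Ms]] by (intro bexI[of _ x]) (auto simp: A_def)
  qed (use Ms subA G subspace_rad subspace_diff[OF subA] in \<open>auto simp: scale_right_diff_distrib\<close>)
  have idxLB: "idx L B = q ^ (2 * n * Suc r)" unfolding B_def by (rule idx_lev_unimodular[OF L])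
  have BM: "B \<subseteq> M" using Brad rad_subset_lev lev_subset by blast
  have t1: "idx L B = idx L M * idx M B"
    by (rule idx_tower) (use G Ls Ms subB BM M'(2) in auto)
  have t2: "idx M B = idx M (lev M r) * idx (lev M r) B"
    by (rule idx_tower) (use G Ms subB order_trans[OF Brad rad_subset_lev] lev_subset subspace_lev[OF Ms] in auto)
  have t3: "idx (lev M r) B = idx (lev M r) (rad M r) * idx (rad M r) B"
    by (rule idx_tower)
      (use G Ms subB Brad rad_subset_lev subspace_lev[OF Ms] subspace_rad[OF Ms] in auto)
  have t4: "idx J B = idx J (rad M r) * idx (rad M r) B"
    by (rule idx_tower) (use G subB Brad radJ subJ subspace_rad[OF Ms] in auto)
  have t5: "idx (lev M r) B = idx (lev M r) J * idx J B"
    by (rule idx_tower) (use G subB Brad radJ subJ JM subspace_lev[OF Ms] in auto)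
  show "idx (rad M r) B * q ^ (\<Sum>\<^sub># \<tau> + 2 * (\<Sum>l\<in>#\<tau>. r - l) + 2 * count \<tau> r) = q ^ (2 * n * Suc r)"
    using idxLB t1 t2 t3 idx_lattice(1)[OF L M] idx_lev[OF M'(1)] idx_rad[OF M'(1)]
    by (simp add: power_add ac_simps)
  have "idx L B > 0" using idxLB q_pos by simp
  then have pos: "idx (lev M r) B > 0" "idx J B > 0" "idx J (rad M r) > 0"
    using t1 t2 t4 t5 by (auto intro: gr0I)
  have "card (coset B ` (lev M r - lev L 1)) = card (coset B ` (lev M r - J))"
    by (rule arg_cong[of _ _ "\<lambda>X. card (coset B ` X)"]) (auto simp: J_def)
  also have "\<dots> = idx (lev M r) B - idx J B"
    using G subB subJ Brad radJ JM subspace_lev[OF Ms] pos by (intro card_cosets_diff) auto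
  finally have S: "card (coset B ` (lev M r - lev L 1)) + idx J B = idx (lev M r) B"
    using t5 pos by (cases "idx (lev M r) J") auto
  have D: "Suc (card (coset M ` {x \<in> L. x \<notin> M \<and> scale p x \<in> lev M r})) = idx J (rad M r)"
  proof -
    have "coset M ` A = insert M (coset M ` (A - M))"
    proof -
      have "coset M x = M" if "x \<in> M" for x
        using coset_eq_iff[OF G[OF Ms], of x 0] that by (simp add: coset_zero)
      moreover have "M \<in> coset M ` A" using subspace_0[OF subA] coset_zero by (metis imageI)
      ultimately show ?thesis by auto
    qed
    moreover have "M \<notin> coset M ` (A - M)"
      using coset_eq_iff[OF G[OF Ms], of 0] by (auto simp: coset_zero subspace_neg[OF Ms])
        (metis add.inverse_inverse coset_zero diff_0 subspace_neg[OF Ms])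
    moreover have "finite (coset M ` A)"
      using pos(3)[folded idxA, unfolded idx_def] by (rule card_ge_0_finite)
    ultimately have "idx A M = Suc (card (coset M ` (A - M)))" unfolding idx_def by simp
    moreover have "A - M = {x \<in> L. x \<notin> M \<and> scale p x \<in> lev M r}" by (auto simp: A_def)
    ultimately show ?thesis using idxA by simp
  qed
  show "card (coset B ` (lev M r - lev L 1)) +
      idx (rad M r) B * Suc (card (coset M ` {x \<in> L. x \<notin> M \<and> scale p x \<in> lev M r})) =
      idx (rad M r) B * q ^ (2 * count \<tau> r)"
    using S t3 t4 idx_rad[OF M'(1), of r] unfolding D by (simp add: ac_simps)
qed

text \<open>
  Summing over the primitive vector first: each of them lies at the top level of the same number
  of lattices.
\<close>

lemma card_primitive_pairs:
  assumes L: "unimodular n L" and top: "\<forall>l\<in>#\<rho>. l \<le> r"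
    and smaller: "\<And>L'. unimodular (n - 1) L' \<Longrightarrow> card (lattices L' \<rho>) = N'"
  defines "B \<equiv> lev L (Suc r)"
  shows "(\<Sum>M\<in>lattices L (add_mset r \<rho>). card (coset B ` (lev M r - lev L 1))) =
    (q ^ (2 * n * Suc r) - q ^ (2 * n * r)) * N'"
proof -
  note Ls = unimodular_subspace[OF L]
  have subB: "subspace B" unfolding B_def by (rule subspace_lev[OF Ls])
  note G = add_subgroup_subspace
  have top': "\<forall>l\<in>#add_mset r \<rho>. l \<le> r" using top by simp
  have BL1: "B \<subseteq> lev L 1"
    using power_le_dvd[of p "Suc r" _ 1] by (auto simp: B_def lev_def)
  have idxLB: "idx L B = q ^ (2 * n * Suc r)" unfolding B_def by (rule idx_lev_unimodular[OF L])
  have "idx L B = idx L (lev L 1) * idx (lev L 1) B"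
    by (rule idx_tower) (use G Ls subB BL1 subspace_lev[OF Ls] lev_subset in auto)
  then have "q ^ (2 * n) * q ^ (2 * n * r) = q ^ (2 * n) * idx (lev L 1) B"
    unfolding idxLB idx_lev_unimodular[OF L] by (simp add: power_add)
  then have idxL1: "idx (lev L 1) B = q ^ (2 * n * r)" using q_pos by simp
  define C where "C = coset B ` (L - lev L 1)"
  have "card C = idx L B - idx (lev L 1) B"
    unfolding C_def using G Ls subB BL1 subspace_lev[OF Ls] lev_subset idxLB q_pos
    by (intro card_cosets_diff) auto
  then have cardC: "card C = q ^ (2 * n * Suc r) - q ^ (2 * n * r)" by (simp only: idxLB idxL1)
  have "finite (coset B ` L)" using idxLB q_pos unfolding idx_def by (metis card_gt_0_iff zero_less_power)
  then have finC: "finite C" unfolding C_def by (rule finite_subset[rotated]) auto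
  have inter: "coset B x \<subseteq> lev M r \<longleftrightarrow> x \<in> lev M r"
    if M: "M \<in> lattices L (add_mset r \<rho>)" for M x
  proof -
    have Ms: "subspace M" using M by (auto simp: lattices_def has_type_subspace)
    have "B \<subseteq> lev L r" using power_le_dvd[of p "Suc r" _ r] by (auto simp: B_def lev_def)
    then have BM: "B \<subseteq> lev M r" using lev_unimodular_subset_lattice[OF L M top'] by blast
    show ?thesis
    proof
      assume "coset B x \<subseteq> lev M r"
      moreover have "x \<in> coset B x" using subspace_0[OF subB] by (simp add: mem_coset_iff)
      ultimately show "x \<in> lev M r" by blast
    next
      assume x: "x \<in> lev M r"
      show "coset B x \<subseteq> lev M r"
      proof
        fix y assume "y \<in> coset B x"
        then have "y - x \<in> lev M r" using BM by (auto simp: mem_coset_iff)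
        then show "y \<in> lev M r" using subspace_add[OF subspace_lev[OF Ms] _ x, of "y - x"] by simp
      qed
    qed
  qed
  have "(\<Sum>M\<in>lattices L (add_mset r \<rho>). card (coset B ` (lev M r - lev L 1))) =
      (\<Sum>M\<in>lattices L (add_mset r \<rho>). card {c \<in> C. c \<subseteq> lev M r})"
  proof (rule sum.cong[OF refl])
    fix M assume M: "M \<in> lattices L (add_mset r \<rho>)"
    then have "lev M r \<subseteq> L" using lev_subset by (auto simp: lattices_def)
    then have "coset B ` (lev M r - lev L 1) = {c \<in> C. c \<subseteq> lev M r}"
      using inter[OF M] unfolding C_def by blast
    then show "card (coset B ` (lev M r - lev L 1)) = card {c \<in> C. c \<subseteq> lev M r}" by simp
  qed
  also have "\<dots> = (\<Sum>c\<in>C. N')"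
  proof (rule sum_multicount_gen[OF finite_lattices[OF L] finC])
    show "\<forall>c\<in>C. card {M \<in> lattices L (add_mset r \<rho>). c \<subseteq> lev M r} = N'"
    proof
      fix c assume "c \<in> C"
      then obtain m where m: "m \<in> L" "m \<notin> lev L 1" "c = coset B m" by (auto simp: C_def)
      have "{M \<in> lattices L (add_mset r \<rho>). c \<subseteq> lev M r} =
          {M \<in> lattices L (add_mset r \<rho>). m \<in> lev M r}" using inter m(3) by blast
      then show "card {M \<in> lattices L (add_mset r \<rho>). c \<subseteq> lev M r} = N'"
        using card_lattices_through_primitive[OF L m(1,2) top] smaller by metis
    qed
  qed
  finally show ?thesis using cardC by simp
qed

text \<open>
  The top-level classes of all lattices of type \<open>\<tau>\<close> are counted twice. The primitive ones lead to
  rank \<open>n - 1\<close>, the nonprimitive ones to the type \<open>\<sigma>\<close> with smaller sum, the class \<open>0\<close> to the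
  lattices themselves. The power \<open>q\<^sup>e\<close> clears the index of \<open>lev L (r + 1)\<close> in the radical from
  the denominators.
\<close>

theorem card_lattices_recursion:
  fixes \<rho> :: "nat multiset"
  assumes L: "unimodular n L" and top: "\<forall>l\<in>#\<rho>. l \<le> Suc s"
    and smaller: "\<And>L'. unimodular (n - 1) L' \<Longrightarrow> card (lattices L' \<rho>) = N'"
  defines "\<tau> \<equiv> add_mset (Suc s) \<rho>" and "\<sigma> \<equiv> add_mset s \<rho>"
  defines "K \<equiv> size (filter_mset (\<lambda>l. l \<le> s) \<sigma>)"
  defines "e \<equiv> \<Sum>\<^sub># \<tau> + 2 * (\<Sum>l\<in>#\<tau>. Suc s - l) + 2 * count \<tau> (Suc s)"
  shows "q ^ e * ((q ^ (2 * n * Suc (Suc s)) - q ^ (2 * n * Suc s)) * N') +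
      q ^ (2 * n * Suc (Suc s)) * (card (lattices L \<tau>) +
        card (lattices L \<sigma>) * (q ^ (2 * K) - q ^ (2 * (K - count \<sigma> s)))) =
      q ^ (2 * n * Suc (Suc s)) * (q ^ (2 * count \<tau> (Suc s)) * card (lattices L \<tau>))"
proof -
  define r where "r = Suc s"
  define B where "B = lev L (Suc r)"
  have top': "\<forall>l\<in>#\<tau>. l \<le> r" using top by (simp add: \<tau>_def r_def)
  define S where "S = (\<lambda>M. card (coset B ` (lev M r - lev L 1)))"
  define D where "D = (\<lambda>M. card (coset M ` {x \<in> L. x \<notin> M \<and> scale p x \<in> lev M r}))"
  have fin: "finite (lattices L \<tau>)" "finite (lattices L \<sigma>)" by (rule finite_lattices[OF L])+
  have each: "q ^ e * S M + q ^ (2 * n * Suc r) * Suc (D M) =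
      q ^ (2 * n * Suc r) * q ^ (2 * count \<tau> r)" if M: "M \<in> lattices L \<tau>" for M
  proof -
    have "q ^ e * (S M + idx (rad M r) B * Suc (D M)) = q ^ e * (idx (rad M r) B * q ^ (2 * count \<tau> r))"
      using card_top_vectors(1)[OF L M top'] unfolding S_def D_def B_def by simp
    then have "q ^ e * S M + (q ^ e * idx (rad M r) B) * Suc (D M) =
        (q ^ e * idx (rad M r) B) * q ^ (2 * count \<tau> r)"
      by (simp only: distrib_left mult.assoc)
    moreover have "q ^ e * idx (rad M r) B = q ^ (2 * n * Suc r)"
      using card_top_vectors(2)[OF L M top'] unfolding e_def B_def r_def by (simp only: mult.commute)
    ultimately show ?thesis by simp
  qed
  have sumS: "(\<Sum>M\<in>lattices L \<tau>. S M) = (q ^ (2 * n * Suc r) - q ^ (2 * n * r)) * N'"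
    unfolding S_def B_def \<tau>_def r_def using top by (intro card_primitive_pairs[OF L _ smaller]) (auto simp: r_def)
  have sumD: "(\<Sum>M\<in>lattices L \<tau>. D M) = card (lattices L \<sigma>) * (q ^ (2 * K) - q ^ (2 * (K - count \<sigma> s)))"
  proof -
    have fD: "finite (coset M ` {x \<in> L. x \<notin> M \<and> scale p x \<in> lev M r})" if "M \<in> lattices L \<tau>" for M
    proof -
      have "finite (coset M ` L)" using that unfolding lattices_def idx_def by (simp add: card_gt_0_iff)
      then show ?thesis by (rule finite_subset[rotated]) auto
    qed
    have fY: "finite (coset (lev N (Suc s)) ` (lev N s - rad N s))" if "N \<in> lattices L \<sigma>" for N
    proof -
      have N: "has_type N \<sigma>" using that by (simp add: lattices_def)
      have "finite (coset (lev N (Suc s)) ` N)"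
        using idx_lev[OF N, of "Suc s"] q_pos unfolding idx_def
        by (metis card_gt_0_iff zero_less_power)
      then show ?thesis by (rule finite_subset[rotated]) (use lev_subset in blast)
    qed
    have "(\<Sum>M\<in>lattices L \<tau>. D M) = card (SIGMA M:lattices L \<tau>.
        coset M ` {x \<in> L. x \<notin> M \<and> scale p x \<in> lev M r})"
      unfolding D_def using fin fD by simp
    also have "\<dots> = card (SIGMA N:lattices L \<sigma>. coset (lev N (Suc s)) ` (lev N s - rad N s))"
      unfolding \<tau>_def \<sigma>_def r_def by (rule card_neighbours[OF unimodular_subspace[OF L] top])
    also have "\<dots> = (\<Sum>N\<in>lattices L \<sigma>. card (coset (lev N (Suc s)) ` (lev N s - rad N s)))"
      using fin fY by simp
    also have "\<dots> = (\<Sum>N\<in>lattices L \<sigma>. q ^ (2 * K) - q ^ (2 * (K - count \<sigma> s)))"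
      unfolding K_def by (intro sum.cong refl card_top_functionals) (simp add: lattices_def)
    finally show ?thesis by simp
  qed
  have "(\<Sum>M\<in>lattices L \<tau>. q ^ e * S M + q ^ (2 * n * Suc r) * Suc (D M)) =
      (\<Sum>M\<in>lattices L \<tau>. q ^ (2 * n * Suc r) * q ^ (2 * count \<tau> r))"
    using each by (intro sum.cong) auto
  moreover have "(\<Sum>M\<in>lattices L \<tau>. q ^ e * S M + q ^ (2 * n * Suc r) * Suc (D M)) =
      q ^ e * (\<Sum>M\<in>lattices L \<tau>. S M) +
      q ^ (2 * n * Suc r) * (card (lattices L \<tau>) + (\<Sum>M\<in>lattices L \<tau>. D M))"
    by (simp only: sum.distrib sum_distrib_left[symmetric] Suc_eq_plus1) (simp add: add.commute)
  ultimately show ?thesis unfolding sumS sumD by (simp add: r_def ac_simps)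
qed

lemma card_lattices_zero:
  assumes L: "unimodular n L"
  shows "card (lattices L (replicate_mset n 0)) = 1"
proof -
  have "lattices L (replicate_mset n 0) = {L}"
  proof (intro equalityI subsetI)
    fix M assume M: "M \<in> lattices L (replicate_mset n 0)"
    then have "M \<subseteq> L" "has_type M (replicate_mset n 0)" by (auto simp: lattices_def)
    moreover have "idx L M = 1" using idx_lattice(1)[OF L M] by simp
    ultimately show "M \<in> {L}"
      using idx_eq_1_imp_eq[of L M] add_subgroup_subspace has_type_subspace unimodular_subspace[OF L]
      by auto
  next
    fix M assume "M \<in> {L}"
    then show "M \<in> lattices L (replicate_mset n 0)"
      using L idx_self[OF add_subgroup_subspace[OF unimodular_subspace[OF L]]]
      by (auto simp: lattices_def unimodular_def)
  qed
  then show ?thesis by simp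
qed

end

section \<open>The sum over paths\<close>

text \<open>
  The sum over the index set of the theorem with the weight \<open>Q\<close> to the power \<open>l\<^sub>1 w\<^sub>1 + \<dots> + l\<^sub>n w\<^sub>n\<close>,
  written as a recursion along the path \<open>w\<close>. The argument \<open>i\<close> is the next step and \<open>w\<close> the last
  value. In terms of \<open>x = Q\<^sup>w\<close> each step applies the Demazure operator of the reflection
  \<open>x \<mapsto> Q\<^sup>2\<^sup>i\<^sup>-\<^sup>1 / x\<close>.
\<close>

fun path_sum :: "'a::field \<Rightarrow> nat \<Rightarrow> int \<Rightarrow> nat list \<Rightarrow> 'a" where
  "path_sum Q i w [] = 1"
| "path_sum Q i w (l # ls) =
    Q powi (int l * w) / (1 - Q powi (2 * int i - 1 - 2 * w)) * path_sum Q (Suc i) w ls +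
    (let v = 2 * int i - 1 - w
     in Q powi (int l * v) / (1 - Q powi (2 * int i - 1 - 2 * v)) * path_sum Q (Suc i) v ls)"

lemma path_sum_reflect: "path_sum Q i w ls = path_sum Q i (2 * int i - 1 - w) ls"
  by (cases ls) (simp_all add: Let_def add.commute)

lemma path_sum_cong_tail:
  assumes "\<And>i w. path_sum Q i w ls = path_sum Q i w ls'"
  shows "path_sum Q i w (us @ ls) = path_sum Q i w (us @ ls')"
  by (induction us arbitrary: i w) (simp_all add: assms)

text \<open>
  Starting one step later and at a value larger by one changes none of the denominators.
\<close>

lemma path_sum_shift:
  assumes "Q \<noteq> 0"
  shows "path_sum Q (Suc i) (w + 1) ls = Q ^ sum_list ls * path_sum Q i w ls"
proof (induction ls arbitrary: i w)
  case (Cons l ls)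
  have e: "2 * int (Suc i) - 1 - 2 * (w + 1) = 2 * int i - 1 - 2 * w"
    "2 * int (Suc i) - 1 - (w + 1) = (2 * int i - 1 - w) + 1"
    "2 * int (Suc i) - 1 - 2 * (2 * int (Suc i) - 1 - (w + 1)) =
      2 * int i - 1 - 2 * (2 * int i - 1 - w)" for w
    by simp_all
  have pw: "Q powi (int l * (w + 1)) = Q ^ l * Q powi (int l * w)" for w
    using assms by (simp add: distrib_left power_int_add)
  show ?case
    unfolding path_sum.simps Let_def e(3) unfolding e(1,2) pw Cons
    by (simp add: power_add algebra_simps add_divide_distrib)
qed simp

lemma flip_weights_sum:
  fixes t :: "'a::field"
  assumes "t \<noteq> 0" "t \<noteq> 1"
  shows "1 / (1 - t) + 1 / (1 - inverse t) = 1"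
proof -
  have "1 / (1 - t) = - (1 / (t - 1))" using minus_divide_right[of 1 "t - 1"] by simp
  moreover have "1 / (1 - inverse t) = t / (t - 1)"
  proof -
    have "1 - inverse t = (t - 1) / t" using assms by (simp add: diff_divide_distrib inverse_eq_divide)
    then show ?thesis by simp
  qed
  ultimately have "1 / (1 - t) + 1 / (1 - inverse t) = t / (t - 1) - 1 / (t - 1)" by simp
  also have "\<dots> = (t - 1) / (t - 1)" by (simp only: diff_divide_distrib)
  finally show ?thesis using assms by simp
qed

context
  fixes Q :: "'a::linordered_field"
  assumes Q_gt_1: "Q > 1"
begin

lemma power_int_eq_1_iff_gt_1: "Q powi k = 1 \<longleftrightarrow> k = 0"
  using Q_gt_1 power_int_strict_increasing[of 0 k Q] power_int_strict_increasing[of k 0 Q]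
  by (cases k "0::int" rule: linorder_cases) auto

text \<open>The two coefficients of a step add up to \<open>1\<close>, as Demazure operators fix constants.\<close>

lemma path_sum_replicate_zero: "path_sum Q i w (replicate n 0) = 1"
proof (induction n arbitrary: i w)
  case (Suc n)
  define k where "k = 2 * int i - 1 - 2 * w"
  have "k \<noteq> 0" unfolding k_def by presburger
  then have t: "Q powi k \<noteq> 1" using power_int_eq_1_iff_gt_1 by simp
  have Q0: "Q powi k \<noteq> 0" using Q_gt_1 by simp
  have "2 * int i - 1 - 2 * (2 * int i - 1 - w) = - k" by (simp add: k_def)
  then have "path_sum Q i w (replicate (Suc n) 0) = 1 / (1 - Q powi k) + 1 / (1 - Q powi (- k))"
    by (simp add: Suc Let_def flip: k_def)
  also have "\<dots> = 1"
    using flip_weights_sum[OF Q0 t] by (simp add: power_int_minus)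
  finally show ?case .
qed simp

text \<open>
  In the first step the value \<open>0\<close> gives a term independent of the head of the list, so the
  difference only involves the value \<open>1\<close>, from which the rest of the path is a shifted copy of a
  path starting at \<open>0\<close>.
\<close>

lemma path_sum_head_step:
  "path_sum Q 1 0 (Suc l # ls) =
    path_sum Q 1 0 (l # ls) + Q ^ (Suc l + sum_list ls) * path_sum Q 1 0 ls"
proof -
  have "path_sum Q (Suc 1) (0 + 1) ls = Q ^ sum_list ls * path_sum Q 1 0 ls"
    using Q_gt_1 by (intro path_sum_shift) auto
  then have shift: "path_sum Q (Suc (Suc 0)) 1 ls = Q ^ sum_list ls * path_sum Q (Suc 0) 0 ls" by simp
  have "Q \<noteq> 0" "1 - 1 / Q \<noteq> 0" using Q_gt_1 by auto
  then have step: "Q ^ Suc l / (1 - 1 / Q) = Q ^ l / (1 - 1 / Q) + Q ^ Suc l"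
    by (simp add: field_simps)
  have expand: "path_sum Q 1 0 (m # ls) = 1 / (1 - Q) * path_sum Q (Suc (Suc 0)) 0 ls +
      Q ^ m / (1 - 1 / Q) * (Q ^ sum_list ls * path_sum Q (Suc 0) 0 ls)" for m
    by (simp add: Let_def shift power_int_minus inverse_eq_divide)
  show ?thesis
    unfolding expand step distrib_right by (simp add: power_add mult.assoc)
qed

text \<open>
  Straightening: an ascent by one may be exchanged with a descent by one. Both sides differ only
  in the terms that flip at the second step, and these cancel because the remaining sum is
  symmetric under the flip of the third step.
\<close>

lemma path_sum_swap: "path_sum Q i w (r # Suc r # ls) = path_sum Q i w (Suc r # r # ls)"
proof -
  define v where "v = 2 * int i - 1 - w"
  define x where "x = Q powi w"
  define y where "y = Q powi v"
  have Q0: "Q \<noteq> 0" using Q_gt_1 by auto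
  have xy0: "x \<noteq> 0" "y \<noteq> 0" using Q0 by (auto simp: x_def y_def)
  define a where "a = path_sum Q (Suc (Suc i)) w ls"
  define c where "c = path_sum Q (Suc (Suc i)) v ls"
  define b where "b = path_sum Q (Suc (Suc i)) (v + 2) ls"
  have b': "path_sum Q (Suc (Suc i)) (w + 2) ls = b"
    using path_sum_reflect[of Q "Suc (Suc i)" "w + 2" ls] by (simp add: b_def v_def algebra_simps)
  have pw: "Q powi (int m * (w + 2)) = (Q ^ 2 * x) ^ m" "Q powi (int m * (v + 2)) = (Q ^ 2 * y) ^ m"
    "Q powi (int m * w) = x ^ m" "Q powi (int m * v) = y ^ m" for m
  proof -
    have pm: "Q powi (int m * z) = (Q powi z) ^ m" for z
      unfolding mult.commute[of "int m"] power_int_mult by simp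
    show "Q powi (int m * (w + 2)) = (Q ^ 2 * x) ^ m" "Q powi (int m * (v + 2)) = (Q ^ 2 * y) ^ m"
      "Q powi (int m * w) = x ^ m" "Q powi (int m * v) = y ^ m"
      unfolding pm using Q0 by (simp_all add: x_def y_def power_int_add mult.commute)
  qed
  have quot: "Q powi (v - w) = y / x" "Q powi (w - v) = x / y"
    "Q powi (v + 2 - w) = Q ^ 2 * y / x" "Q powi (w - (v + 2)) = x / (Q ^ 2 * y)"
    "Q powi (w + 2 - v) = Q ^ 2 * x / y" "Q powi (v - (w + 2)) = y / (Q ^ 2 * x)"
    using Q0 by (simp_all add: x_def y_def power_int_diff power_int_add mult.commute)
  have ne: "x \<noteq> y" "x \<noteq> Q ^ 2 * y" "y \<noteq> Q ^ 2 * x"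
  proof -
    have "v - w \<noteq> 0" "v + 2 - w \<noteq> 0" "w + 2 - v \<noteq> 0" unfolding v_def by presburger+
    then have "Q powi (v - w) \<noteq> 1" "Q powi (v + 2 - w) \<noteq> 1" "Q powi (w + 2 - v) \<noteq> 1"
      using power_int_eq_1_iff_gt_1 by auto
    then show "x \<noteq> y" "x \<noteq> Q ^ 2 * y" "y \<noteq> Q ^ 2 * x" using quot xy0 by auto
  qed
  have e1: "2 * int i - 1 - 2 * w = v - w" "2 * int i - 1 - 2 * v = w - v"
    "2 * int i - 1 - w = v"
    "2 * int (Suc i) - 1 - w = v + 2" "2 * int (Suc i) - 1 - v = w + 2"
    "2 * int (Suc i) - 1 - 2 * w = v + 2 - w" "2 * int (Suc i) - 1 - 2 * v = w + 2 - v"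
    "2 * int (Suc i) - 1 - 2 * (v + 2) = w - (v + 2)"
    "2 * int (Suc i) - 1 - 2 * (w + 2) = v - (w + 2)"
    by (simp_all add: v_def)
  have expand: "path_sum Q i w (l # m # ls) =
      x ^ l / (1 - y / x) *
        (x ^ m / (1 - Q ^ 2 * y / x) * a + (Q ^ 2 * y) ^ m / (1 - x / (Q ^ 2 * y)) * b) +
      y ^ l / (1 - x / y) *
        (y ^ m / (1 - Q ^ 2 * x / y) * c + (Q ^ 2 * x) ^ m / (1 - y / (Q ^ 2 * x)) * b)" for l m
    by (simp only: path_sum.simps Let_def e1 pw quot a_def[symmetric] b_def[symmetric]
        c_def[symmetric] b')
  define z where "z = Q ^ 2"
  have z0: "z \<noteq> 0" using Q0 by (simp add: z_def)
  have ne': "x - y \<noteq> 0" "z * y - x \<noteq> 0" "z * x - y \<noteq> 0" using ne by (auto simp: z_def)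
  have f1: "1 / (1 - y / x) = x / (x - y)" "1 / (1 - x / y) = - (y / (x - y))"
    "1 / (1 - x / (z * y)) = z * y / (z * y - x)" "1 / (1 - y / (z * x)) = z * x / (z * x - y)"
    using xy0 z0 ne' ne(1) by (simp_all add: divide_simps) (simp add: algebra_simps)
  define A where "A = x / (x - y)"
  define B where "B = - (y / (x - y))"
  define \<beta> where "\<beta> = z * y / (z * y - x)"
  define \<gamma> where "\<gamma> = z * x / (z * x - y)"
  define \<delta> where "\<delta> = 1 / (1 - z * y / x)"
  define \<epsilon> where "\<epsilon> = 1 / (1 - z * x / y)"
  have quotient: "u / d * v = u * (1 / d) * v" "u / d = u * (1 / d)" for u d v :: 'a by simp_all
  have expand': "path_sum Q i w (l # m # ls) =
      x ^ l * A * (x ^ m * \<delta> * a + (z * y) ^ m * \<beta> * b) +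
      y ^ l * B * (y ^ m * \<epsilon> * c + (z * x) ^ m * \<gamma> * b)" for l m
    unfolding expand z_def[symmetric] A_def B_def \<beta>_def \<gamma>_def \<delta>_def \<epsilon>_def f1[symmetric] by simp
  have \<beta>: "\<beta> * (z * y - x) = z * y" and \<gamma>: "\<gamma> * (z * x - y) = z * x"
    using ne' by (simp_all add: \<beta>_def \<gamma>_def)
  have "path_sum Q i w (r # Suc r # ls) - path_sum Q i w (Suc r # r # ls) =
     x ^ r * y ^ r * z ^ r * b * (A * (\<beta> * (z * y - x)) + B * (\<gamma> * (z * x - y)))"
    unfolding expand' by (simp add: power_mult_distrib algebra_simps)
  also have "A * (\<beta> * (z * y - x)) + B * (\<gamma> * (z * x - y)) = z * (A * y + B * x)"
    unfolding \<beta> \<gamma> by (simp add: algebra_simps)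
  also have "A * y + B * x = 0" by (simp add: A_def B_def)
  finally show ?thesis by simp
qed

lemma path_sum_bubble:
  "path_sum Q i w (r # replicate k (Suc r) @ ls) = path_sum Q i w (replicate k (Suc r) @ r # ls)"
proof (induction k arbitrary: i w)
  case (Suc k)
  have "path_sum Q i w (r # Suc r # replicate k (Suc r) @ ls) =
      path_sum Q i w ([Suc r] @ (r # replicate k (Suc r) @ ls))"
    using path_sum_swap by simp
  also have "\<dots> = path_sum Q i w ([Suc r] @ (replicate k (Suc r) @ r # ls))"
    using Suc by (intro path_sum_cong_tail)
  finally show ?case by simp
qed simp

end

section \<open>The number of lattices of a given type\<close>

text \<open>
  The number of lattices of type \<open>l\<^sub>1 \<ge> \<dots> \<ge> l\<^sub>n\<close> in a unimodular lattice of rank \<open>2 n\<close> will turn out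
  to be \<open>orbit_weight\<close> times \<open>path_sum\<close>. The second factor is the number of unimodular lattices
  containing a given lattice of this type; the first one is the ratio of both numbers, a ratio of
  volumes of stabilizers in the symplectic group.
\<close>

definition multiplicity_factorials :: "'a::field \<Rightarrow> nat multiset \<Rightarrow> 'a" where
  "multiplicity_factorials Y \<tau> = (\<Prod>v\<in>set_mset \<tau>. gauss_fact Y (count \<tau> v))"

lemma gauss_fact_0: "gauss_fact Y 0 = 1"
  by (simp add: gauss_fact_def)

lemma gauss_fact_Suc: "gauss_fact Y (Suc n) = gauss_fact Y n * gauss_int Y (Suc n)"
  by (simp add: gauss_fact_def)

lemma multiplicity_factorials_add:
  "multiplicity_factorials Y (add_mset v \<tau>) =
    multiplicity_factorials Y \<tau> * gauss_int Y (Suc (count \<tau> v))"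
proof -
  have ext: "multiplicity_factorials Y \<sigma> = (\<Prod>u\<in>insert v (set_mset \<tau>). gauss_fact Y (count \<sigma> u))"
    if "set_mset \<sigma> \<subseteq> insert v (set_mset \<tau>)" for \<sigma>
    unfolding multiplicity_factorials_def using that
    by (intro prod.mono_neutral_left) (auto simp: gauss_fact_0 not_in_iff)
  have "(\<Prod>u\<in>set_mset \<tau> - {v}. gauss_fact Y (count (add_mset v \<tau>) u)) =
      (\<Prod>u\<in>set_mset \<tau> - {v}. gauss_fact Y (count \<tau> u))"
    by (intro prod.cong) auto
  then show ?thesis
    using ext[of \<tau>] ext[of "add_mset v \<tau>"]
    by (auto simp: prod.insert_remove gauss_fact_Suc subset_insertI)
qed

text \<open>The exponent is the sum of \<open>2 (n + 1 - 2 i) l\<^sub>i\<close> for a list \<open>l\<^sub>1, \<dots>, l\<^sub>n\<close>.\<close>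

fun orbit_exponent :: "nat list \<Rightarrow> int" where
  "orbit_exponent [] = 0"
| "orbit_exponent (l # ls) = 2 * int (length ls) * int l + orbit_exponent ls - 2 * int (sum_list ls)"

definition orbit_weight :: "'a::field \<Rightarrow> nat list \<Rightarrow> 'a" where
  "orbit_weight Q ls = Q powi orbit_exponent ls *
    (gauss_fact (1 / Q ^ 2) (length ls) / multiplicity_factorials (1 / Q ^ 2) (mset ls))"

lemma orbit_exponent_step:
  "orbit_exponent (replicate k r @ Suc s # ls) =
    orbit_exponent (replicate k r @ s # ls) + 2 * int (length ls) - 2 * int k"
  by (induction k) (simp_all add: algebra_simps)

context
  fixes Q :: "'a::linordered_field"
  assumes Q_gt_1: "Q > 1"
begin

lemma gauss_int_pos:
  assumes "n > 0" shows "gauss_int (1 / Q ^ 2) n \<noteq> 0"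
proof -
  have lt: "(1 / Q ^ 2) ^ m < 1" if "m > 0" for m
  proof -
    have "1 < Q ^ (2 * m)" using Q_gt_1 that by (intro one_less_power) auto
    then show ?thesis by (simp add: power_one_over flip: power_mult)
  qed
  have "(1 / Q ^ 2) ^ n < 1" "1 / Q ^ 2 < 1" using lt[OF assms] lt[of 1] by simp_all
  then have "1 - (1 / Q ^ 2) ^ n \<noteq> 0" "1 - 1 / Q ^ 2 \<noteq> 0" by (metis less_irrefl right_minus_eq)+
  then show ?thesis by (simp only: gauss_int_def divide_eq_0_iff simp_thms)
qed

lemma gauss_fact_nonzero: "gauss_fact (1 / Q ^ 2) n \<noteq> 0"
  unfolding gauss_fact_def using gauss_int_pos by (simp add: prod_zero_iff)

lemma multiplicity_factorials_nonzero: "multiplicity_factorials (1 / Q ^ 2) \<tau> \<noteq> 0"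
  unfolding multiplicity_factorials_def using gauss_fact_nonzero by (simp add: prod_zero_iff)

lemma gauss_int_ratio:
  assumes "k > 0"
  shows "gauss_int (1 / Q ^ 2) m * (Q ^ (2 * k) - 1) =
    gauss_int (1 / Q ^ 2) k * (Q ^ (2 * k) * (1 - 1 / Q ^ (2 * m)))"
proof -
  have Q0: "Q \<noteq> 0" using Q_gt_1 by auto
  define d where "d = 1 - 1 / Q ^ 2"
  have gi: "gauss_int (1 / Q ^ 2) j = (1 - 1 / Q ^ (2 * j)) / d" for j
    by (simp add: gauss_int_def power_mult power_one_over d_def)
  have "(1 - 1 / Q ^ (2 * k)) * Q ^ (2 * k) = Q ^ (2 * k) - 1"
    using Q0 by (simp add: left_diff_distrib)
  then have "(1 - 1 / Q ^ (2 * m)) * (Q ^ (2 * k) - 1) / d =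
      (1 - 1 / Q ^ (2 * k)) * Q ^ (2 * k) * (1 - 1 / Q ^ (2 * m)) / d"
    by (simp only: mult.commute)
  then show ?thesis unfolding gi by (simp only: times_divide_eq_left mult.assoc)
qed

text \<open>
  Lowering one entry of the leading block of length \<open>k + 1\<close> changes two multiplicities by one, and
  the exponent by twice the difference of the numbers of entries after and before it.
\<close>

lemma orbit_weight_neighbour:
  assumes c: "count_list rest s + 1 = c" and len: "length rest = m"
    and rest: "\<forall>l\<in>set rest. l \<le> s"
  shows "orbit_weight Q (replicate (Suc k) (Suc s) @ rest) * (Q ^ (2 * Suc k) - 1) =
    orbit_weight Q (replicate k (Suc s) @ s # rest) * (Q ^ (2 * Suc m) - Q ^ (2 * (Suc m - c)))"
proof -
  have Q0: "Q \<noteq> 0" using Q_gt_1 by auto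
  define \<rho> where "\<rho> = mset (replicate k (Suc s) @ rest)"
  have cr: "count \<rho> (Suc s) = k" "count \<rho> s = c - 1"
    using rest c by (auto simp: \<rho>_def count_mset count_list_0_iff)
  have c1: "c \<ge> 1" "c \<le> Suc m"
    using c len count_le_length[of rest s] by auto
  have m1: "mset (replicate (Suc k) (Suc s) @ rest) = add_mset (Suc s) \<rho>"
    and m2: "mset (replicate k (Suc s) @ s # rest) = add_mset s \<rho>" by (auto simp: \<rho>_def)
  define Y where "Y = 1 / Q ^ 2"
  define W where "W = Q powi orbit_exponent (replicate k (Suc s) @ s # rest) *
    (gauss_fact Y (Suc (k + m)) / multiplicity_factorials Y \<rho>)"
  have ex: "orbit_exponent (replicate (Suc k) (Suc s) @ rest) =
      orbit_exponent (replicate k (Suc s) @ s # rest) + 2 * int m - 2 * int k"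
    using orbit_exponent_step[of k "Suc s" s rest] len by (simp add: replicate_app_Cons_same)
  have Qex: "Q powi (a + 2 * int m - 2 * int k) = Q powi a * Q ^ (2 * m) / Q ^ (2 * k)" for a
  proof -
    have "2 * int m = int (2 * m)" "2 * int k = int (2 * k)" by simp_all
    then show ?thesis using Q0 by (simp only: power_int_add power_int_diff power_int_of_nat simp_thms)
  qed
  have g0: "gauss_int Y (Suc k) \<noteq> 0" "gauss_int Y c \<noteq> 0"
    unfolding Y_def using gauss_int_pos c1 by auto
  have L: "orbit_weight Q (replicate (Suc k) (Suc s) @ rest) =
      W * (Q ^ (2 * m) / Q ^ (2 * k)) / gauss_int Y (Suc k)"
    unfolding orbit_weight_def m1 multiplicity_factorials_add cr ex Qex W_def Y_def
    using len by (simp add: ac_simps)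
  have R: "orbit_weight Q (replicate k (Suc s) @ s # rest) = W / gauss_int Y c"
    unfolding orbit_weight_def m2 multiplicity_factorials_add cr W_def Y_def
    using len c1 by simp
  have ratio: "gauss_int Y c * (Q ^ (2 * Suc k) - 1) =
      gauss_int Y (Suc k) * (Q ^ (2 * Suc k) * (1 - 1 / Q ^ (2 * c)))"
    unfolding Y_def by (rule gauss_int_ratio) simp
  have pw: "Q ^ (2 * Suc m) - Q ^ (2 * (Suc m - c)) = Q ^ (2 * Suc m) * (1 - 1 / Q ^ (2 * c))"
    using Q0 c1 by (simp add: right_diff_distrib power_diff diff_mult_distrib2)
  have "(Q ^ (2 * m) / Q ^ (2 * k)) * Q ^ (2 * Suc k) = Q ^ (2 * Suc m)"
    using Q0 by (simp add: power_add)
  then have "(Q ^ (2 * m) / Q ^ (2 * k)) * (gauss_int Y c * (Q ^ (2 * Suc k) - 1)) =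
      gauss_int Y (Suc k) * (Q ^ (2 * Suc m) - Q ^ (2 * (Suc m - c)))"
    unfolding ratio pw by (simp add: ac_simps)
  moreover have "a / g * b = d / h" if "a * (h * b) = g * d" "g \<noteq> 0" "h \<noteq> 0" for a b d g h :: 'a
    using that by (simp add: field_simps)
  ultimately have "(Q ^ (2 * m) / Q ^ (2 * k)) / gauss_int Y (Suc k) * (Q ^ (2 * Suc k) - 1) =
      (Q ^ (2 * Suc m) - Q ^ (2 * (Suc m - c))) / gauss_int Y c"
    using g0 by blast
  then have "W * ((Q ^ (2 * m) / Q ^ (2 * k)) / gauss_int Y (Suc k) * (Q ^ (2 * Suc k) - 1)) =
      W * ((Q ^ (2 * Suc m) - Q ^ (2 * (Suc m - c))) / gauss_int Y c)" by simp
  then show ?thesis unfolding L R by simp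
qed

lemma orbit_weight_remove:
  assumes rest: "\<forall>l\<in>set rest. l \<le> s" and ls: "ls = replicate k (Suc s) @ rest"
  shows "orbit_weight Q (Suc s # ls) * (Q ^ (2 * Suc k) - 1) * Q ^ (Suc s + sum_list ls) *
      Q ^ (Suc s + sum_list ls) =
    orbit_weight Q ls * (1 - 1 / Q ^ (2 * Suc (length ls))) * Q ^ (2 * Suc (length ls) * Suc s + 2 * Suc k)"
proof -
  have Q0: "Q \<noteq> 0" using Q_gt_1 by auto
  define Y where "Y = 1 / Q ^ 2"
  define n where "n = length ls"
  have cr: "count (mset ls) (Suc s) = k"
    using rest by (auto simp: ls count_mset count_list_0_iff)
  define W where "W = Q powi orbit_exponent ls *
    (gauss_fact Y n / multiplicity_factorials Y (mset ls))"
  have R: "orbit_weight Q ls = W" by (simp add: orbit_weight_def W_def Y_def n_def)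
  have Qex: "Q powi orbit_exponent (Suc s # ls) =
      Q powi orbit_exponent ls * Q ^ (2 * n * Suc s) / Q ^ (2 * sum_list ls)"
  proof -
    have "orbit_exponent (Suc s # ls) = orbit_exponent ls + int (2 * n * Suc s) - int (2 * sum_list ls)"
      by (simp add: n_def algebra_simps)
    then show ?thesis using Q0 by (simp only: power_int_add power_int_diff power_int_of_nat simp_thms)
  qed
  have L: "orbit_weight Q (Suc s # ls) =
      W * (Q ^ (2 * n * Suc s) / Q ^ (2 * sum_list ls)) * gauss_int Y (Suc n) / gauss_int Y (Suc k)"
    unfolding orbit_weight_def Qex W_def
    by (simp add: multiplicity_factorials_add cr gauss_fact_Suc n_def[symmetric] Y_def[symmetric]
        ac_simps)
  have g0: "gauss_int Y (Suc k) \<noteq> 0" unfolding Y_def using gauss_int_pos by auto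
  have "gauss_int Y (Suc n) * (Q ^ (2 * Suc k) - 1) =
      gauss_int Y (Suc k) * (Q ^ (2 * Suc k) * (1 - 1 / Q ^ (2 * Suc n)))"
    unfolding Y_def by (rule gauss_int_ratio) simp
  then have ratio: "gauss_int Y (Suc n) / gauss_int Y (Suc k) * (Q ^ (2 * Suc k) - 1) =
      Q ^ (2 * Suc k) * (1 - 1 / Q ^ (2 * Suc n))"
    using g0 by (simp add: field_simps)
  have pw: "Q ^ (2 * n * Suc s) / Q ^ (2 * sum_list ls) * Q ^ (Suc s + sum_list ls) *
      Q ^ (Suc s + sum_list ls) = Q ^ (2 * Suc n * Suc s)"
    using Q0 by (simp add: power_add power2_eq_square power_mult mult_2 field_simps)
  have "orbit_weight Q (Suc s # ls) * (Q ^ (2 * Suc k) - 1) * Q ^ (Suc s + sum_list ls) *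
      Q ^ (Suc s + sum_list ls) =
    W * (gauss_int Y (Suc n) / gauss_int Y (Suc k) * (Q ^ (2 * Suc k) - 1)) *
      (Q ^ (2 * n * Suc s) / Q ^ (2 * sum_list ls) * Q ^ (Suc s + sum_list ls) *
      Q ^ (Suc s + sum_list ls))"
    unfolding L by (simp only: divide_inverse ac_simps)
  also have "\<dots> = W * (1 - 1 / Q ^ (2 * Suc n)) * Q ^ (2 * Suc n * Suc s + 2 * Suc k)"
    unfolding ratio pw by (simp only: power_add ac_simps)
  finally show ?thesis by (simp add: R n_def)
qed

end

lemma orbit_weight_zero:
  fixes Q :: "'a::linordered_field"
  assumes "Q > 1"
  shows "orbit_weight Q (replicate n 0) = 1"
proof -
  have "orbit_exponent (replicate n 0) = 0" by (induction n) simp_all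
  moreover have "multiplicity_factorials (1 / Q ^ 2) (replicate_mset n 0) = gauss_fact (1 / Q ^ 2) n"
    by (cases "n = 0") (simp_all add: multiplicity_factorials_def gauss_fact_0)
  ultimately show ?thesis using gauss_fact_nonzero[OF assms] by (simp add: orbit_weight_def)
qed

lemma sum_complement_mset:
  fixes \<tau> :: "nat multiset"
  shows "\<forall>l\<in>#\<tau>. l \<le> r \<Longrightarrow> (\<Sum>l\<in>#\<tau>. r - l) + \<Sum>\<^sub># \<tau> = size \<tau> * r"
  by (induction \<tau>) auto

lemma split_leading_block:
  fixes ys :: "nat list"
  assumes "sorted_wrt (\<ge>) (x # ys)"
  shows "\<exists>k rest. ys = replicate k x @ rest \<and> (\<forall>l\<in>set rest. l < x)"
  using assms
proof (induction ys)
  case (Cons y ys)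
  show ?case
  proof (cases "y = x")
    case True
    then obtain k rest where "ys = replicate k x @ rest" "\<forall>l\<in>set rest. l < x" using Cons by auto
    then show ?thesis using True by (intro exI[of _ "Suc k"] exI[of _ rest]) simp
  next
    case False
    then show ?thesis using Cons.prems by (intro exI[of _ 0] exI[of _ "y # ys"]) fastforce
  qed
qed simp

context alternating_module
begin

lemma unimodular_split: "unimodular (Suc m) L \<Longrightarrow> \<exists>L'. unimodular m L'"
  using exists_plane[of L "replicate_mset (Suc m) 0" 0] unfolding unimodular_def by auto

text \<open>
  The recursion for the number of lattices is the product of the recursion for \<open>path_sum\<close> with the
  two relations for \<open>orbit_weight\<close>. Lowering the first entry of a list with leading block of length
  \<open>k + 1\<close> leaves it unsorted; straightening moves the lowered entry behind the block.
\<close>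

theorem card_lattices_eq:
  assumes "unimodular n L" "sorted_wrt (\<ge>) ls" "length ls = n"
  shows "(of_nat (card (lattices L (mset ls))) :: rat) =
    orbit_weight (of_nat q) ls * path_sum (of_nat q) 1 0 ls"
  using assms
proof (induction "length ls + sum_list ls" arbitrary: n L ls rule: less_induct)
  case less
  define Q where "Q = (of_nat q :: rat)"
  have Q1: "Q > 1" using q_ge_2 by (simp add: Q_def)
  then have Q0: "Q \<noteq> 0" by auto
  show ?case
  proof (cases "\<forall>l\<in>set ls. l = 0")
    case True
    then have ls: "ls = replicate n 0" using less.prems(3) by (metis replicate_eqI)
    show ?thesis
      using card_lattices_zero[OF less.prems(1)] path_sum_replicate_zero[OF Q1] orbit_weight_zero[OF Q1]
      by (simp add: ls flip: Q_def)
  next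
    case False
    then obtain x ys where xys: "ls = x # ys" by (cases ls) auto
    have "x \<noteq> 0" using False less.prems(2) by (auto simp: xys)
    then obtain s where s: "x = Suc s" using not0_implies_Suc by blast
    obtain k rest where ys: "ys = replicate k (Suc s) @ rest" and rest: "\<forall>l\<in>set rest. l \<le> s"
      using split_leading_block[of x ys] less.prems(2) unfolding xys s by (auto simp: less_Suc_eq_le)
    define ls2 where "ls2 = replicate k (Suc s) @ s # rest"
    have n: "n = Suc (length ys)" using less.prems(3) by (simp add: xys)
    have sorted_ys: "sorted_wrt (\<ge>) ys" using less.prems(2) by (simp add: xys)
    have sorted2: "sorted_wrt (\<ge>) ls2"
    proof -
      have "sorted_wrt (\<ge>) (replicate k (Suc s))" by (induction k) auto
      then show ?thesis
        using sorted_ys rest unfolding ys ls2_def by (auto simp: sorted_wrt_append)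
    qed
    have len2: "length ls2 = n" by (simp add: n ys ls2_def)
    define F where "F = (\<lambda>ls. orbit_weight Q ls * path_sum Q 1 0 ls)"
    have IH_ys: "of_nat (card (lattices L' (mset ys))) = F ys" if "unimodular (n - 1) L'" for L'
      unfolding F_def Q_def by (rule less.hyps) (use that sorted_ys n in \<open>simp_all add: xys\<close>)
    have IH2: "of_nat (card (lattices L (mset ls2))) = F ls2"
      unfolding F_def Q_def
      by (rule less.hyps[OF _ less.prems(1) sorted2 len2]) (simp add: xys s ys ls2_def)
    obtain L0 where L0: "unimodular (n - 1) L0"
      using unimodular_split[of "length ys" L] less.prems(1) n by auto
    define N' where "N' = card (lattices L0 (mset ys))"
    have N': "card (lattices L' (mset ys)) = N'" if "unimodular (n - 1) L'" for L'
    proof -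
      have "(of_nat (card (lattices L' (mset ys))) :: rat) = of_nat N'"
        using IH_ys[OF that] IH_ys[OF L0] by (simp add: N'_def)
      then show ?thesis by (simp only: of_nat_eq_iff)
    qed
    define m where "m = length rest"
    define c where "c = count_list rest s + 1"
    define S where "S = Suc s + sum_list ys"
    define N1 where "N1 = card (lattices L (mset ls))"
    define N2 where "N2 = card (lattices L (mset ls2))"
    have m1: "mset ls = add_mset (Suc s) (mset ys)" by (simp add: xys s)
    have m2: "mset ls2 = add_mset s (mset ys)" by (simp add: ys ls2_def)
    have top: "\<forall>l\<in>#mset ys. l \<le> Suc s" using rest by (auto simp: ys)
    have K: "size (filter_mset (\<lambda>l. l \<le> s) (add_mset s (mset ys))) = Suc m"
    proof -
      have "filter (\<lambda>l. l \<le> s) rest = rest" using rest by (simp add: filter_id_conv)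
      then have "filter (\<lambda>l. l \<le> s) ys = rest" by (simp add: ys)
      then show ?thesis by (simp add: m_def flip: mset_filter)
    qed
    have cs: "count (add_mset s (mset ys)) s = c"
      by (simp add: ys c_def count_mset)
    have ct: "count (add_mset (Suc s) (mset ys)) (Suc s) = Suc k"
      using rest by (auto simp: ys count_mset count_list_0_iff)
    define e where "e = \<Sum>\<^sub># (add_mset (Suc s) (mset ys)) +
      2 * (\<Sum>l\<in>#add_mset (Suc s) (mset ys). Suc s - l) + 2 * Suc k"
    have eS: "e + S = 2 * n * Suc s + 2 * Suc k"
    proof -
      have "(\<Sum>l\<in>#add_mset (Suc s) (mset ys). Suc s - l) + S = n * Suc s"
        using sum_complement_mset[of "add_mset (Suc s) (mset ys)" "Suc s"] top
        by (simp add: S_def n sum_mset_sum_list)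
      moreover have "\<Sum>\<^sub># (add_mset (Suc s) (mset ys)) = S" by (simp add: S_def sum_mset_sum_list)
      ultimately show ?thesis unfolding e_def by linarith
    qed
    have rec: "q ^ e * ((q ^ (2 * n * Suc (Suc s)) - q ^ (2 * n * Suc s)) * N') +
        q ^ (2 * n * Suc (Suc s)) * (N1 + N2 * (q ^ (2 * Suc m) - q ^ (2 * (Suc m - c)))) =
        q ^ (2 * n * Suc (Suc s)) * (q ^ (2 * Suc k) * N1)"
      using card_lattices_recursion[OF less.prems(1) top N'] unfolding K cs ct e_def N1_def N2_def m1 m2
      by blast
    define W where "W = Q ^ (2 * n * Suc (Suc s))"
    have "q ^ (2 * n * Suc s) \<le> q ^ (2 * n * Suc (Suc s))"
      using q_pos by (intro power_increasing) auto
    then have d1: "of_nat (q ^ (2 * n * Suc (Suc s)) - q ^ (2 * n * Suc s)) = W - Q ^ (2 * n * Suc s)"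
      by (simp add: of_nat_diff W_def Q_def)
    have "q ^ (2 * (Suc m - c)) \<le> q ^ (2 * Suc m)"
      using q_pos by (intro power_increasing) auto
    then have d2: "of_nat (q ^ (2 * Suc m) - q ^ (2 * (Suc m - c))) =
        Q ^ (2 * Suc m) - Q ^ (2 * (Suc m - c))"
      by (simp add: of_nat_diff Q_def)
    have "W = Q ^ (2 * n) * Q ^ (2 * n * Suc s)" by (simp add: W_def flip: power_add)
    then have W: "W - Q ^ (2 * n * Suc s) = W * (1 - 1 / Q ^ (2 * n))" "W \<noteq> 0"
      using Q0 by (simp_all add: right_diff_distrib)
    have "of_nat (q ^ e * ((q ^ (2 * n * Suc (Suc s)) - q ^ (2 * n * Suc s)) * N') +
        q ^ (2 * n * Suc (Suc s)) * (N1 + N2 * (q ^ (2 * Suc m) - q ^ (2 * (Suc m - c))))) =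
        (of_nat (q ^ (2 * n * Suc (Suc s)) * (q ^ (2 * Suc k) * N1)) :: rat)"
      by (simp only: rec)
    then have "Q ^ e * (W * (1 - 1 / Q ^ (2 * n)) * of_nat N') +
        W * (of_nat N1 + of_nat N2 * (Q ^ (2 * Suc m) - Q ^ (2 * (Suc m - c)))) =
        W * (Q ^ (2 * Suc k) * of_nat N1)"
      unfolding of_nat_add of_nat_mult d1 d2 W(1) of_nat_power unfolding Q_def[symmetric] W_def .
    then have "W * (Q ^ e * (1 - 1 / Q ^ (2 * n)) * of_nat N' +
        of_nat N2 * (Q ^ (2 * Suc m) - Q ^ (2 * (Suc m - c)))) =
        W * (of_nat N1 * (Q ^ (2 * Suc k) - 1))"
      by (simp add: algebra_simps)
    then have lhs: "of_nat N1 * (Q ^ (2 * Suc k) - 1) = Q ^ e * (1 - 1 / Q ^ (2 * n)) * of_nat N' +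
        of_nat N2 * (Q ^ (2 * Suc m) - Q ^ (2 * (Suc m - c)))" using W(2) by simp
    have path: "path_sum Q 1 0 ls = path_sum Q 1 0 ls2 + Q ^ S * path_sum Q 1 0 ys"
      using path_sum_head_step[OF Q1, of s ys] path_sum_bubble[OF Q1, of 1 0 s k rest]
      by (simp add: xys s ys ls2_def S_def)
    have o2: "orbit_weight Q ls * (Q ^ (2 * Suc k) - 1) =
        orbit_weight Q ls2 * (Q ^ (2 * Suc m) - Q ^ (2 * (Suc m - c)))"
      using orbit_weight_neighbour[OF Q1, of rest s c m k] rest
      by (simp add: xys s ys ls2_def c_def m_def)
    have "orbit_weight Q ls * (Q ^ (2 * Suc k) - 1) * Q ^ S * Q ^ S =
        orbit_weight Q ys * (1 - 1 / Q ^ (2 * n)) * Q ^ (e + S)"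
      using orbit_weight_remove[OF Q1 rest ys] eS unfolding n xys s S_def[symmetric] by simp
    then have o3: "orbit_weight Q ls * (Q ^ (2 * Suc k) - 1) * Q ^ S =
        orbit_weight Q ys * (1 - 1 / Q ^ (2 * n)) * Q ^ e"
      using Q0 by (simp add: power_add flip: mult.assoc)
    have "F ls * (Q ^ (2 * Suc k) - 1) =
        orbit_weight Q ls * (Q ^ (2 * Suc k) - 1) * path_sum Q 1 0 ls2 +
        orbit_weight Q ls * (Q ^ (2 * Suc k) - 1) * Q ^ S * path_sum Q 1 0 ys"
      unfolding F_def path by (simp only: distrib_left distrib_right ac_simps)
    also have "\<dots> = Q ^ e * (1 - 1 / Q ^ (2 * n)) * F ys +
        F ls2 * (Q ^ (2 * Suc m) - Q ^ (2 * (Suc m - c)))"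
      unfolding o3 unfolding o2 F_def by (simp only: ac_simps)
    also have "\<dots> = of_nat N1 * (Q ^ (2 * Suc k) - 1)"
      unfolding lhs N2_def IH2 using IH_ys[OF L0] by (simp add: N'_def)
    finally have "F ls * (Q ^ (2 * Suc k) - 1) = of_nat N1 * (Q ^ (2 * Suc k) - 1)" .
    moreover have "Q ^ (2 * Suc k) \<noteq> 1" using one_less_power[OF Q1, of "2 * Suc k"] by auto
    ultimately show ?thesis unfolding F_def N1_def Q_def by simp
  qed
qed

end

section \<open>Subalgebras over a given lattice\<close>

context alternating_module
begin

definition pair_scale :: "'o \<Rightarrow> 'v \<times> 'o \<Rightarrow> 'v \<times> 'o" where
  "pair_scale c u = (scale c (fst u), c * snd u)"

definition pair_submodule :: "('v \<times> 'o) set \<Rightarrow> bool" where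
  "pair_submodule H \<longleftrightarrow> 0 \<in> H \<and> (\<forall>u\<in>H. \<forall>v\<in>H. u + v \<in> H) \<and> (\<forall>c. \<forall>u\<in>H. pair_scale c u \<in> H)"

text \<open>
  The product of the ambient module with \<open>\<o>\<close> stands for the Heisenberg algebra, the second factor
  being its centre.
\<close>

definition lifts :: "'v set \<Rightarrow> nat \<Rightarrow> ('v \<times> 'o) set set" where
  "lifts M m = {H. pair_submodule H \<and> fst ` H = M \<and> {z. (0, z) \<in> H} = {z. p ^ m dvd z}}"

lemma pair_submoduleD:
  assumes "pair_submodule H"
  shows "(0, 0) \<in> H" "(x, y) \<in> H \<Longrightarrow> (x', y') \<in> H \<Longrightarrow> (x + x', y + y') \<in> H"
    "(x, y) \<in> H \<Longrightarrow> (scale c x, c * y) \<in> H"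
    "(x, y) \<in> H \<Longrightarrow> (x', y') \<in> H \<Longrightarrow> (x - x', y - y') \<in> H"
proof -
  show 0: "(0, 0) \<in> H" using assms by (simp add: pair_submodule_def zero_prod_def)
  show add: "(x + x', y + y') \<in> H" if "(x, y) \<in> H" "(x', y') \<in> H" for x y x' y'
    using assms that unfolding pair_submodule_def by (metis add_Pair)
  show sc: "(scale c x, c * y) \<in> H" if "(x, y) \<in> H" for c x y
    using assms that unfolding pair_submodule_def pair_scale_def by (metis fst_conv snd_conv)
  show "(x - x', y - y') \<in> H" if "(x, y) \<in> H" "(x', y') \<in> H" for x y x' y'
    using add[OF that(1) sc[OF that(2), of "- 1"]] by simp
qed

lemma lifts_zero: "lifts {0} m = {{(0, z) | z. p ^ m dvd z}}"
proof (intro equalityI subsetI)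
  fix H assume "H \<in> lifts {0} m"
  then have H: "fst ` H = {0}" "{z. (0, z) \<in> H} = {z. p ^ m dvd z}" by (auto simp: lifts_def)
  have "u \<in> H \<longleftrightarrow> u \<in> {(0, z) | z. p ^ m dvd z}" for u
  proof -
    have "u \<in> H \<Longrightarrow> fst u = 0" using H(1) by blast
    then show ?thesis using H(2) by (cases u) auto
  qed
  then have "H = {(0, z) | z. p ^ m dvd z}" by (rule set_eqI)
  then show "H \<in> {{(0, z) | z. p ^ m dvd z}}" by simp
next
  fix H assume "H \<in> {{(0 :: 'v, z) | z. p ^ m dvd z}}"
  then have H: "H = {(0, z) | z. p ^ m dvd z}" by simp
  have "(0, 0) \<in> H" by (simp add: H)
  then have "fst ` H = {0}" by (force simp: H)
  then show "H \<in> lifts {0} m"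
    by (auto simp: lifts_def H pair_submodule_def pair_scale_def zero_prod_def)
qed

text \<open>A lift over \<open>\<o> u \<oplus> M\<close> is a lift over \<open>M\<close> with a class modulo \<open>p\<^sup>m\<close> above \<open>u\<close>.\<close>

lemma card_lifts_line:
  assumes M: "subspace M" and free: "\<And>a. scale a u \<in> M \<Longrightarrow> a = 0"
  shows "card (lifts (line 0 u M) m) = q ^ m * card (lifts M m)"
proof -
  define P where "P = {z. p ^ m dvd (z::'o)}"
  have P: "add_subgroup P" unfolding P_def by (rule add_subgroup_multiples)
  define E where "E = (\<lambda>(H, Z). {(scale a u + x, a * z + y) | a z x y. z \<in> Z \<and> (x, y) \<in> H})"
  define R where "R = (\<lambda>H :: ('v \<times> 'o) set. ({w \<in> H. fst w \<in> M}, {z. (u, z) \<in> H}))"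
  have u_line: "u \<in> line 0 u M" using subspace_0[OF M] unfolding line_def
    by (intro CollectI exI[of _ 1] exI[of _ 0]) simp
  have E: "E (H, Z) \<in> lifts (line 0 u M) m \<and> R (E (H, Z)) = (H, Z)"
    if H: "H \<in> lifts M m" and Z: "Z \<in> coset P ` UNIV" for H Z
  proof -
    have HS: "pair_submodule H" "fst ` H = M" "\<And>z. (0, z) \<in> H \<longleftrightarrow> z \<in> P"
      using H by (auto simp: lifts_def P_def)
    note D = pair_submoduleD[OF HS(1)]
    have HM: "x \<in> M" if "(x, y) \<in> H" for x y using that HS(2) by force
    obtain z0 where z0: "Z = coset P z0" using Z by blast
    have z0Z: "z0 \<in> Z" using P by (simp add: z0 mem_coset_iff add_subgroup_0)
    have E_eq: "E (H, Z) = {(scale a u + x, a * z0 + y) | a x y. (x, y) \<in> H}"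
    proof (intro equalityI subsetI)
      fix w assume "w \<in> E (H, Z)"
      then obtain a z x y where w: "w = (scale a u + x, a * z + y)" "z \<in> Z" "(x, y) \<in> H"
        by (auto simp: E_def)
      have "z - z0 \<in> P" using w(2) by (simp add: z0 mem_coset_iff)
      then have "a * (z - z0) \<in> P" by (simp add: P_def)
      then have "(0, a * (z - z0)) \<in> H" using HS(3) by simp
      then have "(x, y + a * (z - z0)) \<in> H" using D(2)[OF w(3)] by force
      moreover have "w = (scale a u + x, a * z0 + (y + a * (z - z0)))"
        using w(1) by (simp add: algebra_simps)
      ultimately show "w \<in> {(scale a u + x, a * z0 + y) | a x y. (x, y) \<in> H}" by blast
    qed (use z0Z in \<open>auto simp: E_def\<close>)
    have mem: "(v, w) \<in> E (H, Z) \<longleftrightarrow> (\<exists>a. (v - scale a u, w - a * z0) \<in> H)" for v w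
    proof
      assume "(v, w) \<in> E (H, Z)"
      then obtain a x y where "v = scale a u + x" "w = a * z0 + y" "(x, y) \<in> H"
        unfolding E_eq by blast
      then show "\<exists>a. (v - scale a u, w - a * z0) \<in> H" by (intro exI[of _ a]) simp
    next
      assume "\<exists>a. (v - scale a u, w - a * z0) \<in> H"
      then obtain a where "(v - scale a u, w - a * z0) \<in> H" by blast
      moreover have "(v, w) = (scale a u + (v - scale a u), a * z0 + (w - a * z0))" by simp
      ultimately show "(v, w) \<in> E (H, Z)" unfolding E_eq by blast
    qed
    have "pair_submodule (E (H, Z))"
      unfolding pair_submodule_def
    proof (intro conjI ballI allI)
      show "0 \<in> E (H, Z)" unfolding zero_prod_def mem using D(1) by (intro exI[of _ 0]) simp
    next
      fix s t assume st: "s \<in> E (H, Z)" "t \<in> E (H, Z)"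
      obtain v w v' w' where vw: "s = (v, w)" "t = (v', w')" by (cases s, cases t)
      obtain a b where "(v - scale a u, w - a * z0) \<in> H" "(v' - scale b u, w' - b * z0) \<in> H"
        using st unfolding vw mem by blast
      then have "(v - scale a u + (v' - scale b u), w - a * z0 + (w' - b * z0)) \<in> H" by (rule D(2))
      then show "s + t \<in> E (H, Z)"
        unfolding vw add_Pair mem by (intro exI[of _ "a + b"]) (simp add: algebra_simps)
    next
      fix c t assume t: "t \<in> E (H, Z)"
      obtain v w where vw: "t = (v, w)" by (cases t)
      obtain a where "(v - scale a u, w - a * z0) \<in> H" using t unfolding vw mem by blast
      then have "(scale c (v - scale a u), c * (w - a * z0)) \<in> H" by (rule D(3))
      then show "pair_scale c t \<in> E (H, Z)"
        unfolding vw pair_scale_def fst_conv snd_conv mem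
        by (intro exI[of _ "c * a"]) (simp add: algebra_simps)
    qed
    moreover have "fst ` E (H, Z) = line 0 u M"
    proof -
      have "v \<in> fst ` E (H, Z) \<longleftrightarrow> (\<exists>a. v - scale a u \<in> M)" for v
      proof
        assume "v \<in> fst ` E (H, Z)"
        then obtain w where "(v, w) \<in> E (H, Z)" by force
        then show "\<exists>a. v - scale a u \<in> M" unfolding mem using HM by blast
      next
        assume "\<exists>a. v - scale a u \<in> M"
        then obtain a y where "(v - scale a u, y) \<in> H" using HS(2) by force
        then have "(v, y + a * z0) \<in> E (H, Z)" unfolding mem by (intro exI[of _ a]) simp
        then show "v \<in> fst ` E (H, Z)" by force
      qed
      moreover have "v \<in> line 0 u M \<longleftrightarrow> (\<exists>a. v - scale a u \<in> M)" for v
      proof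
        assume "v \<in> line 0 u M"
        then obtain a z where "v = scale a u + z" "z \<in> M" by (auto simp: line_def)
        then show "\<exists>a. v - scale a u \<in> M" by (intro exI[of _ a]) simp
      next
        assume "\<exists>a. v - scale a u \<in> M"
        then obtain a where "v - scale a u \<in> M" by blast
        moreover have "v = scale a u + (v - scale a u)" by simp
        ultimately show "v \<in> line 0 u M" unfolding line_def by force
      qed
      ultimately show ?thesis by blast
    qed
    moreover have "(0, z) \<in> E (H, Z) \<longleftrightarrow> p ^ m dvd z" for z
    proof
      assume "(0, z) \<in> E (H, Z)"
      then obtain a where a: "(- scale a u, z - a * z0) \<in> H" unfolding mem by auto
      then have "scale a u \<in> M" using HM subspace_neg[OF M] by fastforce
      then have "a = 0" by (rule free)
      then show "p ^ m dvd z" using a HS(3) by (simp add: P_def)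
    next
      assume "p ^ m dvd z"
      then show "(0, z) \<in> E (H, Z)" unfolding mem using HS(3) by (intro exI[of _ 0]) (simp add: P_def)
    qed
    moreover have "{w \<in> E (H, Z). fst w \<in> M} = H"
    proof (intro equalityI subsetI)
      fix t assume t: "t \<in> {w \<in> E (H, Z). fst w \<in> M}"
      obtain v w where vw: "t = (v, w)" by (cases t)
      obtain a where a: "(v - scale a u, w - a * z0) \<in> H" "v \<in> M"
        using t unfolding vw by (auto simp: mem)
      have "scale a u \<in> M" using subspace_diff[OF M a(2) HM[OF a(1)]] by simp
      then have "a = 0" by (rule free)
      then show "t \<in> H" using a vw by simp
    next
      fix t assume t: "t \<in> H"
      obtain v w where vw: "t = (v, w)" by (cases t)
      have "(v, w) \<in> E (H, Z)" unfolding mem using t vw by (intro exI[of _ 0]) simp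
      then show "t \<in> {w \<in> E (H, Z). fst w \<in> M}" using HM t vw by auto
    qed
    moreover have "{z. (u, z) \<in> E (H, Z)} = Z"
    proof -
      have "(u, z) \<in> E (H, Z) \<longleftrightarrow> z - z0 \<in> P" for z
      proof
        assume "(u, z) \<in> E (H, Z)"
        then obtain a where a: "(u - scale a u, z - a * z0) \<in> H" unfolding mem by auto
        then have "scale (1 - a) u \<in> M" using HM by (simp add: scale_left_diff_distrib)
        then have "1 - a = 0" by (rule free)
        then have "a = 1" by simp
        then show "z - z0 \<in> P" using a HS(3) by simp
      next
        assume "z - z0 \<in> P"
        then show "(u, z) \<in> E (H, Z)" unfolding mem using HS(3) by (intro exI[of _ 1]) simp
      qed
      then have "{z. (u, z) \<in> E (H, Z)} = coset P z0"
        unfolding set_eq_iff mem_coset_iff mem_Collect_eq by blast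
      then show ?thesis by (simp only: z0[symmetric])
    qed
    ultimately show ?thesis by (simp add: lifts_def R_def)
  qed
  have R: "R H \<in> lifts M m \<times> coset P ` UNIV \<and> E (R H) = H" if H: "H \<in> lifts (line 0 u M) m" for H
  proof -
    have HS: "pair_submodule H" "fst ` H = line 0 u M" "\<And>z. (0, z) \<in> H \<longleftrightarrow> z \<in> P"
      using H by (auto simp: lifts_def P_def)
    note D = pair_submoduleD[OF HS(1)]
    define H0 where "H0 = {w \<in> H. fst w \<in> M}"
    define Z where "Z = {z. (u, z) \<in> H}"
    obtain z0 where z0: "(u, z0) \<in> H" using u_line HS(2) by force
    have Z: "Z = coset P z0"
    proof -
      have "(u, z) \<in> H \<longleftrightarrow> z - z0 \<in> P" for z
      proof
        assume "(u, z) \<in> H"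
        then have "(u - u, z - z0) \<in> H" using z0 by (rule D(4))
        then show "z - z0 \<in> P" using HS(3) by simp
      next
        assume "z - z0 \<in> P"
        then have "(0, z - z0) \<in> H" using HS(3) by simp
        then have "(u + 0, z0 + (z - z0)) \<in> H" by (rule D(2)[OF z0])
        then show "(u, z) \<in> H" by simp
      qed
      then show ?thesis unfolding Z_def set_eq_iff mem_coset_iff mem_Collect_eq by blast
    qed
    have "pair_submodule H0"
      using HS(1) M by (auto simp: H0_def pair_submodule_def pair_scale_def subspace_0 subspace_add
          subspace_scale)
    moreover have "fst ` H0 = M"
    proof
      show "fst ` H0 \<subseteq> M" by (auto simp: H0_def)
      show "M \<subseteq> fst ` H0"
      proof
        fix x assume x: "x \<in> M"
        then have "x \<in> fst ` H" unfolding HS(2) by (rule subsetD[OF subset_line])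
        then show "x \<in> fst ` H0" using x by (force simp: H0_def)
      qed
    qed
    moreover have "{z. (0, z) \<in> H0} = {z. p ^ m dvd z}"
      using HS(3) subspace_0[OF M] by (auto simp: H0_def P_def)
    ultimately have "R H \<in> lifts M m \<times> coset P ` UNIV"
      using Z by (simp add: R_def H0_def Z_def lifts_def)
    moreover have "E (H0, Z) = H"
    proof (intro equalityI subsetI)
      fix t assume "t \<in> E (H0, Z)"
      then obtain a z x y where t: "t = (scale a u + x, a * z + y)" "(u, z) \<in> H" "(x, y) \<in> H"
        by (auto simp: E_def Z_def H0_def)
      then show "t \<in> H" using D(2)[OF D(3)[OF t(2)] t(3)] by simp
    next
      fix t assume t: "t \<in> H"
      obtain v w where vw: "t = (v, w)" by (cases t)
      have "v \<in> line 0 u M" using t vw HS(2) by force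
      then obtain a x where ax: "v = scale a u + x" "x \<in> M" by (auto simp: line_def)
      have "(v, w) \<in> H" using t vw by simp
      then have "(v - scale a u, w - a * z0) \<in> H" by (rule D(4)[OF _ D(3)[OF z0]])
      then have "(x, w - a * z0) \<in> H0" using ax by (simp add: H0_def)
      moreover have "t = (scale a u + x, a * z0 + (w - a * z0))" using vw ax by simp
      moreover have "z0 \<in> Z" using z0 by (simp add: Z_def)
      ultimately show "t \<in> E (H0, Z)" unfolding E_def by blast
    qed
    ultimately show ?thesis by (simp add: R_def H0_def Z_def)
  qed
  have "bij_betw E (lifts M m \<times> coset P ` UNIV) (lifts (line 0 u M) m)"
  proof (rule bij_betw_byWitness[where f' = R])
    show "\<forall>t\<in>lifts M m \<times> coset P ` UNIV. R (E t) = t" using E by auto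
    show "\<forall>H\<in>lifts (line 0 u M) m. E (R H) = H" using R by blast
    show "E ` (lifts M m \<times> coset P ` UNIV) \<subseteq> lifts (line 0 u M) m" using E by auto
    show "R ` lifts (line 0 u M) m \<subseteq> lifts M m \<times> coset P ` UNIV" using R by blast
  qed
  then have "card (lifts (line 0 u M) m) = card (lifts M m \<times> coset P ` UNIV)"
    by (rule bij_betw_same_card[symmetric])
  also have "\<dots> = card (lifts M m) * idx UNIV P" by (simp add: card_cartesian_product idx_def)
  also have "idx UNIV P = q ^ m" unfolding P_def by (rule idx_multiples)
  finally show ?thesis by simp
qed

text \<open>
  The lifts form a torsor under the homomorphisms from \<open>M\<close> to \<open>\<o> / p\<^sup>m\<close>, and \<open>M\<close> is free on two
  vectors for each elementary divisor.
\<close>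

lemma card_lifts: "has_type M \<tau> \<Longrightarrow> card (lifts M m) = q ^ (2 * size \<tau> * m)"
proof (induction rule: has_type.induct)
  case has_type_zero
  show ?case by (simp add: lifts_zero)
next
  case (has_type_plane M \<tau> l u v)
  note Ms = has_type_subspace[OF has_type_plane.hyps(1)]
  have "card (lifts (hsum 0 u v M) m) = q ^ m * card (lifts (line 0 v M) m)"
    unfolding hsum_def using plane_free(1)[OF has_type_plane.hyps(2)]
    by (intro card_lifts_line) (auto simp: subspace_line[OF Ms])
  also have "card (lifts (line 0 v M) m) = q ^ m * card (lifts M m)"
    using plane_free(2)[OF has_type_plane.hyps(2)] by (intro card_lifts_line Ms) auto
  finally have "card (lifts (hsum 0 u v M) m) = q ^ (m + (m + 2 * size \<tau> * m))"
    unfolding has_type_plane.IH by (simp only: power_add)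
  also have "m + (m + 2 * size \<tau> * m) = 2 * size (add_mset l \<tau>) * m" by simp
  finally show ?case .
qed

lemma ideal_of_finite_index:
  assumes 0: "0 \<in> I" and add: "\<And>x y. x \<in> I \<Longrightarrow> y \<in> I \<Longrightarrow> x + y \<in> I"
    and mult: "\<And>c x. x \<in> I \<Longrightarrow> c * x \<in> I" and fin: "idx UNIV I > 0"
  shows "\<exists>m. I = {z. p ^ m dvd z}"
proof -
  have I: "add_subgroup I"
    unfolding add_subgroup_def using 0 add[OF _ mult, of _ _ "- 1"] by simp
  obtain a b :: nat where ab: "a < b" "p ^ a - p ^ b \<in> I"
    using idx_pos_pigeonhole[OF I fin, of "\<lambda>k. p ^ k"] by auto
  have "p ^ b = p ^ a * p ^ (b - a)" using ab(1) by (simp flip: power_add)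
  then have eq: "p ^ a - p ^ b = (1 - p ^ (b - a)) * p ^ a" by (simp add: algebra_simps)
  obtain c where c: "1 = (1 - p ^ (b - a)) * c"
    using unit_one_minus_power[of "b - a"] ab(1) by (auto elim: dvdE)
  have "c * ((1 - p ^ (b - a)) * p ^ a) \<in> I" using mult[OF ab(2), of c] unfolding eq .
  also have "c * ((1 - p ^ (b - a)) * p ^ a) = (1 - p ^ (b - a)) * c * p ^ a" by (simp only: ac_simps)
  finally have k0: "p ^ a \<in> I" unfolding c[symmetric] by simp
  define m where "m = (LEAST k. p ^ k \<in> I)"
  have m: "p ^ m \<in> I" unfolding m_def by (rule LeastI[of "\<lambda>k. p ^ k \<in> I", OF k0])
  have "x \<in> I \<longleftrightarrow> p ^ m dvd x" for x
  proof
    assume x: "x \<in> I"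
    show "p ^ m dvd x"
    proof (cases "x = 0")
      case False
      then obtain u k where uk: "u dvd 1" "x = u * p ^ k" using valuation by blast
      obtain v where "v * u = 1" using uk(1) by (metis dvdE mult.commute)
      then have "p ^ k = v * x" using uk(2) by (simp flip: mult.assoc)
      then have "p ^ k \<in> I" using mult[OF x] by simp
      then have "m \<le> k" unfolding m_def by (rule Least_le)
      then show ?thesis using uk(2) by (simp add: le_imp_power_dvd)
    qed simp
  next
    assume "p ^ m dvd x"
    then obtain c where "x = c * p ^ m" by (metis dvdE mult.commute)
    then show "x \<in> I" using mult[OF m] by simp
  qed
  then show ?thesis by blast
qed

end

section \<open>Compact discrete valuation rings\<close>

lemma maximal_ideal_max_ideal:
  assumes "discrete_valuation_ring TYPE('o::idom)"
  shows "maximal_ideal (max_ideal :: 'o set)"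
  using assms unfolding discrete_valuation_ring_def max_ideal_def by (blast intro: theI')

text \<open>
  The generator of the maximal ideal is a uniformizer. That elements outside the maximal ideal are
  units follows from maximality up to a factor \<open>1 - p t\<close>, and such factors are units by
  completeness.
\<close>

lemma compact_dvr_uniformizer:
  assumes R: "compact_dvr TYPE('o::idom)"
  shows "\<exists>p::'o. finite_residue_dvr p (residue_card TYPE('o))"
proof -
  have dvr: "discrete_valuation_ring TYPE('o)" and complete: "adically_complete (max_ideal :: 'o set)"
    and fin: "finite (additive_quotient UNIV (max_ideal :: 'o set))"
    using R by (auto simp: compact_dvr_def)
  have max: "maximal_ideal (max_ideal :: 'o set)" by (rule maximal_ideal_max_ideal[OF dvr])
  have max_ideal_ring: "ring_ideal (max_ideal :: 'o set)" "(max_ideal :: 'o set) \<noteq> UNIV"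
    and max_larger: "\<And>J. ring_ideal J \<Longrightarrow> max_ideal \<subseteq> J \<Longrightarrow> J = max_ideal \<or> J = (UNIV :: 'o set)"
    using max by (auto simp: maximal_ideal_def)
  have span_eq: "module.span (*) {a} = {x. a dvd x}" for a :: 'o
    by (auto simp: module.span_singleton[OF module_self] dvd_def mult.commute)
  have "\<forall>I :: 'o set. ring_ideal I \<longrightarrow> principal_ideal I"
    using dvr by (simp add: discrete_valuation_ring_def)
  then have "principal_ideal (max_ideal :: 'o set)" using max_ideal_ring(1) by simp
  then obtain p :: 'o where p: "max_ideal = {x. p dvd x}"
    unfolding principal_ideal_def span_eq by (elim exE)
  have ideal_multiples: "ring_ideal {x::'o. a dvd x}" for a
    unfolding ring_ideal_def by (rule module.subspaceI[OF module_self]) auto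
  have p_nonunit: "\<not> p dvd 1"
  proof
    assume "p dvd 1"
    then have "(max_ideal :: 'o set) = UNIV" unfolding p using dvd_trans one_dvd by blast
    then show False using max_ideal_ring(2) by simp
  qed
  have p_nonzero: "p \<noteq> 0"
  proof
    assume "p = 0"
    obtain a :: 'o where a: "a \<noteq> 0" "\<not> a dvd 1"
      using dvr unfolding discrete_valuation_ring_def by (elim conjE exE)
    have "{x. a dvd x} = max_ideal \<or> {x. a dvd x} = (UNIV :: 'o set)"
      using \<open>p = 0\<close> by (intro max_larger ideal_multiples) (auto simp: p)
    then have "a \<in> (max_ideal :: 'o set)" using a(2) by (metis UNIV_I dvd_refl mem_Collect_eq)
    then show False using a(1) \<open>p = 0\<close> by (simp add: p)
  qed
  have powers: "ideal_power max_ideal k = {x::'o. p ^ k dvd x}" for k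
  proof (induction k)
    case (Suc k)
    have "module.span (*) {a * b | a b. a \<in> max_ideal \<and> b \<in> ideal_power max_ideal k} =
        {x. p ^ Suc k dvd x}"
    proof (intro equalityI)
      show "module.span (*) {a * b | a b. a \<in> max_ideal \<and> b \<in> ideal_power max_ideal k} \<subseteq> {x. p ^ Suc k dvd x}"
        using ideal_multiples[of "p ^ Suc k"] unfolding ring_ideal_def Suc unfolding p
        by (intro module.span_minimal[OF module_self]) (auto intro: mult_dvd_mono)
      show "{x. p ^ Suc k dvd x} \<subseteq> module.span (*) {a * b | a b. a \<in> max_ideal \<and> b \<in> ideal_power max_ideal k}"
      proof
        fix x assume "x \<in> {x. p ^ Suc k dvd x}"
        then have "p ^ Suc k dvd x" by simp
        then obtain c where "x = p ^ Suc k * c" by (rule dvdE)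
        then have "x = p * (p ^ k * c)" by (simp add: mult.assoc)
        then have "x \<in> {a * b | a b. a \<in> max_ideal \<and> b \<in> ideal_power max_ideal k}"
          unfolding Suc unfolding p by (intro CollectI exI[of _ p] exI[of _ "p ^ k * c"]) simp
        then show "x \<in> module.span (*) {a * b | a b. a \<in> max_ideal \<and> b \<in> ideal_power max_ideal k}"
          by (rule module.span_base[OF module_self])
      qed
    qed
    then show ?case by simp
  qed simp
  have separated: "x = 0" if "\<And>k. p ^ k dvd x" for x :: 'o
    using complete that unfolding adically_complete_def powers by blast
  \<comment> \<open>The inverse of \<open>1 - p s\<close> is the limit of the geometric series.\<close>
  have geometric: "(1 - p * s) dvd 1" for s :: 'o
  proof -
    define f where "f = (\<lambda>k. \<Sum>i<k. (p * s) ^ i)"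
    have cauchy: "\<forall>k. f (Suc k) - f k \<in> ideal_power max_ideal k"
      by (simp add: f_def powers power_mult_distrib)
    have "\<exists>y. \<forall>k. y - f k \<in> ideal_power max_ideal k"
      using complete unfolding adically_complete_def by (elim conjE) (erule allE, erule mp, rule cauchy)
    then obtain y where "\<forall>k. y - f k \<in> ideal_power max_ideal k" ..
    then have y: "p ^ k dvd y - f k" for k by (simp add: powers)
    have "(1 - p * s) * y - 1 = 0"
    proof (rule separated)
      fix k
      have "(1 - p * s) * f k = 1 - (p * s) ^ k"
        unfolding f_def by (rule one_diff_power_eq[symmetric])
      then have "(1 - p * s) * y - 1 = (1 - p * s) * (y - f k) - (p * s) ^ k"
        by (simp add: right_diff_distrib)
      moreover have "p ^ k dvd (1 - p * s) * (y - f k) - (p * s) ^ k"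
        by (rule dvd_diff[OF dvd_mult[OF y]]) (simp add: power_mult_distrib)
      ultimately show "p ^ k dvd (1 - p * s) * y - 1" by simp
    qed
    then have "1 = (1 - p * s) * y" by simp
    then show ?thesis by (rule dvdI)
  qed
  have unit: "x dvd 1" if x: "\<not> p dvd x" for x :: 'o
  proof -
    define J where "J = {r * x + t * p | r t. True}"
    have "ring_ideal J" unfolding ring_ideal_def
    proof (rule module.subspaceI[OF module_self])
      show "0 \<in> J" unfolding J_def by (intro CollectI exI[of _ 0]) simp
      fix y z assume "y \<in> J" "z \<in> J"
      then obtain r t r' t' where "y = r * x + t * p" "z = r' * x + t' * p" by (auto simp: J_def)
      then have "y + z = (r + r') * x + (t + t') * p" by (simp add: algebra_simps)
      then show "y + z \<in> J" unfolding J_def by blast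
    next
      fix c y assume "y \<in> J"
      then obtain r t where "y = r * x + t * p" by (auto simp: J_def)
      then have "c * y = (c * r) * x + (c * t) * p" by (simp add: algebra_simps)
      then show "c * y \<in> J" unfolding J_def by blast
    qed
    moreover have "max_ideal \<subseteq> J"
    proof
      fix y assume "y \<in> (max_ideal :: 'o set)"
      then have "p dvd y" by (simp add: p)
      then obtain t where "y = p * t" by (rule dvdE)
      then have "y = 0 * x + t * p" by (simp add: mult.commute)
      then show "y \<in> J" unfolding J_def by blast
    qed
    moreover have "x \<in> J" unfolding J_def by (intro CollectI exI[of _ 1] exI[of _ 0]) simp
    ultimately have "J = UNIV" using max_larger[of J] x by (auto simp: p)
    then obtain r t where "1 = r * x + t * p" unfolding J_def by blast
    then have "r * x = 1 - p * t" by (simp add: algebra_simps)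
    then show "x dvd 1" using geometric[of t] by (metis dvd_mult_right)
  qed
  have "\<exists>u k. u dvd 1 \<and> x = u * p ^ k" if x: "x \<noteq> 0" for x :: 'o
  proof -
    obtain k0 where k0: "\<not> p ^ k0 dvd x" using separated x by blast
    define k where "k = (LEAST k. \<not> p ^ k dvd x)"
    have k: "\<not> p ^ k dvd x" unfolding k_def by (rule LeastI[of "\<lambda>k. \<not> p ^ k dvd x", OF k0])
    then obtain j where j: "k = Suc j" by (cases k) auto
    have "p ^ j dvd x" using not_less_Least[of j "\<lambda>k. \<not> p ^ k dvd x"] j by (simp add: k_def)
    then obtain u where u: "x = p ^ j * u" by (rule dvdE)
    have "\<not> p dvd u"
    proof
      assume "p dvd u"
      then have "p ^ j * p dvd p ^ j * u" by (rule mult_dvd_mono[OF dvd_refl])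
      then show False using k u j by (simp add: mult.commute)
    qed
    then show ?thesis using unit u by (intro exI[of _ u] exI[of _ j]) (simp add: mult.commute)
  qed
  moreover have "residue_card TYPE('o) = idx UNIV {x::'o. p dvd x}"
    unfolding residue_card_def p by (rule additive_index_eq_idx) (auto simp: add_subgroup_def)
  moreover have "residue_card TYPE('o) > 0"
    using fin unfolding residue_card_def additive_index_def
    by (auto simp: card_gt_0_iff additive_quotient_def quotient_def)
  ultimately have "finite_residue_dvr p (residue_card TYPE('o))"
    using p_nonzero p_nonunit by unfold_locales auto
  then show ?thesis by blast
qed

section \<open>Subalgebras of the Heisenberg algebra\<close>

definition vec_scale :: "'o::idom \<Rightarrow> (nat \<Rightarrow> 'o) \<Rightarrow> nat \<Rightarrow> 'o" where
  "vec_scale c a = (\<lambda>i. c * a i)"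

definition heis_form :: "nat \<Rightarrow> (nat \<Rightarrow> 'o::idom) \<Rightarrow> (nat \<Rightarrow> 'o) \<Rightarrow> 'o" where
  "heis_form n a b = (\<Sum>i=1..n. a (2*i - 1) * b (2*i) - a (2*i) * b (2*i - 1))"

definition heis_base :: "nat \<Rightarrow> (nat \<Rightarrow> 'o::idom) set" where
  "heis_base n = {a. \<forall>i. i \<notin> {1..2*n} \<longrightarrow> a i = 0}"

lemma (in finite_residue_dvr) alternating_module_heis:
  "alternating_module p q vec_scale (heis_form n)"
proof unfold_locales
  fix c :: 'o and x y z :: "nat \<Rightarrow> 'o"
  show "heis_form n (x + y) z = heis_form n x z + heis_form n y z"
    by (simp add: heis_form_def algebra_simps flip: sum.distrib)
  show "heis_form n (vec_scale c x) z = c * heis_form n x z"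
    by (simp add: heis_form_def vec_scale_def algebra_simps sum_distrib_left)
  show "heis_form n x x = 0" by (simp add: heis_form_def mult.commute)
  show "heis_form n x y = - heis_form n y x"
    by (simp add: heis_form_def algebra_simps flip: sum_negf)
  show "c = 0 \<or> x = 0" if "vec_scale c x = 0"
    using that by (auto simp: vec_scale_def fun_eq_iff)
qed (auto simp: vec_scale_def fun_eq_iff algebra_simps)

lemma (in finite_residue_dvr) unimodular_heis_base:
  "alternating_module.unimodular p vec_scale (heis_form n) n (heis_base n :: (nat \<Rightarrow> 'o) set)"
proof -
  interpret H: alternating_module p q vec_scale "heis_form n" by (rule alternating_module_heis)
  define e where "e = (\<lambda>(j::nat) (i::nat). if i = j then 1 else (0::'o))"
  have form_e: "heis_form n (e (2*k + 1)) b = b (2*k + 2)"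
    "heis_form n (e (2*k + 2)) b = - b (2*k + 1)" if "k < n" for k b
  proof -
    have "heis_form n (e (2*k + 1)) b = (\<Sum>i=1..n. if i = Suc k then b (2*k + 2) else 0)"
      unfolding heis_form_def by (intro sum.cong) (auto simp: e_def)
    then show "heis_form n (e (2*k + 1)) b = b (2*k + 2)" using that by simp
    have "heis_form n (e (2*k + 2)) b = (\<Sum>i=1..n. if i = Suc k then - b (2*k + 1) else 0)"
      unfolding heis_form_def by (intro sum.cong) (auto simp: e_def)
    then show "heis_form n (e (2*k + 2)) b = - b (2*k + 1)" using that by simp
  qed
  have "H.has_type (heis_base k) (replicate_mset k 0)" if "k \<le> n" for k
    using that
  proof (induction k)
    case 0
    have "heis_base 0 = {0 :: nat \<Rightarrow> 'o}" by (auto simp: heis_base_def)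
    then show ?case using H.has_type_zero by simp
  next
    case (Suc k)
    have k: "k < n" using Suc.prems by simp
    have P: "H.plane 0 (e (2*k + 1)) (e (2*k + 2)) (heis_base k)"
      unfolding H.plane_def form_e[OF k] by (auto simp: e_def heis_base_def)
    have "H.hsum 0 (e (2*k + 1)) (e (2*k + 2)) (heis_base k) = heis_base (Suc k)"
    proof (intro equalityI subsetI)
      fix x assume "x \<in> H.hsum 0 (e (2*k + 1)) (e (2*k + 2)) (heis_base k)"
      then obtain a b z where "x = vec_scale a (e (2*k + 1)) + vec_scale b (e (2*k + 2)) + z"
        "z \<in> heis_base k" unfolding H.mem_hsum by blast
      then show "x \<in> heis_base (Suc k)" by (auto simp: heis_base_def vec_scale_def e_def)
    next
      fix x :: "nat \<Rightarrow> 'o" assume x: "x \<in> heis_base (Suc k)"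
      define z where "z = x(2*k + 1 := 0, 2*k + 2 := 0)"
      have "x = vec_scale (x (2*k + 1)) (e (2*k + 1)) + vec_scale (x (2*k + 2)) (e (2*k + 2)) + z"
        by (auto simp: z_def vec_scale_def e_def fun_eq_iff)
      moreover have "z \<in> heis_base k"
        using x by (auto simp: z_def heis_base_def)
      ultimately show "x \<in> H.hsum 0 (e (2*k + 1)) (e (2*k + 2)) (heis_base k)"
        unfolding H.mem_hsum by (metis one_dvd power_0)
    qed
    moreover have "H.has_type (heis_base k) (replicate_mset k 0)" using Suc.IH k by simp
    from H.has_type_plane[OF this P]
    have "H.has_type (H.hsum 0 (e (2*k + 1)) (e (2*k + 2)) (heis_base k)) (replicate_mset (Suc k) 0)"
      by (simp only: replicate_mset_Suc)
    ultimately show ?case by (simp only:)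
  qed
  then show ?thesis by (simp add: H.unimodular_def)
qed

text \<open>
  The first component is the exponent of the intersection with the centre, the second the type of
  the image in the abelianization.
\<close>

definition subalgebra_types :: "nat \<Rightarrow> nat \<Rightarrow> (nat \<times> nat list) set" where
  "subalgebra_types n N = {(m, ls). sorted_wrt (\<ge>) ls \<and> length ls = n \<and> m + sum_list ls = N \<and>
    (\<forall>l\<in>set ls. m \<le> l)}"

lemma finite_subalgebra_types: "finite (subalgebra_types n N)"
proof (rule finite_subset)
  show "subalgebra_types n N \<subseteq> {0..N} \<times> {ls. set ls \<subseteq> {0..N} \<and> length ls = n}"
    using member_le_sum_list by (fastforce simp: subalgebra_types_def)
qed (simp add: finite_lists_length_eq)

lemma sorted_desc_unique:
  fixes xs ys :: "nat list"
  assumes "sorted_wrt (\<ge>) xs" "sorted_wrt (\<ge>) ys" "mset xs = mset ys"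
  shows "xs = ys"
proof -
  have "sorted (rev xs)" "sorted (rev ys)" using assms by (simp_all add: sorted_wrt_rev)
  then have "sort (rev xs) = rev ys" "sort (rev xs) = rev xs"
    using properties_for_sort[of "rev ys" "rev xs"] properties_for_sort[of "rev xs" "rev xs"] assms(3)
    by simp_all
  then show ?thesis by simp
qed

context finite_residue_dvr
begin

lemma idx_heis_submodule:
  assumes H: "alternating_module.pair_submodule vec_scale (H :: 'o heis set)"
    and sub: "fst ` H \<subseteq> heis_base n"
  shows "additive_index (heis_carrier n) H = idx (heis_base n) (fst ` H) * idx UNIV {z. (0, z) \<in> H}"
proof -
  interpret A: alternating_module p q vec_scale "heis_form n" by (rule alternating_module_heis)
  note D = A.pair_submoduleD[OF H]
  define M where "M = fst ` H"
  have HM: "(x, y) \<in> H \<Longrightarrow> x \<in> M" for x y unfolding M_def by force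
  have gH: "add_subgroup H" using D(1,4) by (auto simp: add_subgroup_def zero_prod_def)
  have gM: "add_subgroup M"
    unfolding add_subgroup_def
  proof (intro conjI ballI)
    show "0 \<in> M" using D(1) HM by blast
    fix x y assume "x \<in> M" "y \<in> M"
    then obtain a b where "(x, a) \<in> H" "(y, b) \<in> H" by (auto simp: M_def)
    then show "x - y \<in> M" using D(4) HM by blast
  qed
  have carrier: "heis_carrier n = heis_base n \<times> (UNIV :: 'o set)"
    by (auto simp: heis_carrier_def heis_base_def)
  have gB: "add_subgroup (heis_base n :: (nat \<Rightarrow> 'o) set)" by (auto simp: add_subgroup_def heis_base_def)
  have gP: "add_subgroup (A' \<times> (UNIV :: 'o set))" if "add_subgroup A'" for A' :: "(nat \<Rightarrow> 'o) set"
    using that by (auto simp: add_subgroup_def zero_prod_def)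
  have gI: "add_subgroup {z. (0, z) \<in> H}"
    using D(1) D(4)[of 0 _ 0] by (auto simp: add_subgroup_def)
  have MB: "M \<subseteq> heis_base n" using sub by (simp add: M_def)
  have HP: "H \<subseteq> M \<times> UNIV" using HM by auto
  have "additive_index (heis_carrier n) H = idx (heis_base n \<times> UNIV) H"
    unfolding carrier using HP MB by (intro additive_index_eq_idx gP gB gH) blast
  also have "\<dots> = idx (heis_base n \<times> (UNIV :: 'o set)) (M \<times> UNIV) * idx (M \<times> UNIV) H"
    using MB by (intro idx_tower[OF gP[OF gB] gP[OF gM] gH HP]) auto
  also have "idx (heis_base n \<times> (UNIV :: 'o set)) (M \<times> UNIV) = idx (heis_base n) M"
  proof (rule idx_cong_hom[where f = fst])
    fix y assume "y \<in> (heis_base n :: (nat \<Rightarrow> 'o) set)"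
    then show "\<exists>x\<in>heis_base n \<times> (UNIV :: 'o set). y - fst x \<in> M"
      using add_subgroup_0[OF gM] by (intro bexI[of _ "(y, 0)"]) auto
  qed (use gM gP[OF gM] add_subgroup_diff[OF gP[OF gB]] in auto)
  also have "idx (M \<times> UNIV) H = idx UNIV {z. (0, z) \<in> H}"
  proof (rule idx_cong_hom[symmetric, where f = "\<lambda>z. (0, z)"])
    fix t assume t: "t \<in> M \<times> (UNIV :: 'o set)"
    obtain x w where xw: "t = (x, w)" by (cases t)
    then obtain y where "(x, y) \<in> H" using t by (auto simp: M_def)
    then show "\<exists>z\<in>UNIV. t - (0, z) \<in> H" unfolding xw by (intro bexI[of _ "w - y"]) auto
  qed (use gH gI add_subgroup_0[OF gM] in auto)
  finally show ?thesis by (simp add: M_def)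
qed

text \<open>
  A subalgebra is determined by its image \<open>M\<close> in the abelianization, its intersection \<open>p\<^sup>m \<o>\<close> with
  the centre, and a lift of \<open>M\<close>. It is closed under the bracket iff the form takes values in
  \<open>p\<^sup>m \<o>\<close> on \<open>M\<close>, that is, iff \<open>m\<close> is at most the smallest elementary divisor.
\<close>

theorem num_subalgebras_eq:
  "(of_nat (num_subalgebras TYPE('o) n (q ^ N)) :: rat) =
    (\<Sum>(m, ls)\<in>subalgebra_types n N.
      orbit_weight (of_nat q) ls * path_sum (of_nat q) 1 0 ls * of_nat q ^ (2 * n * m))"
proof -
  interpret A: alternating_module p q vec_scale "heis_form n" by (rule alternating_module_heis)
  have unimod: "A.unimodular n (heis_base n)" by (rule unimodular_heis_base)
  define L where "L = (heis_base n :: (nat \<Rightarrow> 'o) set)"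
  have L: "A.unimodular n L" using unimod by (simp add: L_def)
  define \<A> where "\<A> = {H :: 'o heis set. heis_subalgebra n H \<and> additive_index (heis_carrier n) H = q ^ N}"
  define \<T> where "\<T> = (SIGMA t:subalgebra_types n N. SIGMA M:A.lattices L (mset (snd t)). A.lifts M (fst t))"
  have scale: "A.pair_scale = heis_scale"
    by (auto simp: A.pair_scale_def heis_scale_def vec_scale_def fun_eq_iff)
  have subspace: "A.pair_submodule H \<longleftrightarrow> module.subspace heis_scale H" for H
    unfolding A.pair_submodule_def scale module.subspace_def[OF module_heis] ..
  have bracket: "heis_bracket n u v = (0, heis_form n (fst u) (fst v))" for u v :: "'o heis"
    by (simp add: heis_bracket_def heis_form_def)
  have carrier: "H \<subseteq> heis_carrier n \<longleftrightarrow> fst ` H \<subseteq> L" for H :: "'o heis set"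
    by (force simp: heis_carrier_def heis_base_def L_def)
  have into: "H \<in> \<A>" if t: "(m, ls) \<in> subalgebra_types n N" and M: "M \<in> A.lattices L (mset ls)"
    and H: "H \<in> A.lifts M m" for m ls M H
  proof -
    have MT: "M \<subseteq> L" "A.has_type M (mset ls)" using M by (auto simp: A.lattices_def)
    have HS: "A.pair_submodule H" "fst ` H = M" "{z. (0, z) \<in> H} = {z. p ^ m dvd z}"
      using H by (auto simp: A.lifts_def)
    have "\<forall>x\<in>M. \<forall>y\<in>M. p ^ m dvd heis_form n x y"
      unfolding A.has_type_form_dvd[OF MT(2)] using t by (auto simp: subalgebra_types_def)
    then have "heis_bracket n u v \<in> H" if "u \<in> H" "v \<in> H" for u v
      unfolding bracket using that HS(2,3) by blast
    moreover have "additive_index (heis_carrier n) H = q ^ N"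
    proof -
      have "additive_index (heis_carrier n) H = idx L M * q ^ m"
        using idx_heis_submodule[OF HS(1), of n] HS(2,3) MT(1) idx_multiples[of m] by (simp add: L_def)
      also have "idx L M = q ^ sum_list ls" using A.idx_lattice(1)[OF L M] by (simp add: sum_mset_sum_list)
      finally show ?thesis using t by (auto simp: subalgebra_types_def power_add mult.commute)
    qed
    ultimately show ?thesis
      using HS(1,2) MT(1) by (simp add: \<A>_def heis_subalgebra_def subspace carrier)
  qed
  have onto: "\<exists>m ls M. (m, ls) \<in> subalgebra_types n N \<and> M \<in> A.lattices L (mset ls) \<and> H \<in> A.lifts M m"
    if H: "H \<in> \<A>" for H
  proof -
    have HS: "A.pair_submodule H" "fst ` H \<subseteq> L" "\<And>u v. u \<in> H \<Longrightarrow> v \<in> H \<Longrightarrow> heis_bracket n u v \<in> H"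
      "additive_index (heis_carrier n) H = q ^ N"
      using H by (auto simp: \<A>_def heis_subalgebra_def subspace simp flip: carrier)
    note D = A.pair_submoduleD[OF HS(1)]
    define M where "M = fst ` H"
    define I where "I = {z. (0, z) \<in> H}"
    have idx: "idx L M * idx UNIV I = q ^ N"
      using idx_heis_submodule[OF HS(1), of n] HS(2,4) by (simp add: M_def I_def L_def)
    have "q ^ N > 0" using q_pos by simp
    then have pos: "idx L M > 0" "idx UNIV I > 0" unfolding idx[symmetric] by simp_all
    have "\<exists>m. I = {z. p ^ m dvd z}"
    proof (rule A.ideal_of_finite_index)
      show "0 \<in> I" using D(1) by (simp add: I_def)
      show "x + y \<in> I" if "x \<in> I" "y \<in> I" for x y
        using D(2)[of 0 x 0 y] that by (simp add: I_def)
      show "c * x \<in> I" if "x \<in> I" for c x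
        using D(3)[of 0 x c] that by (simp add: I_def)
    qed (rule pos)
    then obtain m where m: "I = {z. p ^ m dvd z}" by blast
    have "A.subspace M"
    proof (rule A.subspaceI)
      show "0 \<in> M" using D(1) unfolding M_def by force
      fix x y assume "x \<in> M" "y \<in> M"
      then obtain a b where "(x, a) \<in> H" "(y, b) \<in> H" by (auto simp: M_def)
      then have "(x + y, a + b) \<in> H" by (rule D(2))
      then show "x + y \<in> M" unfolding M_def by force
    next
      fix c x assume "x \<in> M"
      then obtain a where "(x, a) \<in> H" by (auto simp: M_def)
      then have "(vec_scale c x, c * a) \<in> H" by (rule D(3))
      then show "vec_scale c x \<in> M" unfolding M_def by force
    qed
    then obtain \<tau> where \<tau>: "A.has_type M \<tau>"
      using A.sublattice_has_type[OF L[unfolded A.unimodular_def]] HS(2) pos(1) unfolding M_def by blast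
    define ls where "ls = rev (sorted_list_of_multiset \<tau>)"
    have ls: "mset ls = \<tau>" "sorted_wrt (\<ge>) ls"
      by (simp_all add: ls_def sorted_wrt_rev sorted_sorted_list_of_multiset)
    have M: "M \<in> A.lattices L (mset ls)" using \<tau> ls HS(2) pos(1) by (simp add: A.lattices_def M_def)
    have "q ^ (m + sum_list ls) = q ^ N"
      using A.idx_lattice(1)[OF L M] idx idx_multiples[of m]
      by (simp add: m sum_mset_sum_list power_add mult.commute)
    then have N: "m + sum_list ls = N" using q_ge_2 by (simp add: power_inject_exp)
    have "\<forall>x\<in>M. \<forall>y\<in>M. p ^ m dvd heis_form n x y"
    proof (intro ballI)
      fix x y assume "x \<in> M" "y \<in> M"
      then obtain a b where "(x, a) \<in> H" "(y, b) \<in> H" by (auto simp: M_def)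
      then have "heis_form n x y \<in> I" using HS(3) bracket by (fastforce simp: I_def)
      then show "p ^ m dvd heis_form n x y" by (simp add: m)
    qed
    then have "\<forall>l\<in>set ls. m \<le> l" using A.has_type_form_dvd[OF \<tau>] ls(1) by auto
    moreover have "length ls = n" using A.idx_lattice(2)[OF L M] by simp
    ultimately have "(m, ls) \<in> subalgebra_types n N" using ls N by (simp add: subalgebra_types_def)
    moreover have "H \<in> A.lifts M m" using HS(1) m by (simp add: A.lifts_def M_def I_def)
    ultimately show ?thesis using M by blast
  qed
  have "bij_betw (\<lambda>(t, M, H). H) \<T> \<A>"
    unfolding bij_betw_def
  proof
    show "inj_on (\<lambda>(t, M, H). H) \<T>"
    proof (rule inj_onI)
      fix x y assume xy: "x \<in> \<T>" "y \<in> \<T>" "(case x of (t, M, H) \<Rightarrow> H) = (case y of (t, M, H) \<Rightarrow> H)"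
      obtain m ls M H where x: "x = ((m, ls), M, H)" by (cases x) auto
      obtain m' ls' M' where y: "y = ((m', ls'), M', H)" using xy(3) x by (cases y) auto
      have t: "(m, ls) \<in> subalgebra_types n N" "(m', ls') \<in> subalgebra_types n N"
        and MM: "M \<in> A.lattices L (mset ls)" "M' \<in> A.lattices L (mset ls')"
        and HH: "H \<in> A.lifts M m" "H \<in> A.lifts M' m'"
        using xy(1,2) by (auto simp: x y \<T>_def)
      have MM': "M = M'" using HH by (auto simp: A.lifts_def)
      then have "mset ls = mset ls'" using MM A.has_type_unique by (auto simp: A.lattices_def)
      then have "ls = ls'" using t sorted_desc_unique by (auto simp: subalgebra_types_def)
      moreover have "{z. p ^ m dvd z} = {z. p ^ m' dvd z}" using HH by (simp add: A.lifts_def)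
      then have "p ^ m dvd z \<longleftrightarrow> p ^ m' dvd z" for z by (simp only: set_eq_iff mem_Collect_eq)
      from this[of "p ^ m"] this[of "p ^ m'"] have "p ^ m dvd p ^ m'" "p ^ m' dvd p ^ m"
        by simp_all
      then have "m = m'" by (simp add: p_power_dvd_iff)
      ultimately show "x = y" using MM' by (simp add: x y)
    qed
    show "(\<lambda>(t, M, H). H) ` \<T> = \<A>"
    proof (intro equalityI subsetI)
      fix H assume "H \<in> (\<lambda>(t, M, H). H) ` \<T>"
      then show "H \<in> \<A>" using into by (auto simp: \<T>_def)
    next
      fix H assume "H \<in> \<A>"
      then obtain m ls M where "((m, ls), M, H) \<in> \<T>" using onto[of H] by (auto simp: \<T>_def)
      then show "H \<in> (\<lambda>(t, M, H). H) ` \<T>" by (force simp: image_iff)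
    qed
  qed
  then have "num_subalgebras TYPE('o) n (q ^ N) = card \<T>"
    unfolding num_subalgebras_def \<A>_def[symmetric] by (rule bij_betw_same_card[symmetric])
  also have "\<dots> = (\<Sum>t\<in>subalgebra_types n N. card (SIGMA M:A.lattices L (mset (snd t)). A.lifts M (fst t)))"
  proof -
    have "finite (A.lifts M m)" if "M \<in> A.lattices L \<tau>" for M m \<tau>
    proof -
      have "A.has_type M \<tau>" using that by (simp add: A.lattices_def)
      then have "card (A.lifts M m) > 0" using A.card_lifts q_pos by simp
      then show ?thesis by (rule card_ge_0_finite)
    qed
    then have "finite (SIGMA M:A.lattices L (mset (snd t)). A.lifts M (fst t))" for t
      using A.finite_lattices[OF L] by (intro finite_SigmaI) auto
    then show ?thesis unfolding \<T>_def by (intro card_SigmaI finite_subalgebra_types) auto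
  qed
  also have "\<dots> = (\<Sum>t\<in>subalgebra_types n N. card (A.lattices L (mset (snd t))) * q ^ (2 * n * fst t))"
  proof (rule sum.cong[OF refl])
    fix t assume t: "t \<in> subalgebra_types n N"
    have c: "card (A.lifts M (fst t)) = q ^ (2 * n * fst t)" if "M \<in> A.lattices L (mset (snd t))" for M
      using A.card_lifts[of M "mset (snd t)"] A.idx_lattice(2)[OF L that] that
      by (simp add: A.lattices_def)
    then have "finite (A.lifts M (fst t))" if "M \<in> A.lattices L (mset (snd t))" for M
      using that q_pos by (intro card_ge_0_finite) simp
    then have "card (SIGMA M:A.lattices L (mset (snd t)). A.lifts M (fst t)) =
        (\<Sum>M\<in>A.lattices L (mset (snd t)). card (A.lifts M (fst t)))"
      using A.finite_lattices[OF L] by (intro card_SigmaI) auto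
    then show "card (SIGMA M:A.lattices L (mset (snd t)). A.lifts M (fst t)) =
        card (A.lattices L (mset (snd t))) * q ^ (2 * n * fst t)"
      by (simp add: c)
  qed
  finally have "(of_nat (num_subalgebras TYPE('o) n (q ^ N)) :: rat) =
      (\<Sum>t\<in>subalgebra_types n N. of_nat (card (A.lattices L (mset (snd t)))) * of_nat q ^ (2 * n * fst t))"
    by simp
  also have "\<dots> = (\<Sum>t\<in>subalgebra_types n N. orbit_weight (of_nat q) (snd t) *
      path_sum (of_nat q) 1 0 (snd t) * of_nat q ^ (2 * n * fst t))"
  proof (rule sum.cong[OF refl])
    fix t assume "t \<in> subalgebra_types n N"
    then have "sorted_wrt (\<ge>) (snd t)" "length (snd t) = n" by (auto simp: subalgebra_types_def)
    then show "of_nat (card (A.lattices L (mset (snd t)))) * (of_nat q :: rat) ^ (2 * n * fst t) =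
        orbit_weight (of_nat q) (snd t) * path_sum (of_nat q) 1 0 (snd t) * of_nat q ^ (2 * n * fst t)"
      using A.card_lattices_eq[OF L] by simp
  qed
  finally show ?thesis by (simp add: case_prod_unfold)
qed

end

section \<open>Coefficients of Igusa functions\<close>

unbundle fps_syntax

text \<open>Summation by parts, which turns sums over differences \<open>e\<close> into sums over their partial sums.\<close>

lemma sum_times_tails:
  fixes a e :: "nat \<Rightarrow> 'a::comm_semiring_0"
  shows "(\<Sum>j<n. a j * (\<Sum>k=Suc j..n. e k)) = (\<Sum>k=1..n. (\<Sum>j<k. a j) * e k)"
proof (induction n)
  case (Suc n)
  have "(\<Sum>j<Suc n. a j * (\<Sum>k=Suc j..Suc n. e k)) =
      (\<Sum>j<Suc n. a j * (\<Sum>k=Suc j..n. e k) + a j * e (Suc n))"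
    by (intro sum.cong) (auto simp: distrib_left)
  also have "\<dots> = (\<Sum>j<n. a j * (\<Sum>k=Suc j..n. e k)) + (\<Sum>j<Suc n. a j) * e (Suc n)"
    by (simp add: sum.distrib sum_distrib_right distrib_right add.assoc)
  finally show ?case using Suc by simp
qed simp

definition monomial_fps :: "'a::field \<Rightarrow> nat \<Rightarrow> 'a fps" where
  "monomial_fps c d = fps_const c * fps_X ^ d"

text \<open>The exponent \<open>0\<close> does not occur in \<open>A / (1 - A) = A + A\<^sup>2 + \<dots>\<close>.\<close>

lemma geometric_fps_nth:
  fixes c :: "'a::field"
  assumes d: "d > 0"
  shows "(monomial_fps c d / (1 - monomial_fps c d)) $ k =
    (if d dvd k \<and> k > 0 then c ^ (k div d) else 0)"
proof -
  define A where "A = monomial_fps c d"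
  define G where "G = Abs_fps (\<lambda>k. if d dvd k \<and> k > 0 then c ^ (k div d) else 0)"
  have "G * (1 - A) = A"
  proof (rule fps_ext)
    fix k
    have "(G * (1 - A)) $ k = G $ k - (fps_const c * (fps_X ^ d * G)) $ k"
      unfolding A_def monomial_fps_def by (simp add: right_diff_distrib mult.commute mult.left_commute)
    also have "\<dots> = G $ k - (if k < d then 0 else c * G $ (k - d))"
      by (simp add: fps_X_power_mult_nth)
    also have "\<dots> = (if k = d then c else 0)"
    proof (cases "k < d")
      case True
      then show ?thesis by (auto simp: G_def dest: dvd_imp_le)
    next
      case False
      define m where "m = k - d"
      have k: "k = m + d" using False by (simp add: m_def)
      have "(m + d) div d = Suc (m div d)" using d by simp
      then show ?thesis using d by (auto simp: G_def k)
    qed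
    also have "\<dots> = A $ k" by (simp add: A_def monomial_fps_def fps_X_power_nth)
    finally show "(G * (1 - A)) $ k = A $ k" .
  qed
  moreover have "1 - A \<noteq> 0"
  proof
    assume "1 - A = 0"
    then have "(1 - A) $ 0 = 0" by simp
    then show False using d by (simp add: A_def monomial_fps_def)
  qed
  ultimately have "A / (1 - A) = G" by (metis nonzero_mult_div_cancel_right)
  then show ?thesis by (simp add: A_def G_def)
qed

definition exponents :: "(nat \<Rightarrow> nat) \<Rightarrow> nat set \<Rightarrow> nat \<Rightarrow> (nat \<Rightarrow> nat) set" where
  "exponents d I N = {e. (\<forall>i. 0 < e i \<longleftrightarrow> i \<in> I) \<and> (\<Sum>i\<in>I. d i * e i) = N}"

lemma finite_exponents:
  assumes "finite I" "\<forall>i\<in>I. d i > 0"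
  shows "finite (exponents d I N)"
proof (rule finite_subset)
  show "exponents d I N \<subseteq> {e. \<forall>i. (i \<in> I \<longrightarrow> e i \<in> {0..N}) \<and> (i \<notin> I \<longrightarrow> e i = 0)}"
  proof
    fix e assume e: "e \<in> exponents d I N"
    have "e i \<le> N" if i: "i \<in> I" for i
    proof -
      have "e i \<le> d i * e i" using mult_le_mono1[of 1 "d i" "e i"] assms(2) i by force
      also have "\<dots> \<le> (\<Sum>i\<in>I. d i * e i)" using assms(1) i by (intro member_le_sum) auto
      finally show ?thesis using e by (simp add: exponents_def)
    qed
    then show "e \<in> {e. \<forall>i. (i \<in> I \<longrightarrow> e i \<in> {0..N}) \<and> (i \<notin> I \<longrightarrow> e i = 0)}"
      using e by (auto simp: exponents_def)
  qed
  show "finite {e. \<forall>i. (i \<in> I \<longrightarrow> e i \<in> {0..N}) \<and> (i \<notin> I \<longrightarrow> e i = 0)}"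
    by (rule finite_set_of_finite_funs) (use assms in auto)
qed

lemma prod_geometric_fps_nth:
  fixes c :: "nat \<Rightarrow> 'a::field"
  assumes "finite I" "\<forall>i\<in>I. d i > 0"
  shows "(\<Prod>i\<in>I. monomial_fps (c i) (d i) / (1 - monomial_fps (c i) (d i))) $ N =
    (\<Sum>e\<in>exponents d I N. \<Prod>i\<in>I. c i ^ e i)"
  using assms
proof (induction I arbitrary: N rule: finite_induct)
  case empty
  show ?case
  proof (cases "N = 0")
    case True
    then have "exponents d {} N = {\<lambda>_. 0}" by (auto simp: exponents_def fun_eq_iff)
    then show ?thesis using True by simp
  next
    case False
    then have "exponents d {} N = {}" by (auto simp: exponents_def)
    then show ?thesis using False by simp
  qed
next
  case (insert j I)
  define P where "P = (\<Prod>i\<in>I. monomial_fps (c i) (d i) / (1 - monomial_fps (c i) (d i)))"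
  define G where "G = monomial_fps (c j) (d j) / (1 - monomial_fps (c j) (d j))"
  define B where "B = {a. 0 < a \<and> d j * a \<le> N}"
  have dj: "d j > 0" using insert.prems by simp
  have finB: "finite B"
  proof (rule finite_subset)
    show "B \<subseteq> {0..N}"
    proof
      fix a assume "a \<in> B"
      then have "d j * a \<le> N" by (simp add: B_def)
      moreover have "1 * a \<le> d j * a" using dj by (intro mult_le_mono1) simp
      ultimately have "a \<le> N" by linarith
      then show "a \<in> {0..N}" by simp
    qed
  qed simp
  have G: "G $ k = (if d j dvd k \<and> k > 0 then c j ^ (k div d j) else 0)" for k
    unfolding G_def by (rule geometric_fps_nth[OF dj])
  have "(G * P) $ N = (\<Sum>k=0..N. G $ k * P $ (N - k))" by (rule fps_mult_nth)
  also have "\<dots> = (\<Sum>k\<in>(\<lambda>a. d j * a) ` B. G $ k * P $ (N - k))"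
  proof (rule sum.mono_neutral_right)
    show "\<forall>k\<in>{0..N} - (\<lambda>a. d j * a) ` B. G $ k * P $ (N - k) = 0"
    proof
      fix k assume k: "k \<in> {0..N} - (\<lambda>a. d j * a) ` B"
      have "\<not> (d j dvd k \<and> k > 0)"
      proof
        assume "d j dvd k \<and> k > 0"
        then obtain a where "k = d j * a" "k > 0" by (auto elim: dvdE)
        then have "k \<in> (\<lambda>a. d j * a) ` B" using k by (auto simp: B_def)
        then show False using k by simp
      qed
      then have "G $ k = 0" unfolding G by (rule if_not_P)
      then show "G $ k * P $ (N - k) = 0" by simp
    qed
  qed (auto simp: B_def)
  also have "\<dots> = (\<Sum>a\<in>B. G $ (d j * a) * P $ (N - d j * a))"
    using dj by (subst sum.reindex) (auto simp: inj_on_def)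
  also have "\<dots> = (\<Sum>a\<in>B. \<Sum>e\<in>exponents d I (N - d j * a). c j ^ a * (\<Prod>i\<in>I. c i ^ e i))"
  proof (rule sum.cong[OF refl])
    fix a assume "a \<in> B"
    then have "G $ (d j * a) = c j ^ a" using dj by (simp add: G B_def)
    then show "G $ (d j * a) * P $ (N - d j * a) =
        (\<Sum>e\<in>exponents d I (N - d j * a). c j ^ a * (\<Prod>i\<in>I. c i ^ e i))"
      using insert.IH insert.prems by (simp add: P_def sum_distrib_left)
  qed
  also have "\<dots> = (\<Sum>(a, e)\<in>(SIGMA a:B. exponents d I (N - d j * a)). c j ^ a * (\<Prod>i\<in>I. c i ^ e i))"
    using finB finite_exponents[OF insert.hyps(1)] insert.prems by (intro sum.Sigma) auto
  also have "\<dots> = (\<Sum>e\<in>exponents d (insert j I) N. \<Prod>i\<in>insert j I. c i ^ e i)"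
  proof (rule sum.reindex_bij_witness[where i = "\<lambda>e. (e j, e(j := 0))" and j = "\<lambda>(a, e). e(j := a)"])
    fix t assume t: "t \<in> (SIGMA a:B. exponents d I (N - d j * a))"
    obtain a e where ae: "t = (a, e)" "0 < a" "d j * a \<le> N" "\<forall>i. 0 < e i \<longleftrightarrow> i \<in> I"
      "(\<Sum>i\<in>I. d i * e i) = N - d j * a" using t by (auto simp: B_def exponents_def)
    have ej: "e j = 0" using ae(4) insert.hyps(2) by auto
    have same: "(\<Sum>i\<in>I. d i * (e(j := a)) i) = (\<Sum>i\<in>I. d i * e i)"
      "(\<Prod>i\<in>I. c i ^ (e(j := a)) i) = (\<Prod>i\<in>I. c i ^ e i)"
      using insert.hyps(2) by (intro sum.cong prod.cong; auto)+
    show "((case t of (a, e) \<Rightarrow> e(j := a)) j, (case t of (a, e) \<Rightarrow> e(j := a))(j := 0)) = t"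
      using ej by (auto simp: ae(1) fun_eq_iff)
    have "(\<Sum>i\<in>insert j I. d i * (e(j := a)) i) = N"
      using insert.hyps same(1) ae(3,5) by simp
    then show "(case t of (a, e) \<Rightarrow> e(j := a)) \<in> exponents d (insert j I) N"
      using ae(2,4) by (simp add: ae(1) exponents_def)
    show "(\<Prod>i\<in>insert j I. c i ^ (case t of (a, e) \<Rightarrow> e(j := a)) i) =
        (case t of (a, e) \<Rightarrow> c j ^ a * (\<Prod>i\<in>I. c i ^ e i))"
      using insert.hyps same(2) by (simp add: ae(1))
  next
    fix e assume e: "e \<in> exponents d (insert j I) N"
    show "(case (e j, e(j := 0)) of (a, e) \<Rightarrow> e(j := a)) = e" by simp
    have "(\<Sum>i\<in>I. d i * (e(j := 0)) i) = (\<Sum>i\<in>I. d i * e i)"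
      using insert.hyps(2) by (intro sum.cong) auto
    moreover have "d j * e j + (\<Sum>i\<in>I. d i * e i) = N" "0 < e j"
      using e insert.hyps by (auto simp: exponents_def)
    ultimately show "(e j, e(j := 0)) \<in> (SIGMA a:B. exponents d I (N - d j * a))"
      using e insert.hyps(2) by (auto simp: exponents_def B_def)
  qed
  finally show ?case using insert.hyps by (simp add: P_def G_def)
qed

definition exponents_within :: "(nat \<Rightarrow> nat) \<Rightarrow> nat set \<Rightarrow> nat \<Rightarrow> (nat \<Rightarrow> nat) set" where
  "exponents_within d S N = {e. (\<forall>i. i \<notin> S \<longrightarrow> e i = 0) \<and> (\<Sum>i\<in>S. d i * e i) = N}"

text \<open>
  Expanding the geometric series, the subset \<open>I\<close> becomes the support of the exponent vector.
\<close>

lemma augmented_igusa_nth: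
  fixes c :: "nat \<Rightarrow> 'a::field"
  assumes d: "\<forall>i\<in>{0..n}. d i > 0" and X: "\<And>i. i \<in> {0..n} \<Longrightarrow> X i = monomial_fps (c i) (d i)"
  shows "augmented_igusa n Y X $ N = (\<Sum>e\<in>exponents_within d {0..n} N.
    gauss_multinomial Y n {i. 0 < e i} * (\<Prod>i\<in>{0..n}. c i ^ e i))"
proof -
  have "augmented_igusa n Y X $ N = (\<Sum>I\<in>Pow {0..n}. gauss_multinomial Y n I *
      (\<Prod>i\<in>I. X i / (1 - X i)) $ N)"
    by (simp add: augmented_igusa_def fps_sum_nth)
  also have "\<dots> = (\<Sum>I\<in>Pow {0..n}. \<Sum>e\<in>exponents d I N. gauss_multinomial Y n I * (\<Prod>i\<in>I. c i ^ e i))"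
  proof (rule sum.cong[OF refl])
    fix I assume I: "I \<in> Pow {0..n}"
    have "(\<Prod>i\<in>I. X i / (1 - X i)) = (\<Prod>i\<in>I. monomial_fps (c i) (d i) / (1 - monomial_fps (c i) (d i)))"
      using I X by (intro prod.cong) auto
    moreover have "finite I" "\<forall>i\<in>I. d i > 0" using I d finite_subset by auto
    ultimately show "gauss_multinomial Y n I * (\<Prod>i\<in>I. X i / (1 - X i)) $ N =
        (\<Sum>e\<in>exponents d I N. gauss_multinomial Y n I * (\<Prod>i\<in>I. c i ^ e i))"
      using prod_geometric_fps_nth[of I d c N] by (simp add: sum_distrib_left)
  qed
  also have "\<dots> = (\<Sum>(I, e)\<in>(SIGMA I:Pow {0..n}. exponents d I N).
      gauss_multinomial Y n I * (\<Prod>i\<in>I. c i ^ e i))"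
  proof (rule sum.Sigma)
    show "\<forall>I\<in>Pow {0..n}. finite (exponents d I N)"
      using d by (auto intro!: finite_exponents intro: finite_subset)
  qed simp
  also have "\<dots> = (\<Sum>e\<in>exponents_within d {0..n} N.
      gauss_multinomial Y n {i. 0 < e i} * (\<Prod>i\<in>{0..n}. c i ^ e i))"
  proof (rule sum.reindex_bij_witness[where i = "\<lambda>e. ({i. 0 < e i}, e)" and j = snd])
    fix t assume t: "t \<in> (SIGMA I:Pow {0..n}. exponents d I N)"
    obtain I e where Ie: "t = (I, e)" "I \<subseteq> {0..n}" "e \<in> exponents d I N" using t by auto
    have e: "I = {i. 0 < e i}" "(\<Sum>i\<in>I. d i * e i) = N" using Ie(3) by (auto simp: exponents_def)
    show "({i. 0 < snd t i}, snd t) = t" using e by (simp add: Ie(1))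
    have "(\<Sum>i\<in>{0..n}. d i * e i) = (\<Sum>i\<in>I. d i * e i)"
      using Ie(2) e(1) by (intro sum.mono_neutral_right) auto
    then show "snd t \<in> exponents_within d {0..n} N"
      using e Ie(2) by (auto simp: Ie(1) exponents_within_def)
    have "(\<Prod>i\<in>{0..n}. c i ^ e i) = (\<Prod>i\<in>I. c i ^ e i)"
      using Ie(2) e(1) by (intro prod.mono_neutral_right) auto
    then show "gauss_multinomial Y n {i. 0 < snd t i} * (\<Prod>i\<in>{0..n}. c i ^ snd t i) =
        (case t of (I, e) \<Rightarrow> gauss_multinomial Y n I * (\<Prod>i\<in>I. c i ^ e i))"
      using e(1) by (simp add: Ie(1))
  next
    fix e assume e: "e \<in> exponents_within d {0..n} N"
    have sub: "{i. 0 < e i} \<subseteq> {0..n}"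
    proof
      fix i assume "i \<in> {i. 0 < e i}"
      then show "i \<in> {0..n}" using e by (cases "i \<in> {0..n}") (auto simp: exponents_within_def)
    qed
    have "(\<Sum>i\<in>{0..n}. d i * e i) = (\<Sum>i\<in>{i. 0 < e i}. d i * e i)"
      using sub by (intro sum.mono_neutral_right) auto
    then show "({i. 0 < e i}, e) \<in> (SIGMA I:Pow {0..n}. exponents d I N)"
      using e sub by (simp add: exponents_within_def exponents_def)
    show "snd ({i. 0 < e i}, e) = e" by simp
  qed
  finally show ?thesis .
qed

section \<open>Gaussian multinomials\<close>

lemma multiplicity_factorials_block:
  assumes "v \<notin># \<tau>"
  shows "multiplicity_factorials Y (\<tau> + replicate_mset k v) = multiplicity_factorials Y \<tau> * gauss_fact Y k"
proof (induction k)
  case (Suc k)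
  have "count (\<tau> + replicate_mset k v) v = k" using assms by (simp add: not_in_iff)
  then show ?case
    using multiplicity_factorials_add[of Y v "\<tau> + replicate_mset k v"] Suc
    by (simp add: gauss_fact_Suc mult.assoc)
qed (simp add: gauss_fact_0)

lemma gauss_multinomial_remove_Max:
  assumes "finite I" "I \<noteq> {}"
  shows "gauss_multinomial Y n I = gauss_binomial Y n (Max I) * gauss_multinomial Y (Max I) (I - {Max I})"
proof -
  define i where "i = Max I"
  define I' where "I' = I - {i}"
  have iI: "i \<in> I" unfolding i_def by (rule Max_in[OF assms])
  have "j \<le> i" if "j \<in> I" for j unfolding i_def using assms(1) that by (rule Max_ge)
  then have I: "finite I'" "i \<notin> I'" "I = insert i I'" "\<forall>j\<in>I'. j < i"
    using assms(1) iI by (auto simp: I'_def le_neq_implies_less)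
  define xs where "xs = sorted_list_of_set I'"
  have xs: "sorted_list_of_set I = xs @ [i]"
  proof -
    have "sorted (xs @ [i])" "distinct (xs @ [i])" "set (xs @ [i]) = I"
      using I by (auto simp: xs_def sorted_append)
    then show ?thesis using sorted_list_of_set.idem_if_sorted_distinct by metis
  qed
  have len: "length xs = card I'" by (simp add: xs_def)
  have card: "card I = Suc (card I')" using I by simp
  have "gauss_multinomial Y n I = (\<Prod>j<Suc (card I').
      gauss_binomial Y ((xs @ [i, n]) ! Suc j) ((xs @ [i, n]) ! j))"
    by (simp add: gauss_multinomial_def xs card Let_def)
  also have "\<dots> = (\<Prod>j<card I'. gauss_binomial Y ((xs @ [i, n]) ! Suc j) ((xs @ [i, n]) ! j)) *
      gauss_binomial Y n i"
    by (simp add: nth_append len)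
  also have "(\<Prod>j<card I'. gauss_binomial Y ((xs @ [i, n]) ! Suc j) ((xs @ [i, n]) ! j)) =
      (\<Prod>j<card I'. gauss_binomial Y ((xs @ [i]) ! Suc j) ((xs @ [i]) ! j))"
    by (intro prod.cong refl) (auto simp: nth_append len)
  also have "\<dots> = gauss_multinomial Y i I'"
    by (simp add: gauss_multinomial_def xs_def Let_def)
  finally show ?thesis by (simp add: i_def I'_def mult.commute)
qed

lemma map_upt_const: "(\<And>j. a \<le> j \<Longrightarrow> j < b \<Longrightarrow> f j = c) \<Longrightarrow> map f [a..<b] = replicate (b - a) c"
  by (rule replicate_eqI) auto

text \<open>
  A Gaussian multinomial is a quotient of Gaussian factorials: the sizes of the blocks into which
  \<open>I\<close> cuts \<open>{1..n}\<close> are the multiplicities of any decreasing sequence with descents at \<open>I\<close>.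
\<close>

lemma gauss_multinomial_eq:
  assumes fact: "\<And>m. gauss_fact Y m \<noteq> 0"
    and "finite I" "I \<subseteq> {0..n}"
    and "\<And>j. Suc j < n \<Longrightarrow> (f (Suc j) :: nat) \<le> f j"
    and "\<And>j. Suc j < n \<Longrightarrow> Suc j \<in> I \<longleftrightarrow> f (Suc j) < f j"
  shows "gauss_multinomial Y n I * multiplicity_factorials Y (mset (map f [0..<n])) = gauss_fact Y n"
  using assms(2-)
proof (induction "card I" arbitrary: I n)
  case 0
  then have I: "I = {}" by simp
  have const: "f j = f 0" if "j < n" for j
    using that
  proof (induction j)
    case (Suc j)
    then show ?case using 0(4)[of j] 0(5)[of j] I by force
  qed simp
  have "map f [0..<n] = replicate (n - 0) (f 0)" by (intro map_upt_const const)
  then have "map f [0..<n] = replicate n (f 0)" by simp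
  then have "mset (map f [0..<n]) = {#} + replicate_mset n (f 0)" by (metis add_0 mset_replicate)
  then show ?case
    using multiplicity_factorials_block[of "f 0" "{#}" Y n]
    by (simp add: I gauss_multinomial_def multiplicity_factorials_def)
next
  case (Suc k)
  then have ne: "I \<noteq> {}" by auto
  define i where "i = Max I"
  have iI: "i \<in> I" and i: "i \<le> n" and Imax: "\<And>j. j \<in> I \<Longrightarrow> j \<le> i"
    using Max_in[OF Suc.prems(1) ne] Suc.prems(2) Max_ge[OF Suc.prems(1)] by (auto simp: i_def)
  have IH: "gauss_multinomial Y i (I - {i}) * multiplicity_factorials Y (mset (map f [0..<i])) = gauss_fact Y i"
  proof (rule Suc.hyps(1))
    show "k = card (I - {i})" using Suc.hyps(2) iI Suc.prems(1) by simp
    show "I - {i} \<subseteq> {0..i}" using Imax by auto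
    show "Suc j \<in> I - {i} \<longleftrightarrow> f (Suc j) < f j" if "Suc j < i" for j
      using Suc.prems(4)[of j] that i by auto
  qed (use Suc.prems i in auto)
  have decreasing: "f j' \<le> f j" if "j \<le> j'" "j' < n" for j j'
    using that
  proof (induction j' rule: dec_induct)
    case (step j')
    then show ?case using Suc.prems(3)[of j'] by simp
  qed simp
  have const: "f j = f i" if "i \<le> j" "j < n" for j
    using that
  proof (induction j rule: dec_induct)
    case (step j)
    have "Suc j \<notin> I" using Imax[of "Suc j"] step.hyps by auto
    then show ?case using step Suc.prems(3)[of j] Suc.prems(4)[of j] by force
  qed simp
  have split: "mset (map f [0..<n]) = mset (map f [0..<i]) + replicate_mset (n - i) (f i)"
  proof -
    have "[0..<n] = [0..<i] @ [i..<n]" using i by (metis le_add_diff_inverse upt_add_eq_append zero_le)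
    moreover have "map f [i..<n] = replicate (n - i) (f i)"
      by (intro map_upt_const const)
    ultimately show ?thesis by (metis map_append mset_append mset_replicate)
  qed
  have "multiplicity_factorials Y (mset (map f [0..<n])) =
      multiplicity_factorials Y (mset (map f [0..<i])) * gauss_fact Y (n - i)"
  proof (cases "i = n")
    case True
    then show ?thesis by (simp add: gauss_fact_0)
  next
    case False
    have "f i < f j" if j: "j < i" for j
    proof -
      obtain i' where i': "i = Suc i'" using j by (cases i) auto
      have "f i < f i'" using Suc.prems(4)[of i'] iI i False by (simp add: i')
      also have "f i' \<le> f j" using decreasing[of j i'] j i i' by simp
      finally show ?thesis .
    qed
    then have "f i \<notin># mset (map f [0..<i])" by force
    then show ?thesis unfolding split by (rule multiplicity_factorials_block)
  qed
  then have "gauss_multinomial Y n I * multiplicity_factorials Y (mset (map f [0..<n])) =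
      gauss_binomial Y n i * gauss_fact Y (n - i) *
      (gauss_multinomial Y i (I - {i}) * multiplicity_factorials Y (mset (map f [0..<i])))"
    using gauss_multinomial_remove_Max[OF Suc.prems(1) ne, of Y n] by (simp add: i_def ac_simps)
  also have "\<dots> = gauss_fact Y n" unfolding IH gauss_binomial_def using fact by simp
  finally show ?case .
qed

section \<open>The index set as a set of paths\<close>

text \<open>
  The segment of length \<open>k\<close> of a path, for the steps \<open>i, \<dots>, i + k - 1\<close> and the value \<open>v\<close> before
  step \<open>i\<close>.
\<close>

definition paths :: "nat \<Rightarrow> nat \<Rightarrow> nat \<Rightarrow> (nat \<Rightarrow> nat) set" where
  "paths i v k = {w. (\<forall>j. j \<notin> {i..<i + k} \<longrightarrow> w j = 0) \<and>
    (\<forall>j\<in>{i..<i + k}. w j = (if j = i then v else w (j - 1)) \<or>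
      w j + (if j = i then v else w (j - 1)) = 2 * j - 1)}"

definition path_weight :: "'a::field \<Rightarrow> nat \<Rightarrow> nat list \<Rightarrow> (nat \<Rightarrow> nat) \<Rightarrow> 'a" where
  "path_weight Q i ls w = (\<Prod>j<length ls.
    1 / (1 - Q powi (2 * int (i + j) - 1 - 2 * int (w (i + j)))) * Q ^ (ls ! j * w (i + j)))"

lemma paths_zero: "paths i v 0 = {\<lambda>_. 0}"
  by (auto simp: paths_def fun_eq_iff)

text \<open>
  The bound on \<open>v\<close> keeps the subtraction from truncating; it is inherited by both branches.
\<close>

lemma paths_Suc:
  assumes "v \<le> 2 * i - 1"
  shows "paths i v (Suc k) =
    (\<lambda>w. w(i := v)) ` paths (Suc i) v k \<union> (\<lambda>w. w(i := 2 * i - 1 - v)) ` paths (Suc i) (2 * i - 1 - v) k"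
proof -
  have into: "w(i := a) \<in> paths i v (Suc k)"
    if w: "w \<in> paths (Suc i) a k" and a: "a = v \<or> a = 2 * i - 1 - v" for w a
  proof -
    have step: "(w(i := a)) j = (if j = i then v else (w(i := a)) (j - 1)) \<or>
        (w(i := a)) j + (if j = i then v else (w(i := a)) (j - 1)) = 2 * j - 1"
      if j: "j \<in> {i..<i + Suc k}" for j
    proof (cases "j = i")
      case True
      then show ?thesis using a assms by auto
    next
      case False
      then have "j \<in> {Suc i..<Suc i + k}" using j by auto
      then have "w j = (if j = Suc i then a else w (j - 1)) \<or>
          w j + (if j = Suc i then a else w (j - 1)) = 2 * j - 1"
        using w unfolding paths_def by blast
      moreover have "(w(i := a)) (j - 1) = (if j = Suc i then a else w (j - 1))"
        using False j by auto
      ultimately show ?thesis using False by simp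
    qed
    have "(w(i := a)) j = 0" if "j \<notin> {i..<i + Suc k}" for j
      using w that by (auto simp: paths_def)
    then show ?thesis using step unfolding paths_def by blast
  qed
  show ?thesis
  proof (intro equalityI subsetI)
    fix w assume w: "w \<in> paths i v (Suc k)"
    define a where "a = w i"
    have "w i = v \<or> w i + v = 2 * i - 1"
    proof -
      have "i \<in> {i..<i + Suc k}" by simp
      then show ?thesis using w unfolding paths_def by force
    qed
    then have a: "a = v \<or> a = 2 * i - 1 - v" by (auto simp: a_def)
    define w' where "w' = w(i := 0)"
    have "w' \<in> paths (Suc i) a k"
    proof -
      have "w' j = (if j = Suc i then a else w' (j - 1)) \<or>
          w' j + (if j = Suc i then a else w' (j - 1)) = 2 * j - 1"
        if j: "j \<in> {Suc i..<Suc i + k}" for j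
      proof -
        have "j \<in> {i..<i + Suc k}" "j \<noteq> i" using j by auto
        then have "w j = (if j = i then v else w (j - 1)) \<or>
            w j + (if j = i then v else w (j - 1)) = 2 * j - 1"
          using w unfolding paths_def by blast
        then have "w j = w (j - 1) \<or> w j + w (j - 1) = 2 * j - 1" using \<open>j \<noteq> i\<close> by simp
        moreover have "(if j = Suc i then a else w' (j - 1)) = w (j - 1)"
          using j by (auto simp: w'_def a_def)
        moreover have "w' j = w j" using \<open>j \<noteq> i\<close> by (simp add: w'_def)
        ultimately show ?thesis by simp
      qed
      moreover have "w' j = 0" if "j \<notin> {Suc i..<Suc i + k}" for j
        using w that by (cases "j = i") (auto simp: w'_def paths_def)
      ultimately show ?thesis unfolding paths_def by blast
    qed
    moreover have "w = w'(i := a)" by (simp add: w'_def a_def)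
    ultimately show "w \<in> (\<lambda>w. w(i := v)) ` paths (Suc i) v k \<union>
        (\<lambda>w. w(i := 2 * i - 1 - v)) ` paths (Suc i) (2 * i - 1 - v) k"
      using a by blast
  qed (use into in blast)
qed

lemma finite_paths: "v \<le> 2 * i - 1 \<Longrightarrow> finite (paths i v k)"
proof (induction k arbitrary: i v)
  case (Suc k)
  have "v \<le> 2 * Suc i - 1" "2 * i - 1 - v \<le> 2 * Suc i - 1" using Suc.prems by auto
  then show ?case unfolding paths_Suc[OF Suc.prems] using Suc.IH by blast
qed (simp add: paths_zero)

lemma sum_paths:
  fixes Q :: "'a::field"
  assumes Q: "Q \<noteq> 0"
  shows "v \<le> 2 * i - 1 \<Longrightarrow> i > 0 \<Longrightarrow> (\<Sum>w\<in>paths i v (length ls). path_weight Q i ls w) = path_sum Q i (int v) ls"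
proof (induction ls arbitrary: i v)
  case Nil
  then show ?case by (simp add: paths_zero path_weight_def)
next
  case (Cons l ls)
  define u where "u = 2 * i - 1 - v"
  have u: "int u = 2 * int i - 1 - int v" using Cons.prems by (simp add: u_def)
  have uv: "u \<noteq> v"
  proof
    assume "u = v"
    then have "2 * int v = 2 * int i - 1" using u by simp
    then show False by presburger
  qed
  have le: "v \<le> 2 * Suc i - 1" "u \<le> 2 * Suc i - 1" using Cons.prems by (auto simp: u_def)
  have weight: "path_weight Q i (l # ls) (w(i := a)) =
      Q powi (int l * int a) / (1 - Q powi (2 * int i - 1 - 2 * int a)) * path_weight Q (Suc i) ls w" for w a
  proof -
    have "path_weight Q i (l # ls) (w(i := a)) =
        1 / (1 - Q powi (2 * int i - 1 - 2 * int a)) * Q ^ (l * a) * path_weight Q (Suc i) ls w"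
      unfolding path_weight_def length_Cons prod.lessThan_Suc_shift
      by (simp cong: prod.cong)
    moreover have "Q ^ (l * a) = Q powi (int l * int a)" by (simp flip: of_nat_mult)
    ultimately show ?thesis by simp
  qed
  have inj: "inj_on (\<lambda>w. w(i := a)) (paths (Suc i) a k)" for a k
  proof (rule inj_onI)
    fix w w' assume w: "w \<in> paths (Suc i) a k" "w' \<in> paths (Suc i) a k" "w(i := a) = w'(i := a)"
    have "w i = 0" "w' i = 0" using w(1,2) by (auto simp: paths_def)
    then show "w = w'" using w(3) by (metis fun_upd_triv fun_upd_upd)
  qed
  have part: "(\<Sum>w\<in>(\<lambda>w. w(i := a)) ` paths (Suc i) a (length ls). path_weight Q i (l # ls) w) =
      Q powi (int l * int a) / (1 - Q powi (2 * int i - 1 - 2 * int a)) * path_sum Q (Suc i) (int a) ls"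
    if "a \<le> 2 * Suc i - 1" for a
    unfolding sum.reindex[OF inj] o_def weight sum_distrib_left[symmetric] using Cons.IH[OF that] by simp
  have "(\<Sum>w\<in>paths i v (length (l # ls)). path_weight Q i (l # ls) w) =
      (\<Sum>w\<in>(\<lambda>w. w(i := v)) ` paths (Suc i) v (length ls). path_weight Q i (l # ls) w) +
      (\<Sum>w\<in>(\<lambda>w. w(i := u)) ` paths (Suc i) u (length ls). path_weight Q i (l # ls) w)"
    unfolding length_Cons paths_Suc[OF Cons.prems(1)] u_def[symmetric]
  proof (rule sum.union_disjoint)
    show "(\<lambda>w. w(i := v)) ` paths (Suc i) v (length ls) \<inter> (\<lambda>w. w(i := u)) ` paths (Suc i) u (length ls) = {}"
      using uv by (auto dest: fun_cong[where x = i])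
  qed (use finite_paths le in auto)
  also have "\<dots> = path_sum Q i (int v) (l # ls)"
    unfolding part[OF le(1)] part[OF le(2)] by (simp add: u Let_def)
  finally show ?case .
qed

lemma heis_W_eq_paths: "heis_W n = paths 1 0 n"
proof -
  have "w \<in> heis_W n \<longleftrightarrow> w \<in> paths 1 0 n" for w
  proof -
    have range: "{1..<1 + n} = {1..n}" by auto
    show ?thesis
      unfolding heis_W_def paths_def range mem_Collect_eq
    proof (intro conj_cong refl)
      assume "\<forall>i. i \<notin> {1..n} \<longrightarrow> w i = 0"
      then have eq: "(if j = 1 then 0 else w (j - 1)) = w (j - 1)" for j by auto
      show "(\<forall>i\<in>{1..n}. w i = w (i - 1) \<or> w i + w (i - 1) = 2 * i - 1) \<longleftrightarrow>
          (\<forall>j\<in>{1..n}. w j = (if j = 1 then 0 else w (j - 1)) \<or>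
            w j + (if j = 1 then 0 else w (j - 1)) = 2 * j - 1)"
        unfolding eq ..
    qed
  qed
  then show ?thesis by blast
qed

section \<open>Comparison of coefficients\<close>

lemma orbit_exponent_nth:
  "orbit_exponent ls = (\<Sum>j<length ls. 2 * (int (length ls) - 1 - 2 * int j) * int (ls ! j))"
proof (induction ls)
  case (Cons l ls)
  have "(\<Sum>j<length ls. 2 * (int (length ls) - 2 - 2 * int j) * int (ls ! j)) =
      (\<Sum>j<length ls. 2 * (int (length ls) - 1 - 2 * int j) * int (ls ! j) - 2 * int (ls ! j))"
    by (intro sum.cong) (auto simp: algebra_simps)
  also have "\<dots> = orbit_exponent ls - 2 * int (sum_list ls)"
    unfolding Cons by (simp add: sum_subtractf sum_list_sum_nth atLeast0LessThan sum_distrib_left)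
  finally have shifted: "(\<Sum>j<length ls. 2 * (int (length ls) - 2 - 2 * int j) * int (ls ! j)) =
      orbit_exponent ls - 2 * int (sum_list ls)" .
  have "(\<Sum>j<length ls. 2 * (int (Suc (length ls)) - 1 - 2 * int (Suc j)) * int ((l # ls) ! Suc j)) =
      (\<Sum>j<length ls. 2 * (int (length ls) - 2 - 2 * int j) * int (ls ! j))"
    by (intro sum.cong) auto
  then show ?case
    unfolding orbit_exponent.simps length_Cons sum.lessThan_Suc_shift shifted by simp
qed simp

text \<open>
  An exponent vector \<open>e\<close> encodes the decreasing list with differences \<open>e 1, \<dots>, e (n - 1)\<close> and last
  entry \<open>e n + e 0\<close>.
\<close>

definition tail_sum :: "nat \<Rightarrow> (nat \<Rightarrow> nat) \<Rightarrow> nat \<Rightarrow> nat" where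
  "tail_sum n e j = e 0 + (\<Sum>k=Suc j..n. e k)"

definition tail_sums :: "nat \<Rightarrow> (nat \<Rightarrow> nat) \<Rightarrow> nat list" where
  "tail_sums n e = map (tail_sum n e) [0..<n]"

lemma length_tail_sums [simp]: "length (tail_sums n e) = n"
  by (simp add: tail_sums_def)

lemma nth_tail_sums: "j < n \<Longrightarrow> tail_sums n e ! j = tail_sum n e j"
  by (simp add: tail_sums_def)

lemma tail_sum_step: "j < n \<Longrightarrow> tail_sum n e j = e (Suc j) + tail_sum n e (Suc j)"
  by (simp add: tail_sum_def sum.atLeast_Suc_atMost)

lemma tail_sum_antimono: "i \<le> j \<Longrightarrow> tail_sum n e j \<le> tail_sum n e i"
  unfolding tail_sum_def by (intro add_left_mono sum_mono2) auto

lemma sum_times_tail_sums: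
  fixes a :: "nat \<Rightarrow> 'a::comm_semiring_1"
  shows "(\<Sum>j<n. a j * of_nat (tail_sums n e ! j)) =
    (\<Sum>j<n. a j) * of_nat (e 0) + (\<Sum>k=1..n. (\<Sum>j<k. a j) * of_nat (e k))"
proof -
  have "(\<Sum>j<n. a j * of_nat (tail_sums n e ! j)) =
      (\<Sum>j<n. a j * of_nat (e 0) + a j * (\<Sum>k=Suc j..n. of_nat (e k)))"
    by (intro sum.cong) (auto simp: nth_tail_sums tail_sum_def distrib_left)
  also have "\<dots> = (\<Sum>j<n. a j) * of_nat (e 0) + (\<Sum>j<n. a j * (\<Sum>k=Suc j..n. of_nat (e k)))"
    by (simp add: sum.distrib sum_distrib_right)
  finally show ?thesis unfolding sum_times_tails .
qed

lemma orbit_exponent_tail_sums: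
  "orbit_exponent (tail_sums n e) = int (\<Sum>k=1..n. 2 * k * (n - k) * e k)"
proof -
  have partial: "(\<Sum>j<k. 2 * (int n - 1 - 2 * int j)) = 2 * int k * (int n - int k)" for k
    by (induction k) (auto simp: algebra_simps)
  have "orbit_exponent (tail_sums n e) =
      (\<Sum>j<n. 2 * (int n - 1 - 2 * int j)) * int (e 0) +
      (\<Sum>k=1..n. (\<Sum>j<k. 2 * (int n - 1 - 2 * int j)) * int (e k))"
    unfolding orbit_exponent_nth length_tail_sums by (rule sum_times_tail_sums)
  also have "\<dots> = (\<Sum>k=1..n. 2 * int k * (int n - int k) * int (e k))"
    unfolding partial by simp
  also have "\<dots> = int (\<Sum>k=1..n. 2 * k * (n - k) * e k)"
    by (simp add: of_nat_diff)
  finally show ?thesis .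
qed

text \<open>The degree in \<open>T\<close> of the \<open>i\<close>-th argument of the Igusa function.\<close>

definition igusa_degree :: "nat \<Rightarrow> nat \<Rightarrow> nat" where
  "igusa_degree n i = (if i = 0 then Suc n else i)"

lemma weighted_degree:
  "(\<Sum>i\<in>{0..n}. igusa_degree n i * e i) = e 0 + sum_list (tail_sums n e)"
proof -
  have "sum_list (tail_sums n e) = (\<Sum>j<n. 1 * of_nat (tail_sums n e ! j))"
    by (simp add: sum_list_sum_nth atLeast0LessThan)
  also have "\<dots> = n * e 0 + (\<Sum>k=1..n. k * e k)"
    unfolding sum_times_tail_sums by simp
  finally have "e 0 + sum_list (tail_sums n e) = Suc n * e 0 + (\<Sum>k=1..n. k * e k)" by simp
  moreover have "(\<Sum>i\<in>{0..n}. igusa_degree n i * e i) = Suc n * e 0 + (\<Sum>i=1..n. igusa_degree n i * e i)"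
    by (simp add: sum.atLeast_Suc_atMost igusa_degree_def)
  moreover have "(\<Sum>i=1..n. igusa_degree n i * e i) = (\<Sum>k=1..n. k * e k)"
    by (intro sum.cong) (auto simp: igusa_degree_def)
  ultimately show ?thesis by simp
qed

lemma telescope_differences:
  fixes L :: "nat \<Rightarrow> nat"
  assumes "j \<le> n" "\<And>k. j \<le> k \<Longrightarrow> k < n \<Longrightarrow> L (Suc k) \<le> L k"
  shows "L n + (\<Sum>k=Suc j..n. L (k - 1) - L k) = L j"
  using assms
proof (induction j rule: inc_induct)
  case (step j)
  have "(\<Sum>k=Suc j..n. L (k - 1) - L k) = (L j - L (Suc j)) + (\<Sum>k=Suc (Suc j)..n. L (k - 1) - L k)"
    using step.hyps by (simp add: sum.atLeast_Suc_atMost)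
  moreover have "L (Suc j) \<le> L j" using step.hyps step.prems by simp
  moreover have "L n + (\<Sum>k=Suc (Suc j)..n. L (k - 1) - L k) = L (Suc j)"
    using step.prems by (intro step.IH) auto
  ultimately show ?case by simp
qed simp

lemma bij_betw_exponents_subalgebra_types:
  "bij_betw (\<lambda>e. (e 0, tail_sums n e)) (exponents_within (igusa_degree n) {0..n} N) (subalgebra_types n N)"
proof -
  define L where "L = (\<lambda>(m::nat) ls k. if k < n then ls ! k else m)"
  define E where "E = (\<lambda>(m, ls) i. if i = 0 then m else if i \<le> n then L m ls (i - 1) - L m ls i else 0)"
  show ?thesis
  proof (rule bij_betw_byWitness[where f' = E])
    show "\<forall>e\<in>exponents_within (igusa_degree n) {0..n} N. E (e 0, tail_sums n e) = e"
    proof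
      fix e assume e: "e \<in> exponents_within (igusa_degree n) {0..n} N"
      have L: "L (e 0) (tail_sums n e) k = tail_sum n e k" if "k \<le> n" for k
        using that by (auto simp: L_def nth_tail_sums tail_sum_def)
      have "E (e 0, tail_sums n e) i = e i" for i
      proof (cases "1 \<le> i \<and> i \<le> n")
        case True
        then obtain k where k: "i = Suc k" "k < n" by (cases i) auto
        then show ?thesis using tail_sum_step[of k n e] L[of k] L[of i] by (simp add: E_def)
      next
        case False
        then show ?thesis using e by (auto simp: E_def exponents_within_def not_le)
      qed
      then show "E (e 0, tail_sums n e) = e" ..
    qed
    have E_types: "(E (m, ls) 0, tail_sums n (E (m, ls))) = (m, ls)"
      if t: "(m, ls) \<in> subalgebra_types n N" for m ls
    proof -
      have ls: "sorted_wrt (\<ge>) ls" "length ls = n" "\<forall>l\<in>set ls. m \<le> l"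
        using t by (auto simp: subalgebra_types_def)
      have dec: "L m ls (Suc k) \<le> L m ls k" if "k < n" for k
      proof (cases "Suc k < n")
        case True
        then show ?thesis using ls(1,2) by (simp add: L_def sorted_wrt_iff_nth_less)
      next
        case False
        then show ?thesis using ls(2,3) that by (simp add: L_def)
      qed
      have "tail_sum n (E (m, ls)) j = ls ! j" if j: "j < n" for j
      proof -
        have "tail_sum n (E (m, ls)) j = L m ls n + (\<Sum>k=Suc j..n. L m ls (k - 1) - L m ls k)"
          by (simp add: tail_sum_def E_def L_def)
        also have "\<dots> = L m ls j" using j dec by (intro telescope_differences) auto
        finally show ?thesis using j by (simp add: L_def)
      qed
      then have "tail_sums n (E (m, ls)) = ls" using ls(2) by (intro nth_equalityI) (auto simp: nth_tail_sums)
      then show ?thesis by (simp add: E_def)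
    qed
    then show "\<forall>t\<in>subalgebra_types n N. (E t 0, tail_sums n (E t)) = t" by auto
    show "(\<lambda>e. (e 0, tail_sums n e)) ` exponents_within (igusa_degree n) {0..n} N \<subseteq> subalgebra_types n N"
    proof
      fix t assume "t \<in> (\<lambda>e. (e 0, tail_sums n e)) ` exponents_within (igusa_degree n) {0..n} N"
      then obtain e where e: "t = (e 0, tail_sums n e)" "e \<in> exponents_within (igusa_degree n) {0..n} N" by blast
      have "sorted_wrt (\<ge>) (tail_sums n e)"
        using tail_sum_antimono by (auto simp: sorted_wrt_iff_nth_less nth_tail_sums)
      moreover have "\<forall>l\<in>set (tail_sums n e). e 0 \<le> l"
        by (auto simp: tail_sums_def tail_sum_def)
      moreover have "e 0 + sum_list (tail_sums n e) = N"
        using e(2) weighted_degree[of n e] by (simp add: exponents_within_def)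
      ultimately show "t \<in> subalgebra_types n N" by (simp add: e(1) subalgebra_types_def)
    qed
    show "E ` subalgebra_types n N \<subseteq> exponents_within (igusa_degree n) {0..n} N"
    proof
      fix e assume "e \<in> E ` subalgebra_types n N"
      then obtain m ls where t: "e = E (m, ls)" "(m, ls) \<in> subalgebra_types n N" by auto
      have "e 0 + sum_list (tail_sums n e) = N"
        using E_types[OF t(2)] t by (simp add: subalgebra_types_def)
      then have "(\<Sum>i\<in>{0..n}. igusa_degree n i * e i) = N" unfolding weighted_degree .
      moreover have "\<forall>i. i \<notin> {0..n} \<longrightarrow> e i = 0" by (auto simp: t(1) E_def)
      ultimately show "e \<in> exponents_within (igusa_degree n) {0..n} N" by (simp add: exponents_within_def)
    qed
  qed
qed

definition igusa_coeff :: "'a::field \<Rightarrow> nat \<Rightarrow> (nat \<Rightarrow> nat) \<Rightarrow> nat \<Rightarrow> 'a" where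
  "igusa_coeff Q n w i = (if i = 0 then Q ^ (2 * n + (\<Sum>j=1..n. w j))
    else Q ^ ((\<Sum>j=1..i. w j) + 2 * i * (n - i)))"

lemma heis_X_eq_monomial:
  assumes "n \<ge> 1"
  shows "heis_X q n w i = monomial_fps (igusa_coeff (of_nat q) n w i) (igusa_degree n i)"
proof (cases "i = 0")
  case True
  have "heis_X q n w 0 =
      fps_const (of_nat q ^ (2 * n) * of_nat q ^ (\<Sum>j=1..n. w j)) * (fps_X * fps_X ^ n)"
    by (simp add: heis_X_def Let_def flip: fps_const_mult)
  then show ?thesis by (simp add: True monomial_fps_def igusa_coeff_def igusa_degree_def power_add)
next
  case False
  then show ?thesis by (simp add: heis_X_def monomial_fps_def igusa_coeff_def igusa_degree_def)
qed

text \<open>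
  The exponent of \<open>Q\<close> is linear in \<open>e\<close>. Summation by parts makes it linear in the list, where the part
  that depends on \<open>w\<close> separates from the rest.
\<close>

lemma prod_igusa_coeff:
  fixes Q :: "'a::field"
  assumes "Q \<noteq> 0"
  shows "(\<Prod>i\<in>{0..n}. igusa_coeff Q n w i ^ e i) =
    Q ^ (2 * n * e 0) * Q powi orbit_exponent (tail_sums n e) * (\<Prod>j<n. Q ^ (tail_sums n e ! j * w (Suc j)))"
proof -
  have shift: "(\<Sum>j<k. w (Suc j)) = (\<Sum>j=1..k. w j)" for k
    by (simp add: sum.atLeast1_atMost_eq)
  have "(\<Sum>j<n. tail_sums n e ! j * w (Suc j)) = (\<Sum>j<n. w (Suc j) * of_nat (tail_sums n e ! j))"
    by (intro sum.cong) auto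
  also have "\<dots> = (\<Sum>j=1..n. w j) * e 0 + (\<Sum>k=1..n. (\<Sum>j=1..k. w j) * e k)"
    unfolding sum_times_tail_sums shift by simp
  finally have w: "(\<Sum>j<n. tail_sums n e ! j * w (Suc j)) =
      (\<Sum>j=1..n. w j) * e 0 + (\<Sum>k=1..n. (\<Sum>j=1..k. w j) * e k)" .
  have "(\<Prod>i\<in>{0..n}. igusa_coeff Q n w i ^ e i) =
      igusa_coeff Q n w 0 ^ e 0 * (\<Prod>i=1..n. igusa_coeff Q n w i ^ e i)"
    by (simp add: prod.atLeast_Suc_atMost)
  also have "(\<Prod>i=1..n. igusa_coeff Q n w i ^ e i) =
      (\<Prod>i=1..n. Q ^ ((\<Sum>j=1..i. w j) * e i + 2 * i * (n - i) * e i))"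
    by (intro prod.cong) (auto simp: igusa_coeff_def add_mult_distrib simp flip: power_mult)
  also have "\<dots> = Q ^ (\<Sum>i=1..n. (\<Sum>j=1..i. w j) * e i + 2 * i * (n - i) * e i)"
    by (simp only: power_sum)
  also have "igusa_coeff Q n w 0 ^ e 0 = Q ^ (2 * n * e 0 + (\<Sum>j=1..n. w j) * e 0)"
    by (simp add: igusa_coeff_def add_mult_distrib flip: power_mult)
  also have "Q ^ (2 * n * e 0 + (\<Sum>j=1..n. w j) * e 0) *
      Q ^ (\<Sum>i=1..n. (\<Sum>j=1..i. w j) * e i + 2 * i * (n - i) * e i) =
      Q ^ (2 * n * e 0) * Q ^ (\<Sum>i=1..n. 2 * i * (n - i) * e i) *
      Q ^ (\<Sum>j<n. tail_sums n e ! j * w (Suc j))"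
    unfolding w sum.distrib by (simp only: power_add ac_simps)
  finally show ?thesis
    by (simp only: orbit_exponent_tail_sums power_int_of_nat power_sum)
qed

text \<open>
  The support of \<open>e\<close> between \<open>1\<close> and \<open>n - 1\<close> is the set of descents of the list. Whether \<open>0\<close> or
  \<open>n\<close> belongs to it does not affect the multinomial.
\<close>

lemma gauss_multinomial_exponents:
  fixes Q :: "'a::linordered_field"
  assumes Q: "Q > 1" and e: "e \<in> exponents_within d {0..n} N"
  shows "gauss_multinomial (1 / Q ^ 2) n {i. 0 < e i} =
    gauss_fact (1 / Q ^ 2) n / multiplicity_factorials (1 / Q ^ 2) (mset (tail_sums n e))"
proof -
  have sub: "{i. 0 < e i} \<subseteq> {0..n}"
  proof
    fix i assume "i \<in> {i. 0 < e i}"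
    then show "i \<in> {0..n}" using e by (cases "i \<in> {0..n}") (auto simp: exponents_within_def)
  qed
  have "gauss_multinomial (1 / Q ^ 2) n {i. 0 < e i} *
      multiplicity_factorials (1 / Q ^ 2) (mset (map (tail_sum n e) [0..<n])) = gauss_fact (1 / Q ^ 2) n"
  proof (rule gauss_multinomial_eq)
    show "finite {i. 0 < e i}" using sub finite_subset by blast
    show "tail_sum n e (Suc j) \<le> tail_sum n e j" for j by (rule tail_sum_antimono) simp
    show "Suc j \<in> {i. 0 < e i} \<longleftrightarrow> tail_sum n e (Suc j) < tail_sum n e j" if "Suc j < n" for j
      using tail_sum_step[of j n e] that by simp
  qed (use sub gauss_fact_nonzero[OF Q] in auto)
  then show ?thesis
    using multiplicity_factorials_nonzero[OF Q] by (simp add: tail_sums_def nonzero_eq_divide_eq)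
qed

lemma sum_heis_C:
  assumes "q > 0" "length ls = n"
  shows "(\<Sum>w\<in>heis_W n. heis_C q n w * (\<Prod>j<n. of_nat q ^ (ls ! j * w (Suc j)))) =
    path_sum (of_nat q) 1 0 ls"
proof -
  have "heis_C q n w * (\<Prod>j<n. of_nat q ^ (ls ! j * w (Suc j))) = path_weight (of_nat q) 1 ls w" for w
    by (simp add: heis_C_def path_weight_def prod.atLeast1_atMost_eq assms(2) flip: prod.distrib)
  then show ?thesis
    using sum_paths[of "of_nat q :: rat" 0 1 ls] assms by (simp add: heis_W_eq_paths)
qed

text \<open>
  Exchanging the sums over paths and exponent vectors leaves, for each exponent vector, the sum
  over paths attached to the list that it encodes.
\<close>

theorem heis_igusa_nth:
  assumes n: "n \<ge> 1" and q: "q \<ge> 2"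
  shows "(\<Sum>w\<in>heis_W n. fps_const (heis_C q n w) *
      augmented_igusa n (1 / of_nat q ^ 2) (heis_X q n w)) $ N =
    (\<Sum>(m, ls)\<in>subalgebra_types n N.
      orbit_weight (of_nat q) ls * path_sum (of_nat q) 1 0 ls * of_nat q ^ (2 * n * m))"
proof -
  define Q where "Q = (of_nat q :: rat)"
  have Q1: "Q > 1" using q by (simp add: Q_def)
  then have Q0: "Q \<noteq> 0" by auto
  define E where "E = exponents_within (igusa_degree n) {0..n} N"
  define g where "g = (\<lambda>e :: nat \<Rightarrow> nat. gauss_multinomial (1 / Q ^ 2) n {i. 0 < e i})"
  have "(\<Sum>w\<in>heis_W n. fps_const (heis_C q n w) * augmented_igusa n (1 / Q ^ 2) (heis_X q n w)) $ N =
      (\<Sum>w\<in>heis_W n. heis_C q n w * (\<Sum>e\<in>E. g e * (\<Prod>i\<in>{0..n}. igusa_coeff Q n w i ^ e i)))"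
    unfolding fps_sum_nth
  proof (rule sum.cong[OF refl])
    fix w
    have "augmented_igusa n (1 / Q ^ 2) (heis_X q n w) $ N =
        (\<Sum>e\<in>E. g e * (\<Prod>i\<in>{0..n}. igusa_coeff Q n w i ^ e i))"
      unfolding E_def g_def
      by (rule augmented_igusa_nth) (auto simp: igusa_degree_def heis_X_eq_monomial[OF n] Q_def)
    then show "(fps_const (heis_C q n w) * augmented_igusa n (1 / Q ^ 2) (heis_X q n w)) $ N =
        heis_C q n w * (\<Sum>e\<in>E. g e * (\<Prod>i\<in>{0..n}. igusa_coeff Q n w i ^ e i))" by simp
  qed
  also have "\<dots> = (\<Sum>e\<in>E. \<Sum>w\<in>heis_W n. heis_C q n w * (g e * (\<Prod>i\<in>{0..n}. igusa_coeff Q n w i ^ e i)))"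
    unfolding sum_distrib_left by (rule sum.swap)
  also have "\<dots> = (\<Sum>e\<in>E. orbit_weight Q (tail_sums n e) * path_sum Q 1 0 (tail_sums n e) * Q ^ (2 * n * e 0))"
  proof (rule sum.cong[OF refl])
    fix e assume e: "e \<in> E"
    have "(\<Sum>w\<in>heis_W n. heis_C q n w * (g e * (\<Prod>i\<in>{0..n}. igusa_coeff Q n w i ^ e i))) =
        (\<Sum>w\<in>heis_W n. (g e * Q ^ (2 * n * e 0) * Q powi orbit_exponent (tail_sums n e)) *
          (heis_C q n w * (\<Prod>j<n. Q ^ (tail_sums n e ! j * w (Suc j)))))"
      unfolding prod_igusa_coeff[OF Q0] by (intro sum.cong refl) (simp only: ac_simps)
    also have "\<dots> = (g e * Q ^ (2 * n * e 0) * Q powi orbit_exponent (tail_sums n e)) *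
        path_sum Q 1 0 (tail_sums n e)"
      unfolding sum_distrib_left[symmetric] Q_def using q by (subst sum_heis_C) auto
    also have "\<dots> = orbit_weight Q (tail_sums n e) * path_sum Q 1 0 (tail_sums n e) * Q ^ (2 * n * e 0)"
    proof -
      have "g e = gauss_fact (1 / Q ^ 2) n / multiplicity_factorials (1 / Q ^ 2) (mset (tail_sums n e))"
        using gauss_multinomial_exponents[OF Q1] e unfolding g_def E_def by blast
      then show ?thesis by (simp only: orbit_weight_def length_tail_sums ac_simps)
    qed
    finally show "(\<Sum>w\<in>heis_W n. heis_C q n w * (g e * (\<Prod>i\<in>{0..n}. igusa_coeff Q n w i ^ e i))) =
        orbit_weight Q (tail_sums n e) * path_sum Q 1 0 (tail_sums n e) * Q ^ (2 * n * e 0)" .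
  qed
  also have "\<dots> = (\<Sum>(m, ls)\<in>subalgebra_types n N. orbit_weight Q ls * path_sum Q 1 0 ls * Q ^ (2 * n * m))"
    using sum.reindex_bij_betw[OF bij_betw_exponents_subalgebra_types, of
        "\<lambda>(m, ls). orbit_weight Q ls * path_sum Q 1 0 ls * Q ^ (2 * n * m)" n N]
    by (simp add: E_def)
  finally show ?thesis by (simp add: Q_def)
qed

theorem theorem1:
  fixes n q :: nat
  assumes "n \<ge> 1"
    and "compact_dvr TYPE('o::idom)"
    and "q = residue_card TYPE('o)"
  shows "heis_zeta TYPE('o) n =
    (\<Sum>w\<in>heis_W n. fps_const (heis_C q n w) *
       augmented_igusa n (1 / of_nat q ^ 2) (heis_X q n w))"
proof (rule fps_ext)
  fix N
  obtain p :: 'o where p: "finite_residue_dvr p (residue_card TYPE('o))"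
    using compact_dvr_uniformizer[OF assms(2)] by blast
  interpret finite_residue_dvr p q using p assms(3) by simp
  have "heis_zeta TYPE('o) n $ N = of_nat (num_subalgebras TYPE('o) n (q ^ N))"
    by (simp add: heis_zeta_def assms(3))
  then show "heis_zeta TYPE('o) n $ N = (\<Sum>w\<in>heis_W n. fps_const (heis_C q n w) *
       augmented_igusa n (1 / of_nat q ^ 2) (heis_X q n w)) $ N"
    unfolding num_subalgebras_eq heis_igusa_nth[OF assms(1) q_ge_2] .
qed

end
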